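(* Let $N\ge4$ and let $g^\partial=e^*\eta$ be degenerate. Given any $\widetilde\omega\in\Omega_\partial^{1,2}$, there is a unique decomposition $\widetilde\omega=\omega+v$ with $\omega$ and $v$ satisfying \begin{align*} &e^{N-3}v=0,\\ &e_ne^{N-4}d_\omega e-e_ne^{N-4}p_{\mathcal T}(d_\omega e)\in\mathrm{Im}\,W_{N-3}^{\partial,(1,1)},\\ &p_{\mathcal K}v=0. \end{align*}
   Context: $\Sigma$ is the $(N-1)$-dimensional boundary of an oriented $N$-manifold; $\mathcal V_\Sigma\to\Sigma$ is a rank-$N$ bundle with fibrewise Lorentzian inner product $\eta$ (the restriction of the bundle associated to an $SO(N-1,1)$-principal bundle on the bulk); $\Omega^{i,j}_\partial=\Omega^i(\Sigma,\bigwedge^j\mathcal V_\Sigma)$, with wedge product in both factors (wedge symbols omitted), graded commutative for the total degree. $e\in\Omega_\partial^{1,1}$ is a boundary coframe, i.e. an injective bundle map $T\Sigma\to\mathcal V_\Sigma$; $g^\partial=e^*\eta$ is the induced boundary metric (when degenerate, it has one-dimensional kernel, since $\eta$ is Lorentzian); $e_n\in\Omega_\partial^{0,1}$ is a section completing $e(T\Sigma)$ to a frame of $\mathcal V_\Sigma$. Orthogonal connections $\omega$ on $\mathcal V_\Sigma$ are identified with elements of $\Omega_\partial^{1,2}$ by fixing a reference connection (using $\mathfrak{so}(N-1,1)\cong\bigwedge^2V$, $V$ the fibre), and $d_\omega$ is the covariant derivative. For $A\in\Omega_\partial^{i,j}$, $[A,e]\in\Omega_\partial^{i+1,j-1}$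 has components $\sum_{\sigma}\mathrm{sign}(\sigma)A^{a_1\dots a_j}_{\mu_{\sigma(1)}\dots\mu_{\sigma(i)}}\eta_{a_jb}e^b_{\mu_{\sigma(i+1)}}$, the sum being over permutations of $i+1$ elements. $W_k^{\partial,(i,j)}:\Omega_\partial^{i,j}\to\Omega_\partial^{i+k,j+k}$, $A\mapsto A\wedge e^k$; $\varrho^{(1,2)}:\Omega_\partial^{1,2}\to\Omega_\partial^{2,1}$, $A\mapsto[A,e]$. $J$ is a complement of $\varrho^{(1,2)}(\mathrm{Ker}\,W_{N-3}^{\partial,(1,2)})$ in $\Omega_\partial^{2,1}$; $\mathcal T=\mathrm{Ker}\,W_{N-3}^{\partial,(2,1)}\cap J\subset\Omega_\partial^{2,1}$; $\mathcal K=\mathrm{Ker}\,W_{N-3}^{\partial,(1,2)}\cap\mathrm{Ker}\,\varrho^{(1,2)}\subset\Omega_\partial^{1,2}$; $p_{\mathcal T}:\Omega_\partial^{2,1}\to\mathcal T$ and $p_{\mathcal K}:\Omega_\partial^{1,2}\to\mathcal K$ are some projections onto these subspaces. (For example, $J$ may be taken to be the orthogonal complement, and $p_{\mathcal T},p_{\mathcal K}$ the orthogonal projections, with respect to an arbitrarily chosen Riemannian metric on $\Sigma$ extended to these spaces.)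
   Formalization: The projection p_T is additionally required to vanish on eγ for all γ in Ω^{1,0} and on e_nβ for all β in Ω^{2,0}; for an arbitrary projection p_T existence of the decomposition can fail, and this condition is exactly what makes the claim hold for every ω̃. *)

theory Defs
  imports
    "HOL-Analysis.Analysis"
    "HOL-Combinatorics.Permutations"
    "HOL-Library.Function_Algebras"
begin

section \<open>Smooth maps on open sets\<close>

primrec Ck_on :: "nat \<Rightarrow> 'a::real_normed_vector set \<Rightarrow> ('a \<Rightarrow> 'b::real_normed_vector) \<Rightarrow> bool" where
  "Ck_on 0 S f \<longleftrightarrow> continuous_on S f"
| "Ck_on (Suc k) S f \<longleftrightarrow> (\<forall>x\<in>S. f differentiable (at x)) \<and>
     (\<forall>v. Ck_on k S (\<lambda>x. frechet_derivative f (at x) v))"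

definition smooth_on :: "'a::real_normed_vector set \<Rightarrow> ('a \<Rightarrow> 'b::real_normed_vector) \<Rightarrow> bool" where
  "smooth_on S f \<longleftrightarrow> (\<forall>k. Ck_on k S f)"


section \<open>Oriented manifolds with an associated \<open>SO(N-1,1)\<close>-bundle\<close>

text \<open>
  The base is the space of points \<open>'p\<close>, of dimension \<open>CARD('m)\<close>; the fibre has dimension
  \<open>CARD('n)\<close>. The atlas is indexed by \<open>'c\<close>, and over each chart domain the bundle is trivialised
  by a pseudo-orthonormal frame, so that fibre vectors over an overlap have components related by
  \<open>v\<^sub>\<alpha> = gtrans \<alpha> \<beta> v\<^sub>\<beta>\<close>. This is the description by a smooth \<open>SO(N-1,1)\<close>-cocycle of the
  bundle associated to a principal bundle. The index \<open>tidx\<close> is the negative direction of the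
  Minkowski form.
\<close>

record ('p, 'c, 'm, 'n) lbundle =
  cdom :: "'c \<Rightarrow> 'p set"
  chart :: "'c \<Rightarrow> 'p \<Rightarrow> real ^ 'm"
  gtrans :: "'c \<Rightarrow> 'c \<Rightarrow> 'p \<Rightarrow> real ^ 'n ^ 'n"
  tidx :: 'n

definition coord :: "('p, 'c, 'm::finite, 'n::finite) lbundle \<Rightarrow> 'c \<Rightarrow> real ^ 'm \<Rightarrow> 'p" where
  "coord B \<alpha> = inv_into (cdom B \<alpha>) (chart B \<alpha>)"

definition eta :: "('p, 'c, 'm::finite, 'n::finite) lbundle \<Rightarrow> real ^ 'n ^ 'n" where
  "eta B = (\<chi> a b. if a \<noteq> b then 0 else if a = tidx B then -1 else 1)"

text \<open>\<open>jac B \<alpha> \<beta> p $ \<nu> $ \<mu>\<close> is the partial derivative of the coordinate \<open>x\<^sub>\<beta>\<^sup>\<nu>\<close> along \<open>x\<^sub>\<alpha>\<^sup>\<mu>\<close>.\<close>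

definition jac :: "('p, 'c, 'm::finite, 'n::finite) lbundle \<Rightarrow> 'c \<Rightarrow> 'c \<Rightarrow> 'p \<Rightarrow> real ^ 'm ^ 'm" where
  "jac B \<alpha> \<beta> p =
     matrix (frechet_derivative (\<lambda>x. chart B \<beta> (coord B \<alpha> x)) (at (chart B \<alpha> p)))"

definition lorentz_bundle ::
  "('p::{t2_space, second_countable_topology}, 'c, 'm::finite, 'n::finite) lbundle \<Rightarrow> bool" where
  "lorentz_bundle B \<longleftrightarrow>
     (\<Union>\<alpha>. cdom B \<alpha>) = UNIV \<and>
     (\<forall>\<alpha>. open (cdom B \<alpha>) \<and> open (chart B \<alpha> ` cdom B \<alpha>) \<and>
          homeomorphism (cdom B \<alpha>) (chart B \<alpha> ` cdom B \<alpha>) (chart B \<alpha>) (coord B \<alpha>)) \<and>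
     (\<forall>\<alpha> \<beta>. smooth_on (chart B \<alpha> ` (cdom B \<alpha> \<inter> cdom B \<beta>)) (\<lambda>x. chart B \<beta> (coord B \<alpha> x))) \<and>
     (\<forall>\<alpha> \<beta>. \<forall>p \<in> cdom B \<alpha> \<inter> cdom B \<beta>. det (jac B \<alpha> \<beta> p) > 0) \<and>
     (\<forall>\<alpha> \<beta>. smooth_on (chart B \<alpha> ` (cdom B \<alpha> \<inter> cdom B \<beta>)) (\<lambda>x. gtrans B \<alpha> \<beta> (coord B \<alpha> x))) \<and>
     (\<forall>\<alpha> \<beta>. \<forall>p \<in> cdom B \<alpha> \<inter> cdom B \<beta>.
          transpose (gtrans B \<alpha> \<beta> p) ** eta B ** gtrans B \<alpha> \<beta> p = eta B \<and>
          det (gtrans B \<alpha> \<beta> p) = 1) \<and>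
     (\<forall>\<alpha>. \<forall>p \<in> cdom B \<alpha>. gtrans B \<alpha> \<alpha> p = mat 1) \<and>
     (\<forall>\<alpha> \<beta> \<gamma>. \<forall>p \<in> cdom B \<alpha> \<inter> cdom B \<beta> \<inter> cdom B \<gamma>.
          gtrans B \<alpha> \<beta> p ** gtrans B \<beta> \<gamma> p = gtrans B \<alpha> \<gamma> p)"


section \<open>The algebra of bundle-valued forms at a point\<close>

text \<open>
  The space of forms of degree \<open>(i,j)\<close> at a point is the part of bidegree \<open>(i,j)\<close> of the exterior
  algebra of the direct sum of cotangent space and fibre. Its product is the wedge product in both
  factors, with the signs that make it graded commutative for the total degree \<open>i + j\<close>.
  An element is given by its alternating components: a list entry \<open>Inl \<mu>\<close> is a form index, an entry
  \<open>Inr a\<close> a fibre index, and the component with form indices \<open>\<mu>s\<close> and fibre indices \<open>as\<close> is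
  \<open>A (map Inl \<mu>s @ map Inr as)\<close>.
\<close>

type_synonym ('m, 'n) ext = "('m + 'n) list \<Rightarrow> real"

definition bidegree :: "nat \<Rightarrow> nat \<Rightarrow> ('m, 'n) ext \<Rightarrow> bool" where
  "bidegree i j A \<longleftrightarrow>
     (\<forall>xs. A xs \<noteq> 0 \<longrightarrow> length (filter isl xs) = i \<and> length (filter (\<lambda>x. \<not> isl x) xs) = j) \<and>
     (\<forall>xs \<sigma>. \<sigma> permutes {..<length xs} \<longrightarrow> A (permute_list \<sigma> xs) = of_int (sign \<sigma>) * A xs)"

definition ext_one :: "('m, 'n) ext" where
  "ext_one xs = (if xs = [] then 1 else 0)"

definition wedge :: "('m, 'n) ext \<Rightarrow> ('m, 'n) ext \<Rightarrow> ('m, 'n) ext" where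
  "wedge A B xs = (\<Sum>k\<le>length xs. 1 / (fact k * fact (length xs - k)) *
     (\<Sum>\<sigma> | \<sigma> permutes {..<length xs}.
        of_int (sign \<sigma>) * A (take k (permute_list \<sigma> xs)) * B (drop k (permute_list \<sigma> xs))))"

text \<open>\<open>dx_wedge F\<close> is the sum over \<open>\<mu>\<close> of \<open>dx\<^sup>\<mu> \<and> F \<mu>\<close>.\<close>

definition dx_wedge :: "('m \<Rightarrow> ('m, 'n) ext) \<Rightarrow> ('m, 'n) ext" where
  "dx_wedge F xs = (\<Sum>k<length xs. case xs ! k of
      Inl \<mu> \<Rightarrow> (-1) ^ k * F \<mu> (take k xs @ drop (Suc k) xs)
    | Inr a \<Rightarrow> 0)"


section \<open>Smooth sections\<close>

text \<open>
  A section is the family of its components in all charts, which are set to zero off the chart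
  domain, so that equal sections are equal functions.
\<close>

type_synonym ('p, 'c, 'm, 'n) field = "'c \<Rightarrow> 'p \<Rightarrow> ('m, 'n) ext"

definition index_change ::
  "('p, 'c, 'm::finite, 'n::finite) lbundle \<Rightarrow> 'c \<Rightarrow> 'c \<Rightarrow> 'p \<Rightarrow> 'm + 'n \<Rightarrow> 'm + 'n \<Rightarrow> real" where
  "index_change B \<alpha> \<beta> p x y = (case (x, y) of
      (Inl \<mu>, Inl \<nu>) \<Rightarrow> jac B \<alpha> \<beta> p $ \<nu> $ \<mu>
    | (Inr a, Inr b) \<Rightarrow> gtrans B \<alpha> \<beta> p $ a $ b
    | _ \<Rightarrow> 0)"

definition Omega ::
  "('p::topological_space, 'c, 'm::finite, 'n::finite) lbundle \<Rightarrow> nat \<Rightarrow> nat \<Rightarrow>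
     ('p, 'c, 'm, 'n) field set" where
  "Omega B i j = {A.
     (\<forall>\<alpha> p. p \<notin> cdom B \<alpha> \<longrightarrow> A \<alpha> p = 0) \<and>
     (\<forall>\<alpha>. \<forall>p \<in> cdom B \<alpha>. bidegree i j (A \<alpha> p)) \<and>
     (\<forall>\<alpha> xs. smooth_on (chart B \<alpha> ` cdom B \<alpha>) (\<lambda>x. A \<alpha> (coord B \<alpha> x) xs)) \<and>
     (\<forall>\<alpha> \<beta>. \<forall>p \<in> cdom B \<alpha> \<inter> cdom B \<beta>. \<forall>xs.
        A \<alpha> p xs = (\<Sum>ys | length ys = length xs.
           (\<Prod>k<length xs. index_change B \<alpha> \<beta> p (xs ! k) (ys ! k)) * A \<beta> p ys))}"

definition fwedge ::
  "('p, 'c, 'm, 'n) field \<Rightarrow> ('p, 'c, 'm, 'n) field \<Rightarrow> ('p, 'c, 'm, 'n) field" where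
  "fwedge A C = (\<lambda>\<alpha> p. wedge (A \<alpha> p) (C \<alpha> p))"

primrec fpow :: "('p, 'c, 'm, 'n) field \<Rightarrow> nat \<Rightarrow> ('p, 'c, 'm, 'n) field" where
  "fpow e 0 = (\<lambda>\<alpha> p. ext_one)"
| "fpow e (Suc k) = fwedge e (fpow e k)"

definition fscale :: "real \<Rightarrow> ('p, 'c, 'm, 'n) field \<Rightarrow> ('p, 'c, 'm, 'n) field" where
  "fscale c A = (\<lambda>\<alpha> p xs. c * A \<alpha> p xs)"

lemma vector_space_fscale: "vector_space fscale"
  by unfold_locales (auto simp: fscale_def fun_eq_iff algebra_simps)

definition complement_in ::
  "('p, 'c, 'm, 'n) field set \<Rightarrow> ('p, 'c, 'm, 'n) field set \<Rightarrow> ('p, 'c, 'm, 'n) field set \<Rightarrow> bool" where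
  "complement_in E S J \<longleftrightarrow> J \<subseteq> E \<and> module.subspace fscale J \<and>
     S \<inter> J = {0} \<and> (\<forall>A\<in>E. \<exists>s\<in>S. \<exists>t\<in>J. A = s + t)"

definition projection_onto ::
  "('p, 'c, 'm, 'n) field set \<Rightarrow> ('p, 'c, 'm, 'n) field set \<Rightarrow>
     (('p, 'c, 'm, 'n) field \<Rightarrow> ('p, 'c, 'm, 'n) field) \<Rightarrow> bool" where
  "projection_onto E S P \<longleftrightarrow>
     (\<forall>A\<in>E. \<forall>C\<in>E. P (A + C) = P A + P C) \<and>
     (\<forall>c. \<forall>A\<in>E. P (fscale c A) = fscale c (P A)) \<and>
     (\<forall>A\<in>E. P A \<in> S) \<and> (\<forall>A\<in>S. P A = A)"


section \<open>Boundary coframes\<close>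

definition coframe_map :: "('p, 'c, 'm::finite, 'n::finite) field \<Rightarrow> 'c \<Rightarrow> 'p \<Rightarrow> real ^ 'm \<Rightarrow> real ^ 'n" where
  "coframe_map e \<alpha> p u = (\<chi> a. \<Sum>\<mu>\<in>UNIV. e \<alpha> p [Inl \<mu>, Inr a] * u $ \<mu>)"

definition boundary_coframe ::
  "('p::topological_space, 'c, 'm::finite, 'n::finite) lbundle \<Rightarrow> ('p, 'c, 'm, 'n) field \<Rightarrow> bool" where
  "boundary_coframe B e \<longleftrightarrow> e \<in> Omega B 1 1 \<and>
     (\<forall>\<alpha>. \<forall>p \<in> cdom B \<alpha>. inj (coframe_map e \<alpha> p))"

definition completes_frame ::
  "('p::topological_space, 'c, 'm::finite, 'n::finite) lbundle \<Rightarrow>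
     ('p, 'c, 'm, 'n) field \<Rightarrow> ('p, 'c, 'm, 'n) field \<Rightarrow> bool" where
  "completes_frame B e en \<longleftrightarrow> en \<in> Omega B 0 1 \<and>
     (\<forall>\<alpha>. \<forall>p \<in> cdom B \<alpha>.
        span (insert (\<chi> a. en \<alpha> p [Inr a]) (range (coframe_map e \<alpha> p))) = UNIV)"

definition boundary_metric ::
  "('p, 'c, 'm::finite, 'n::finite) lbundle \<Rightarrow> ('p, 'c, 'm, 'n) field \<Rightarrow>
     'c \<Rightarrow> 'p \<Rightarrow> real ^ 'm \<Rightarrow> real ^ 'm \<Rightarrow> real" where
  "boundary_metric B e \<alpha> p u w = coframe_map e \<alpha> p u \<bullet> (eta B *v coframe_map e \<alpha> p w)"

definition degenerate_metric ::
  "('p, 'c, 'm::finite, 'n::finite) lbundle \<Rightarrow> ('p, 'c, 'm, 'n) field \<Rightarrow> bool" where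
  "degenerate_metric B e \<longleftrightarrow>
     (\<forall>\<alpha>. \<forall>p \<in> cdom B \<alpha>. \<exists>u. u \<noteq> 0 \<and> (\<forall>w. boundary_metric B e \<alpha> p u w = 0))"


section \<open>Connections and the covariant derivative\<close>

text \<open>
  \<open>G \<alpha> p \<mu> $ a $ b\<close> are the coefficients of the connection form in the chart \<open>\<alpha>\<close>: the derivative of
  a section \<open>v\<close> of the bundle is \<open>\<partial>\<^sub>\<mu> v\<^sup>a + G\<^sub>\<mu>\<^sup>a\<^sub>b v\<^sup>b\<close>. The last condition is the gauge
  transformation law, multiplied from the right by \<open>gtrans\<close>.
\<close>

definition orth_connection ::
  "('p::topological_space, 'c, 'm::finite, 'n::finite) lbundle \<Rightarrow>
     ('c \<Rightarrow> 'p \<Rightarrow> 'm \<Rightarrow> real ^ 'n ^ 'n) \<Rightarrow> bool" where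
  "orth_connection B G \<longleftrightarrow>
     (\<forall>\<alpha> \<mu>. smooth_on (chart B \<alpha> ` cdom B \<alpha>) (\<lambda>x. G \<alpha> (coord B \<alpha> x) \<mu>)) \<and>
     (\<forall>\<alpha> \<mu>. \<forall>p \<in> cdom B \<alpha>. transpose (G \<alpha> p \<mu>) ** eta B + eta B ** G \<alpha> p \<mu> = 0) \<and>
     (\<forall>\<alpha> \<beta> \<mu>. \<forall>p \<in> cdom B \<alpha> \<inter> cdom B \<beta>.
        G \<alpha> p \<mu> ** gtrans B \<alpha> \<beta> p
          + frechet_derivative (\<lambda>x. gtrans B \<alpha> \<beta> (coord B \<alpha> x)) (at (chart B \<alpha> p)) (axis \<mu> 1)
        = (\<Sum>\<nu>\<in>UNIV. (jac B \<alpha> \<beta> p $ \<nu> $ \<mu>) *\<^sub>R (gtrans B \<alpha> \<beta> p ** G \<beta> p \<nu>)))"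

text \<open>
  The connection identified with \<open>w\<close> of degree \<open>(1,2)\<close> by the reference connection \<open>G0\<close>; a
  bivector acts on the fibre by \<open>v\<^sup>a \<mapsto> w\<^sup>a\<^sup>c \<eta>\<^sub>c\<^sub>b v\<^sup>b\<close>.
\<close>

definition connection_of ::
  "('p, 'c, 'm::finite, 'n::finite) lbundle \<Rightarrow> ('c \<Rightarrow> 'p \<Rightarrow> 'm \<Rightarrow> real ^ 'n ^ 'n) \<Rightarrow>
     ('p, 'c, 'm, 'n) field \<Rightarrow> 'c \<Rightarrow> 'p \<Rightarrow> 'm \<Rightarrow> real ^ 'n ^ 'n" where
  "connection_of B G0 w \<alpha> p \<mu> =
     (\<chi> a b. G0 \<alpha> p \<mu> $ a $ b + (\<Sum>c\<in>UNIV. w \<alpha> p [Inl \<mu>, Inr a, Inr c] * eta B $ c $ b))"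

definition cov_deriv ::
  "('p::topological_space, 'c, 'm::finite, 'n::finite) lbundle \<Rightarrow>
     ('c \<Rightarrow> 'p \<Rightarrow> 'm \<Rightarrow> real ^ 'n ^ 'n) \<Rightarrow> ('p, 'c, 'm, 'n) field \<Rightarrow> ('p, 'c, 'm, 'n) field" where
  "cov_deriv B G A \<alpha> p = (if p \<in> cdom B \<alpha> then
     dx_wedge (\<lambda>\<mu> ys.
       frechet_derivative (\<lambda>x. A \<alpha> (coord B \<alpha> x) ys) (at (chart B \<alpha> p)) (axis \<mu> 1)
       + (\<Sum>l<length ys. case ys ! l of
            Inl \<nu> \<Rightarrow> 0
          | Inr a \<Rightarrow> (\<Sum>b\<in>UNIV. G \<alpha> p \<mu> $ a $ b * A \<alpha> p (ys[l := Inr b]))))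
     else 0)"

definition d_conn ::
  "('p::topological_space, 'c, 'm::finite, 'n::finite) lbundle \<Rightarrow>
     ('c \<Rightarrow> 'p \<Rightarrow> 'm \<Rightarrow> real ^ 'n ^ 'n) \<Rightarrow> ('p, 'c, 'm, 'n) field \<Rightarrow>
     ('p, 'c, 'm, 'n) field \<Rightarrow> ('p, 'c, 'm, 'n) field" where
  "d_conn B G0 w = cov_deriv B (connection_of B G0 w)"

lemma d_conn_coframe_component:
  assumes "p \<in> cdom B \<alpha>"
  shows "d_conn B G0 w e \<alpha> p [Inl \<mu>, Inl \<nu>, Inr a] =
      frechet_derivative (\<lambda>x. e \<alpha> (coord B \<alpha> x) [Inl \<nu>, Inr a]) (at (chart B \<alpha> p)) (axis \<mu> 1)
    - frechet_derivative (\<lambda>x. e \<alpha> (coord B \<alpha> x) [Inl \<mu>, Inr a]) (at (chart B \<alpha> p)) (axis \<nu> 1)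
    + (\<Sum>b\<in>UNIV. connection_of B G0 w \<alpha> p \<mu> $ a $ b * e \<alpha> p [Inl \<nu>, Inr b])
    - (\<Sum>b\<in>UNIV. connection_of B G0 w \<alpha> p \<nu> $ a $ b * e \<alpha> p [Inl \<mu>, Inr b])"
  using assms by (simp add: d_conn_def cov_deriv_def dx_wedge_def numeral_eq_Suc lessThan_Suc)


section \<open>The maps \<open>W\<close> and \<open>\<rho>\<close>, and the spaces built from them\<close>

definition W :: "('p, 'c, 'm, 'n) field \<Rightarrow> nat \<Rightarrow> ('p, 'c, 'm, 'n) field \<Rightarrow> ('p, 'c, 'm, 'n) field" where
  "W e k A = fwedge A (fpow e k)"

definition kerW ::
  "('p::topological_space, 'c, 'm::finite, 'n::finite) lbundle \<Rightarrow> ('p, 'c, 'm, 'n) field \<Rightarrow>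
     nat \<Rightarrow> nat \<Rightarrow> nat \<Rightarrow> ('p, 'c, 'm, 'n) field set" where
  "kerW B e k i j = {A \<in> Omega B i j. W e k A = 0}"

definition imW ::
  "('p::topological_space, 'c, 'm::finite, 'n::finite) lbundle \<Rightarrow> ('p, 'c, 'm, 'n) field \<Rightarrow>
     nat \<Rightarrow> nat \<Rightarrow> nat \<Rightarrow> ('p, 'c, 'm, 'n) field set" where
  "imW B e k i j = W e k ` Omega B i j"

text \<open>
  \<open>[A,e]\<close> for \<open>A\<close> with one form index. Moving the form index of \<open>e\<close>, which the component formula
  puts last, to the front accounts for the minus sign.
\<close>

definition rho ::
  "('p, 'c, 'm::finite, 'n::finite) lbundle \<Rightarrow> ('p, 'c, 'm, 'n) field \<Rightarrow>
     ('p, 'c, 'm, 'n) field \<Rightarrow> ('p, 'c, 'm, 'n) field" where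
  "rho B e A \<alpha> p = - dx_wedge (\<lambda>\<nu> ys.
     \<Sum>a\<in>UNIV. \<Sum>b\<in>UNIV. A \<alpha> p (ys @ [Inr a]) * eta B $ a $ b * e \<alpha> p [Inl \<nu>, Inr b])"

lemma rho_component:
  "rho B e A \<alpha> p [Inl \<mu>, Inl \<nu>, Inr c] =
      (\<Sum>a\<in>UNIV. \<Sum>b\<in>UNIV. A \<alpha> p [Inl \<mu>, Inr c, Inr a] * eta B $ a $ b * e \<alpha> p [Inl \<nu>, Inr b])
    - (\<Sum>a\<in>UNIV. \<Sum>b\<in>UNIV. A \<alpha> p [Inl \<nu>, Inr c, Inr a] * eta B $ a $ b * e \<alpha> p [Inl \<mu>, Inr b])"
  by (simp add: rho_def dx_wedge_def numeral_eq_Suc lessThan_Suc)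

definition T_space ::
  "('p::topological_space, 'c, 'm::finite, 'n::finite) lbundle \<Rightarrow> ('p, 'c, 'm, 'n) field \<Rightarrow>
     ('p, 'c, 'm, 'n) field set \<Rightarrow> ('p, 'c, 'm, 'n) field set" where
  "T_space B e J = kerW B e (CARD('n) - 3) 2 1 \<inter> J"

definition K_space ::
  "('p::topological_space, 'c, 'm::finite, 'n::finite) lbundle \<Rightarrow> ('p, 'c, 'm, 'n) field \<Rightarrow>
     ('p, 'c, 'm, 'n) field set" where
  "K_space B e = kerW B e (CARD('n) - 3) 1 2 \<inter> {A \<in> Omega B 1 2. rho B e A = 0}"

end

theory Submission
  imports Defs
begin

text \<open>
  With \<open>m = N - 1\<close>, multiplication by \<open>e\<close> and the contraction \<open>\<Lambda>\<close> with the dual coframe satisfy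
  \<open>[\<Lambda>, e] = m - i - j\<close> on tangential forms of degree \<open>(i, j)\<close>, and the Lefschetz argument shows that
  \<open>e\<^sup>k\<close> is injective on the tangential forms with \<open>i + j + k \<le> m\<close> that are needed here. This gives
  \<open>\<Omega>\<^sup>2\<^sup>,\<^sup>1 = Ker W\<^sub>N\<^sub>-\<^sub>3 \<oplus> Z\<close> with \<open>Z = e \<Omega>\<^sup>1\<^sup>,\<^sup>0 + e\<^sub>n \<Omega>\<^sup>2\<^sup>,\<^sup>0\<close>, where \<open>Z\<close> consists of the forms that
  \<open>e\<^sub>n e\<^sup>N\<^sup>-\<^sup>4\<close> maps into \<open>Im W\<^sub>N\<^sub>-\<^sub>3\<close>. Since \<open>\<rho>\<close> is a derivation killing \<open>e\<close>, it maps \<open>Ker W\<^sub>N\<^sub>-\<^sub>3\<close> into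
  \<open>Ker W\<^sub>N\<^sub>-\<^sub>3\<close>, which is therefore \<open>\<rho>(Ker W\<^sub>N\<^sub>-\<^sub>3) \<oplus> \<T>\<close>. As \<open>d\<^sub>\<omega> e\<close> is affine in \<open>\<omega>\<close> with linear part \<open>\<rho>\<close>,
  and \<open>p\<^sub>\<T>\<close> is a projection vanishing on \<open>Z\<close>, the condition on \<open>\<omega>\<close> says that \<open>\<rho> v\<close> is the
  \<open>\<rho>(Ker W\<^sub>N\<^sub>-\<^sub>3)\<close>-component of the torsion of the given connection. This fixes \<open>v\<close> up to \<open>\<K>\<close>, and
  \<open>p\<^sub>\<K> v = 0\<close> removes the remaining freedom.
\<close>

section \<open>Permutations of lists and the wedge product\<close>

text \<open>The exponents sit exactly at the limit of the Lefschetz range. In degree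
  \<open>(2, 1)\<close> the power e^(m-3) is still injective on tangential forms, since 2 + 1 + (m -
  3) = m, whereas e^(m-2) is one step too far: its kernel in that degree consists of the tangential
  forms killed by \<Lambda>. Such forms are invisible to W but are detected by e_n e^(m-3) modulo Im
  W, and this contrast lets the structural condition determine the Ker W component of the torsion.
  J, pT and pK are only real-linear data on spaces of global sections, so \<T> and \<K> are split
  off there by linear algebra. The splitting into Ker W and Z has to be constructed as a splitting
  into smooth global sections. It is computed in each chart from a dual frame; Cramer's rule gives
  smoothness, and uniqueness of the parts at each point gives the transition law without a
  computation. For the same reason the torsion of the reference connection has to be shown to be a
  section, which needs the symmetry of the second derivatives of the transition maps.\<close>

definition alternating :: "('a list \<Rightarrow> real) \<Rightarrow> bool" where
  "alternating A \<longleftrightarrow>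
     (\<forall>xs \<sigma>. \<sigma> permutes {..<length xs} \<longrightarrow> A (permute_list \<sigma> xs) = of_int (sign \<sigma>) * A xs)"

text \<open>The interior product with a basis vector, on components.\<close>

definition slot :: "'a \<Rightarrow> ('a list \<Rightarrow> real) \<Rightarrow> 'a list \<Rightarrow> real" where
  "slot x A ys = A (x # ys)"

text \<open>The grading involution: it carries the sign that an odd operator acquires on passing
  \<open>A\<close>.\<close>

definition invol :: "('a list \<Rightarrow> real) \<Rightarrow> 'a list \<Rightarrow> real" where
  "invol A xs = (-1) ^ length xs * A xs"

abbreviation "swap_perm \<equiv> Transposition.transpose"

lemma alternatingD:
  "alternating A \<Longrightarrow> \<sigma> permutes {..<length xs} \<Longrightarrow>
    A (permute_list \<sigma> xs) = of_int (sign \<sigma>) * A xs"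
  by (auto simp: alternating_def)

section \<open>Permutations fixing the head of a list, and cycles\<close>

lemma permutation_lessThan: "\<sigma> permutes {..<n::nat} \<Longrightarrow> permutation \<sigma>"
  using permutation_permutes by blast

text \<open>The embedding of the permutations of n letters as the stabiliser of 0 in those of n + 1
  letters.\<close>

definition shift_perm :: "(nat \<Rightarrow> nat) \<Rightarrow> nat \<Rightarrow> nat" where
  "shift_perm \<sigma> i = (case i of 0 \<Rightarrow> 0 | Suc j \<Rightarrow> Suc (\<sigma> j))"

lemma shift_perm_simps [simp]: "shift_perm \<sigma> 0 = 0" "shift_perm \<sigma> (Suc j) = Suc (\<sigma> j)"
  by (auto simp: shift_perm_def)

lemma shift_perm_permutes:
  assumes "\<sigma> permutes {..<n}"
  shows "shift_perm \<sigma> permutes {..<Suc n}"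
  unfolding permutes_def
proof (intro conjI allI impI)
  fix i assume "i \<notin> {..<Suc n}"
  then show "shift_perm \<sigma> i = i"
    using assms by (cases i) (auto simp: permutes_def)
next
  fix y
  show "\<exists>!i. shift_perm \<sigma> i = y"
  proof (cases y)
    case 0
    show ?thesis
    proof (rule ex1I[of _ 0])
      show "i = 0" if "shift_perm \<sigma> i = y" for i
        using that 0 by (cases i) simp_all
    qed (simp add: 0)
  next
    case (Suc z)
    obtain j where j: "\<sigma> j = z" "\<And>j'. \<sigma> j' = z \<Longrightarrow> j' = j"
      using assms unfolding permutes_def by metis
    show ?thesis
    proof (rule ex1I[of _ "Suc j"])
      show "shift_perm \<sigma> (Suc j) = y" using j(1) Suc by simp
      show "i = Suc j" if "shift_perm \<sigma> i = y" for i
      proof (cases i)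
        case (Suc i')
        then show ?thesis using that j(2)[of i'] \<open>y = Suc z\<close> by simp
      qed (use that Suc in simp)
    qed
  qed
qed

lemma sign_shift_perm:
  assumes "\<sigma> permutes {..<n}"
  shows "sign (shift_perm \<sigma>) = sign \<sigma>"
proof -
  have "finite {..<n}" by simp
  with assms show ?thesis
  proof (induction \<sigma> rule: permutes_induct)
    case id
    have "shift_perm id = id" by (auto simp: fun_eq_iff shift_perm_def split: nat.splits)
    then show ?case by (simp add: id_def)
  next
    case (swap a b p)
    have eq: "shift_perm (swap_perm a b \<circ> p)
        = swap_perm (Suc a) (Suc b) \<circ> shift_perm p"
      by (auto simp: fun_eq_iff shift_perm_def Transposition.transpose_def split: nat.splits)
    have "permutation p" "permutation (shift_perm p)"
      using swap shift_perm_permutes permutation_lessThan by blast+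
    then show ?case
      unfolding eq using swap by (simp add: sign_compose permutation_swap_id sign_swap_id del: o_apply)
  qed
qed

lemma permute_list_shift_perm:
  "permute_list (shift_perm \<sigma>) (x # xs) = x # permute_list \<sigma> xs"
  by (simp add: permute_list_def map_upt_Suc del: upt_Suc)

lemma bij_betw_shift_perm:
  "bij_betw shift_perm {\<sigma>. \<sigma> permutes {..<n}} {\<sigma>. \<sigma> permutes {..<Suc n} \<and> \<sigma> 0 = 0}"
  unfolding bij_betw_def
proof
  show "inj_on shift_perm {\<sigma>. \<sigma> permutes {..<n}}"
  proof (rule inj_onI)
    fix \<sigma> \<tau> assume eq: "shift_perm \<sigma> = shift_perm \<tau>"
    show "\<sigma> = \<tau>"
    proof
      show "\<sigma> i = \<tau> i" for i using fun_cong[OF eq, of "Suc i"] by simp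
    qed
  qed
  show "shift_perm ` {\<sigma>. \<sigma> permutes {..<n}} = {\<sigma>. \<sigma> permutes {..<Suc n} \<and> \<sigma> 0 = 0}"
  proof (intro equalityI subsetI)
    fix \<tau> assume "\<tau> \<in> {\<sigma>. \<sigma> permutes {..<Suc n} \<and> \<sigma> 0 = 0}"
    then have p: "\<tau> permutes {..<Suc n}" and z: "\<tau> 0 = 0" by auto
    have nz: "\<tau> (Suc i) \<noteq> 0" for i
      using permutes_inj[OF p] z by (metis injD nat.distinct(1))
    define \<sigma> where "\<sigma> i = \<tau> (Suc i) - 1" for i
    have S: "\<tau> (Suc i) = Suc (\<sigma> i)" for i
      using nz[of i] by (simp add: \<sigma>_def)
    have "\<tau> = shift_perm \<sigma>"
      using z S by (auto simp: fun_eq_iff shift_perm_def split: nat.splits)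
    moreover have "\<sigma> permutes {..<n}"
      unfolding permutes_def
    proof (intro conjI allI impI)
      fix i assume "i \<notin> {..<n}"
      then have "\<tau> (Suc i) = Suc i" using p by (auto simp: permutes_def)
      then show "\<sigma> i = i" using S by simp
    next
      fix y
      obtain j where j: "\<tau> j = Suc y" "\<And>j'. \<tau> j' = Suc y \<Longrightarrow> j' = j"
        using p unfolding permutes_def by metis
      obtain i where "j = Suc i" using j(1) z by (cases j) auto
      show "\<exists>!i. \<sigma> i = y"
      proof (rule ex1I[of _ i])
        show "\<sigma> i = y" using j(1) S[of i] \<open>j = Suc i\<close> by simp
        show "i' = i" if "\<sigma> i' = y" for i'
          using j(2)[of "Suc i'"] S[of i'] \<open>j = Suc i\<close> that by simp
      qed
    qed
    ultimately show "\<tau> \<in> shift_perm ` {\<sigma>. \<sigma> permutes {..<n}}" by auto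
  qed (auto simp: shift_perm_permutes)
qed

text \<open>The cycle that carries the head of a list to position \<open>k\<close>. Writing it as a
  product of \<open>k\<close> adjacent transpositions makes its sign immediate.\<close>

primrec cyc :: "nat \<Rightarrow> nat \<Rightarrow> nat" where
  "cyc 0 = id"
| "cyc (Suc k) = cyc k \<circ> swap_perm k (Suc k)"

lemma cyc_apply: "cyc k i = (if i < k then Suc i else if i = k then 0 else i)"
  by (induction k arbitrary: i) (auto simp: Transposition.transpose_def)

lemma cyc_permutes: "k < n \<Longrightarrow> cyc k permutes {..<n}"
proof (induction k)
  case (Suc k)
  then show ?case
    by (simp add: permutes_compose permutes_swap_id del: o_apply)
qed (simp add: permutes_id[unfolded id_def] id_def)

lemma sign_cyc: "sign (cyc k) = (-1) ^ k"
proof (induction k)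
  case (Suc k)
  have "permutation (cyc k)"
    using cyc_permutes[of k "Suc k"] permutation_lessThan by blast
  then show ?case
    using Suc by (simp add: sign_compose permutation_swap_id sign_swap_id del: o_apply)
qed simp

lemma permute_list_cyc:
  assumes "k \<le> length ys"
  shows "permute_list (cyc k) (y # ys) = take k ys @ y # drop k ys"
proof (rule nth_equalityI)
  fix i assume "i < length (permute_list (cyc k) (y # ys))"
  then have i: "i \<le> length ys" by simp
  have "permute_list (cyc k) (y # ys) ! i = (y # ys) ! cyc k i"
    using i cyc_permutes[of k "Suc (length ys)"] assms
    by (subst permute_list_nth) auto
  then show "permute_list (cyc k) (y # ys) ! i = (take k ys @ y # drop k ys) ! i"
    using assms i by (auto simp: cyc_apply nth_append nth_Cons' min_def)
qed (use assms in auto)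

lemma alternating_slot:
  assumes "alternating A"
  shows "alternating (slot x A)"
  unfolding alternating_def slot_def
proof (intro allI impI)
  fix xs :: "'a list" and \<sigma> assume \<sigma>: "\<sigma> permutes {..<length xs}"
  have "A (permute_list (shift_perm \<sigma>) (x # xs)) = of_int (sign (shift_perm \<sigma>)) * A (x # xs)"
    by (rule alternatingD[OF assms]) (use shift_perm_permutes[OF \<sigma>] in simp)
  then show "A (x # permute_list \<sigma> xs) = of_int (sign \<sigma>) * A (x # xs)"
    by (simp add: permute_list_shift_perm sign_shift_perm[OF \<sigma>])
qed

lemma alternating_invol: "alternating A \<Longrightarrow> alternating (invol A)"
  by (auto simp: alternating_def invol_def)

section \<open>Summands of the product under a transposition inside one factor\<close>

lemma take_permute_swap:
  assumes "a < k" "b < k" "k \<le> length zs"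
  shows "take k (permute_list (swap_perm a b) zs) = permute_list (swap_perm a b) (take k zs)"
    and "drop k (permute_list (swap_perm a b) zs) = drop k zs"
proof -
  have p: "swap_perm a b permutes {..<length zs}" and p': "swap_perm a b permutes {..<k}"
    using assms by (auto intro!: permutes_swap_id)
  show "take k (permute_list (swap_perm a b) zs) = permute_list (swap_perm a b) (take k zs)"
    by (rule nth_equalityI)
       (use assms p p' in \<open>simp_all add: permute_list_nth min.absorb2 Transposition.transpose_def\<close>)
  show "drop k (permute_list (swap_perm a b) zs) = drop k zs"
    by (rule nth_equalityI) (use assms p in \<open>auto simp: permute_list_nth Transposition.transpose_def\<close>)
qed

lemma drop_permute_swap:
  assumes "k \<le> a" "k \<le> b" "a < length zs" "b < length zs"
  shows "drop k (permute_list (swap_perm a b) zs)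
           = permute_list (swap_perm (a - k) (b - k)) (drop k zs)"
    and "take k (permute_list (swap_perm a b) zs) = take k zs"
proof -
  have p: "swap_perm a b permutes {..<length zs}"
      and p': "swap_perm (a - k) (b - k) permutes {..<length zs - k}"
    using assms by (auto intro!: permutes_swap_id)
  show "drop k (permute_list (swap_perm a b) zs)
           = permute_list (swap_perm (a - k) (b - k)) (drop k zs)"
    by (rule nth_equalityI)
       (use assms p p' in \<open>auto simp: permute_list_nth Transposition.transpose_def\<close>)
  show "take k (permute_list (swap_perm a b) zs) = take k zs"
    by (rule nth_equalityI) (use assms p in \<open>auto simp: permute_list_nth Transposition.transpose_def\<close>)
qed

definition wedge_term :: "('a list \<Rightarrow> real) \<Rightarrow> ('a list \<Rightarrow> real) \<Rightarrow> 'a list \<Rightarrow> nat \<Rightarrow> (nat \<Rightarrow> nat) \<Rightarrow> real" where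
  "wedge_term A B xs k \<sigma> =
     of_int (sign \<sigma>) * A (take k (permute_list \<sigma> xs)) * B (drop k (permute_list \<sigma> xs))"

text \<open>Both positions lie in the same factor, so the sign produced by the alternation of that
  factor cancels the change in \<open>sign \<sigma>\<close>.\<close>

lemma wedge_term_swap:
  assumes A: "alternating A" and B: "alternating B" and \<sigma>: "\<sigma> permutes {..<length xs}"
    and ab: "a < length xs" "b < length xs" "a < k \<longleftrightarrow> b < k" and k: "k \<le> length xs"
  shows "wedge_term A B xs k (\<sigma> \<circ> swap_perm a b) = wedge_term A B xs k \<sigma>"
proof (cases "a = b")
  case False
  let ?t = "swap_perm a b" and ?zs = "permute_list \<sigma> xs"
  have t: "?t permutes {..<length xs}" using ab by (auto intro!: permutes_swap_id)
  have pl: "permute_list (\<sigma> \<circ> ?t) xs = permute_list ?t ?zs"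
    by (rule permute_list_compose[OF t])
  have s: "sign (\<sigma> \<circ> ?t) = - sign \<sigma>"
    using \<sigma> False by (subst sign_compose) (simp_all add: sign_swap_id permutation_swap_id permutation_lessThan)
  show ?thesis
  proof (cases "a < k")
    case True
    have "A (permute_list ?t (take k ?zs)) = of_int (sign ?t) * A (take k ?zs)"
      by (rule alternatingD[OF A]) (use True ab k in \<open>auto intro!: permutes_swap_id\<close>)
    then show ?thesis
      using True ab k False unfolding wedge_term_def pl s
      by (simp add: take_permute_swap sign_swap_id)
  next
    case F: False
    have "B (permute_list (swap_perm (a - k) (b - k)) (drop k ?zs)) = of_int (sign (swap_perm (a - k) (b - k))) * B (drop k ?zs)"
      by (rule alternatingD[OF B]) (use F ab k in \<open>auto intro!: permutes_swap_id\<close>)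
    moreover have "a - k \<noteq> b - k" using F ab False by auto
    ultimately show ?thesis
      using F ab k False unfolding wedge_term_def pl s
      by (simp add: drop_permute_swap sign_swap_id)
  qed
qed simp

text \<open>The place where the head of the list lands may be moved freely within each of the two
  blocks of arguments.\<close>

lemma sum_wedge_term_swap:
  assumes A: "alternating A" and B: "alternating B"
    and ab: "a < length xs" "b < length xs" "a < k \<longleftrightarrow> b < k" and k: "k \<le> length xs"
  shows "(\<Sum>\<sigma> | \<sigma> permutes {..<length xs} \<and> \<sigma> a = 0. wedge_term A B xs k \<sigma>)
       = (\<Sum>\<sigma> | \<sigma> permutes {..<length xs} \<and> \<sigma> b = 0. wedge_term A B xs k \<sigma>)"
proof (rule sum.reindex_bij_witness[where i = "\<lambda>\<sigma>. \<sigma> \<circ> swap_perm a b" and j = "\<lambda>\<sigma>. \<sigma> \<circ> swap_perm a b"])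
  have t: "swap_perm a b permutes {..<length xs}" using ab by (auto intro!: permutes_swap_id)
  fix \<sigma> :: "nat \<Rightarrow> nat"
  show "\<sigma> \<circ> swap_perm a b \<circ> swap_perm a b = \<sigma>"
    "\<sigma> \<circ> swap_perm a b \<circ> swap_perm a b = \<sigma>" by (auto simp: fun_eq_iff)
  show "\<sigma> \<circ> swap_perm a b \<in> {\<sigma>. \<sigma> permutes {..<length xs} \<and> \<sigma> b = 0}"
    if "\<sigma> \<in> {\<sigma>. \<sigma> permutes {..<length xs} \<and> \<sigma> a = 0}"
    using that t by (auto intro!: permutes_compose simp del: o_apply) (simp)
  show "\<sigma> \<circ> swap_perm a b \<in> {\<sigma>. \<sigma> permutes {..<length xs} \<and> \<sigma> a = 0}"
    if "\<sigma> \<in> {\<sigma>. \<sigma> permutes {..<length xs} \<and> \<sigma> b = 0}"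
    using that t by (auto intro!: permutes_compose simp del: o_apply) (simp)
  show "wedge_term A B xs k (\<sigma> \<circ> swap_perm a b) = wedge_term A B xs k \<sigma>"
    if "\<sigma> \<in> {\<sigma>. \<sigma> permutes {..<length xs} \<and> \<sigma> a = 0}"
    using wedge_term_swap[OF A B _ ab k] that by auto
qed

text \<open>Permutations are classified by the position at which the head \<open>x\<close> lands:
  \<open>k\<close> positions belong to \<open>A\<close>, the others to \<open>B\<close>, and all
  positions of one block contribute equally. A head landing in \<open>B\<close> has to cross the
  \<open>k\<close> arguments of \<open>A\<close>, which accounts for \<open>invol A\<close>. The
  truncated \<open>k - 1\<close> at \<open>k = 0\<close> comes with coefficient zero.\<close>

lemma sum_wedge_term_Cons:
  assumes A: "alternating A" and B: "alternating B" and k: "k \<le> Suc (length xs)"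
  defines "P \<equiv> {\<sigma>. \<sigma> permutes {..<length xs}}"
  shows "(\<Sum>\<sigma> | \<sigma> permutes {..<Suc (length xs)}. wedge_term A B (x # xs) k \<sigma>) =
     real k * (\<Sum>\<sigma>\<in>P. wedge_term (slot x A) B xs (k - 1) \<sigma>) +
     real (Suc (length xs) - k) * (\<Sum>\<sigma>\<in>P. wedge_term (invol A) (slot x B) xs k \<sigma>)"
proof -
  let ?n = "length xs"
  let ?Q = "{\<sigma>. \<sigma> permutes {..<Suc ?n}}"
  let ?w = "wedge_term A B (x # xs) k"
  have fin: "finite ?Q" by (simp add: finite_permutations)
  have split: "(\<Sum>\<sigma>\<in>?Q. ?w \<sigma>) = (\<Sum>j<Suc ?n. \<Sum>\<sigma> | \<sigma> permutes {..<Suc ?n} \<and> \<sigma> j = 0. ?w \<sigma>)"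
  proof -
    have "(\<Sum>j\<in>{..<Suc ?n}. \<Sum>\<sigma>\<in>{\<sigma>\<in>?Q. inv \<sigma> 0 = j}. ?w \<sigma>) = (\<Sum>\<sigma>\<in>?Q. ?w \<sigma>)"
      by (rule sum.group[OF fin]) (use permutes_in_image[OF permutes_inv] in \<open>fastforce simp: lessThan_iff\<close>)+
    moreover have "{\<sigma>\<in>?Q. inv \<sigma> 0 = j} = {\<sigma>. \<sigma> permutes {..<Suc ?n} \<and> \<sigma> j = 0}" for j
      by (auto simp: permutes_inv_eq permutes_inverses)
    ultimately show ?thesis by simp
  qed
  have F0: "(\<Sum>\<sigma> | \<sigma> permutes {..<Suc ?n} \<and> \<sigma> 0 = 0. ?w \<sigma>) = (\<Sum>\<sigma>\<in>P. ?w (shift_perm \<sigma>))"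
    unfolding P_def by (rule sum.reindex_bij_betw[OF bij_betw_shift_perm, symmetric])
  have lt: "(\<Sum>\<sigma> | \<sigma> permutes {..<Suc ?n} \<and> \<sigma> j = 0. ?w \<sigma>)
      = (\<Sum>\<sigma>\<in>P. wedge_term (slot x A) B xs (k - 1) \<sigma>)" if "j < k" for j
  proof -
    have "(\<Sum>\<sigma> | \<sigma> permutes {..<Suc ?n} \<and> \<sigma> j = 0. ?w \<sigma>) = (\<Sum>\<sigma> | \<sigma> permutes {..<Suc ?n} \<and> \<sigma> 0 = 0. ?w \<sigma>)"
      using sum_wedge_term_swap[OF A B, of j "x # xs" 0 k] that k by auto
    also have "\<dots> = (\<Sum>\<sigma>\<in>P. wedge_term (slot x A) B xs (k - 1) \<sigma>)"
      unfolding F0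
    proof (rule sum.cong[OF refl])
      fix \<sigma> assume "\<sigma> \<in> P"
      then have s: "sign (shift_perm \<sigma>) = sign \<sigma>" by (auto simp: P_def sign_shift_perm)
      show "?w (shift_perm \<sigma>) = wedge_term (slot x A) B xs (k - 1) \<sigma>"
        using that by (cases k) (auto simp: wedge_term_def s permute_list_shift_perm slot_def)
    qed
    finally show ?thesis .
  qed
  have ge: "(\<Sum>\<sigma> | \<sigma> permutes {..<Suc ?n} \<and> \<sigma> j = 0. ?w \<sigma>)
      = (\<Sum>\<sigma>\<in>P. wedge_term (invol A) (slot x B) xs k \<sigma>)" if j: "j \<in> {k..<Suc ?n}" for j
  proof -
    have kn: "k \<le> ?n" using j by auto
    have c: "cyc k permutes {..<Suc ?n}" using kn by (intro cyc_permutes) auto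
    have "(\<Sum>\<sigma> | \<sigma> permutes {..<Suc ?n} \<and> \<sigma> j = 0. ?w \<sigma>) = (\<Sum>\<sigma> | \<sigma> permutes {..<Suc ?n} \<and> \<sigma> k = 0. ?w \<sigma>)"
      using sum_wedge_term_swap[OF A B, of j "x # xs" k k] j k by auto
    \<comment> \<open>Composition with \<open>cyc k\<close> turns the stabiliser of 0 into the
      permutations that put the head at position \<open>k\<close>; the sign of the cycle becomes the
      sign in \<open>invol A\<close>.\<close>
    also have "\<dots> = (\<Sum>\<sigma> | \<sigma> permutes {..<Suc ?n} \<and> \<sigma> 0 = 0. ?w (\<sigma> \<circ> cyc k))"
    proof (rule sum.reindex_bij_witness[where i = "\<lambda>\<sigma>. \<sigma> \<circ> cyc k" and j = "\<lambda>\<sigma>. \<sigma> \<circ> inv (cyc k)"])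
      fix \<sigma> :: "nat \<Rightarrow> nat"
      show "\<sigma> \<circ> inv (cyc k) \<circ> cyc k = \<sigma>" "\<sigma> \<circ> cyc k \<circ> inv (cyc k) = \<sigma>"
        using permutes_inv_o[OF c] by (simp_all add: o_assoc[symmetric])
      then show "?w (\<sigma> \<circ> inv (cyc k) \<circ> cyc k) = ?w \<sigma>" by simp
      have i0: "inv (cyc k) 0 = k" using c by (simp add: permutes_inv_eq cyc_apply)
      show "\<sigma> \<circ> inv (cyc k) \<in> {\<sigma>. \<sigma> permutes {..<Suc ?n} \<and> \<sigma> 0 = 0}"
        if "\<sigma> \<in> {\<sigma>. \<sigma> permutes {..<Suc ?n} \<and> \<sigma> k = 0}"
        using that permutes_inv[OF c] i0 permutes_compose[of "inv (cyc k)" _ \<sigma>] by auto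
      show "\<sigma> \<circ> cyc k \<in> {\<sigma>. \<sigma> permutes {..<Suc ?n} \<and> \<sigma> k = 0}"
        if "\<sigma> \<in> {\<sigma>. \<sigma> permutes {..<Suc ?n} \<and> \<sigma> 0 = 0}"
        using that permutes_compose[OF c, of \<sigma>] by (auto simp: cyc_apply)
    qed
    also have "\<dots> = (\<Sum>\<sigma>\<in>P. ?w (shift_perm \<sigma> \<circ> cyc k))"
      unfolding P_def by (rule sum.reindex_bij_betw[OF bij_betw_shift_perm, symmetric])
    also have "\<dots> = (\<Sum>\<sigma>\<in>P. wedge_term (invol A) (slot x B) xs k \<sigma>)"
    proof (rule sum.cong[OF refl])
      fix \<sigma> assume "\<sigma> \<in> P"
      then have \<sigma>: "\<sigma> permutes {..<?n}" by (simp add: P_def)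
      have s: "sign (shift_perm \<sigma> \<circ> cyc k) = sign \<sigma> * (-1) ^ k"
        using sign_shift_perm[OF \<sigma>] permutation_lessThan[OF shift_perm_permutes[OF \<sigma>]]
          permutation_lessThan[OF c]
        by (simp add: sign_compose sign_cyc)
      have pl: "permute_list (shift_perm \<sigma> \<circ> cyc k) (x # xs)
          = take k (permute_list \<sigma> xs) @ x # drop k (permute_list \<sigma> xs)"
        using kn c by (subst permute_list_compose) (auto simp: permute_list_shift_perm permute_list_cyc)
      show "?w (shift_perm \<sigma> \<circ> cyc k) = wedge_term (invol A) (slot x B) xs k \<sigma>"
        using kn by (simp add: wedge_term_def s pl slot_def invol_def min_def)
    qed
    finally show ?thesis .
  qed
  have "{..<Suc ?n} = {..<k} \<union> {k..<Suc ?n}" using k by auto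
  then have "(\<Sum>\<sigma>\<in>?Q. ?w \<sigma>)
     = (\<Sum>j<k. \<Sum>\<sigma> | \<sigma> permutes {..<Suc ?n} \<and> \<sigma> j = 0. ?w \<sigma>)
       + (\<Sum>j\<in>{k..<Suc ?n}. \<Sum>\<sigma> | \<sigma> permutes {..<Suc ?n} \<and> \<sigma> j = 0. ?w \<sigma>)"
    unfolding split by (simp add: sum.union_disjoint ivl_disj_int)
  then show ?thesis using lt ge by simp
qed

lemma wedge_eq_wedge_term:
  "wedge A B xs = (\<Sum>k\<le>length xs. 1 / (fact k * fact (length xs - k)) *
     (\<Sum>\<sigma> | \<sigma> permutes {..<length xs}. wedge_term A B xs k \<sigma>))"
  by (simp add: wedge_def wedge_term_def)

lemma wedge_Nil [simp]: "wedge A B [] = A [] * B []"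
  by (simp add: wedge_def)

text \<open>Contraction of the first index is an antiderivation. Together with \<open>wedge_Nil\<close> this
  determines the product, so that identities between products follow by list induction.\<close>

lemma wedge_Cons:
  assumes A: "alternating A" and B: "alternating B"
  shows "wedge A B (x # xs) = wedge (slot x A) B xs + wedge (invol A) (slot x B) xs"
proof -
  let ?n = "length xs"
  define F where "F k = (\<Sum>\<sigma> | \<sigma> permutes {..<?n}. wedge_term (slot x A) B xs k \<sigma>)" for k
  define G where "G k = (\<Sum>\<sigma> | \<sigma> permutes {..<?n}. wedge_term (invol A) (slot x B) xs k \<sigma>)" for k
  have "wedge A B (x # xs) = (\<Sum>k\<le>Suc ?n. 1 / (fact k * fact (Suc ?n - k)) *
      (real k * F (k - 1) + real (Suc ?n - k) * G k))"
    unfolding wedge_eq_wedge_term F_def G_def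
    by (auto intro!: sum.cong simp: sum_wedge_term_Cons[OF A B])
  also have "\<dots> = (\<Sum>k\<le>Suc ?n. 1 / (fact k * fact (Suc ?n - k)) * (real k * F (k - 1)))
     + (\<Sum>k\<le>Suc ?n. 1 / (fact k * fact (Suc ?n - k)) * (real (Suc ?n - k) * G k))"
    by (simp add: distrib_left sum.distrib del: sum.atMost_Suc)
  \<comment> \<open>In both sums the number of positions cancels one factor of a factorial. The
    boundary term with coefficient zero drops out: \<open>k = 0\<close> here, after which the index
    is shifted, and the top index in the other sum.\<close>
  also have "(\<Sum>k\<le>Suc ?n. 1 / (fact k * fact (Suc ?n - k)) * (real k * F (k - 1)))
     = (\<Sum>k\<le>?n. 1 / (fact k * fact (?n - k)) * F k)"
  proof -
    have "1 / (fact (Suc k) * fact (Suc ?n - Suc k)) * (real (Suc k) * F (Suc k - 1))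
        = 1 / (fact k * fact (?n - k)) * F k" for k
      by (simp only: fact_Suc diff_Suc_Suc diff_Suc_1 of_nat_mult) (simp add: divide_simps del: of_nat_Suc)
    then show ?thesis by (subst sum.atMost_Suc_shift) simp
  qed
  also have "(\<Sum>k\<le>Suc ?n. 1 / (fact k * fact (Suc ?n - k)) * (real (Suc ?n - k) * G k))
     = (\<Sum>k\<le>?n. 1 / (fact k * fact (?n - k)) * G k)"
  proof -
    have "1 / (fact k * fact (Suc ?n - k)) * (real (Suc ?n - k) * G k)
        = 1 / (fact k * fact (?n - k)) * G k" if "k \<le> ?n" for k
      using that by (simp only: Suc_diff_le fact_Suc of_nat_mult) (simp add: divide_simps del: of_nat_Suc)
    then show ?thesis by simp
  qed
  finally show ?thesis by (simp add: wedge_eq_wedge_term F_def G_def)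
qed

section \<open>The graded algebra of alternating forms\<close>

definition scl :: "real \<Rightarrow> ('a list \<Rightarrow> real) \<Rightarrow> 'a list \<Rightarrow> real" where
  "scl c A xs = c * A xs"

lemma sum_fun_apply: "(\<Sum>i\<in>I. F i) x = (\<Sum>i\<in>I. F i x)"
  by (induction I rule: infinite_finite_induct) auto

lemma scl_simps [simp]: "scl 0 A = 0" "scl 1 A = A" "scl c 0 = 0" "scl (-1) A = - A"
  "scl c (scl d A) = scl (c * d) A"
  by (auto simp: fun_eq_iff scl_def)

lemma scl_add: "scl c (A + B) = scl c A + scl c B" "scl (c + d) A = scl c A + scl d A"
  by (auto simp: fun_eq_iff scl_def algebra_simps)

lemma scl_minus: "scl c (- A) = - scl c A" "scl (- c) A = - scl c A"
  by (auto simp: fun_eq_iff scl_def)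

lemma scl_sum: "scl c (\<Sum>i\<in>I. F i) = (\<Sum>i\<in>I. scl c (F i))" 
  by (auto simp: fun_eq_iff scl_def sum_fun_apply sum_distrib_left)

lemma scl_sum_left: "scl (\<Sum>i\<in>I. c i) A = (\<Sum>i\<in>I. scl (c i) A)" 
  by (auto simp: fun_eq_iff scl_def sum_fun_apply sum_distrib_right)

lemma scl_eq_0D: "scl c A = 0 \<Longrightarrow> c \<noteq> 0 \<Longrightarrow> A = 0"
  by (auto simp: fun_eq_iff scl_def)

lemma wedge_add_left: "wedge (A + A') B = wedge A B + wedge A' B"
  by (auto simp: fun_eq_iff wedge_def algebra_simps sum.distrib sum_distrib_left)

lemma wedge_add_right: "wedge A (B + B') = wedge A B + wedge A B'"
  by (auto simp: fun_eq_iff wedge_def algebra_simps sum.distrib sum_distrib_left)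

lemma wedge_scl_left: "wedge (scl c A) B = scl c (wedge A B)"
  by (auto simp: fun_eq_iff wedge_def scl_def algebra_simps sum_distrib_left)

lemma wedge_scl_right: "wedge A (scl c B) = scl c (wedge A B)"
  by (auto simp: fun_eq_iff wedge_def scl_def algebra_simps sum_distrib_left)

lemma wedge_0_left [simp]: "wedge 0 B = 0"
  by (auto simp: fun_eq_iff wedge_def)

lemma wedge_0_right [simp]: "wedge A 0 = 0"
  by (auto simp: fun_eq_iff wedge_def)

lemma wedge_minus_left: "wedge (- A) B = - wedge A B"
  by (metis scl_simps(4) wedge_scl_left)

lemma wedge_minus_right: "wedge A (- B) = - wedge A B"
  by (metis scl_simps(4) wedge_scl_right)

lemma wedge_diff_left: "wedge (A - A') B = wedge A B - wedge A' B"
  using wedge_add_left[of A "- A'" B] by (simp add: wedge_minus_left)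

lemma wedge_diff_right: "wedge A (B - B') = wedge A B - wedge A B'"
  using wedge_add_right[of A B "- B'"] by (simp add: wedge_minus_right)

lemma wedge_sum_left: "wedge (\<Sum>i\<in>I. F i) B = (\<Sum>i\<in>I. wedge (F i) B)"
  by (induction I rule: infinite_finite_induct) (simp_all only: wedge_add_left sum.infinite sum.empty sum.insert wedge_0_left not_False_eq_True)

lemma wedge_sum_right: "wedge B (\<Sum>i\<in>I. F i) = (\<Sum>i\<in>I. wedge B (F i))"
  by (induction I rule: infinite_finite_induct) (simp_all only: wedge_add_right sum.infinite sum.empty sum.insert wedge_0_right not_False_eq_True)

lemma alternating_add: "alternating A \<Longrightarrow> alternating B \<Longrightarrow> alternating (A + B)"
  by (auto simp: alternating_def algebra_simps)

lemma alternating_scl: "alternating A \<Longrightarrow> alternating (scl c A)"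
  by (auto simp: alternating_def scl_def algebra_simps)

lemma alternating_minus: "alternating A \<Longrightarrow> alternating (- A)"
  by (auto simp: alternating_def)

lemma alternating_diff: "alternating A \<Longrightarrow> alternating B \<Longrightarrow> alternating (A - B)"
  by (auto simp: alternating_def algebra_simps)

lemma alternating_0: "alternating 0"
  by (auto simp: alternating_def)

lemma alternating_sum: "(\<And>i. i \<in> I \<Longrightarrow> alternating (F i)) \<Longrightarrow> alternating (\<Sum>i\<in>I. F i)"
  by (induction I rule: infinite_finite_induct) (auto simp: alternating_0 alternating_add)

lemma alternating_ext_one: "alternating ext_one"
  by (auto simp: alternating_def ext_one_def permutes_empty)
     (metis length_0_conv length_permute_list)

text \<open>Left translation by \<open>\<tau>\<close> permutes the range of summation and changes
  each summand only through the factor \<open>sign \<tau>\<close>.\<close>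

lemma alternating_wedge: "alternating (wedge A B)"
  unfolding alternating_def
proof (intro allI impI)
  fix xs :: "('a + 'b) list" and \<tau> assume \<tau>: "\<tau> permutes {..<length xs}"
  have "(\<Sum>\<sigma> | \<sigma> permutes {..<length xs}. wedge_term A B (permute_list \<tau> xs) k \<sigma>)
      = of_int (sign \<tau>) * (\<Sum>\<sigma> | \<sigma> permutes {..<length xs}. wedge_term A B xs k \<sigma>)" for k
  proof -
    have "(\<Sum>\<sigma> | \<sigma> permutes {..<length xs}. wedge_term A B xs k \<sigma>)
        = (\<Sum>\<sigma> | \<sigma> permutes {..<length xs}. wedge_term A B xs k (\<tau> \<circ> \<sigma>))"
      by (rule setum_permutations_compose_left[OF \<tau>])
    also have "\<dots> = (\<Sum>\<sigma> | \<sigma> permutes {..<length xs}. of_int (sign \<tau>) * wedge_term A B (permute_list \<tau> xs) k \<sigma>)"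
    proof (rule sum.cong[OF refl])
      fix \<sigma> assume "\<sigma> \<in> {\<sigma>. \<sigma> permutes {..<length xs}}"
      then have \<sigma>: "\<sigma> permutes {..<length xs}" by simp
      have s: "sign (\<tau> \<circ> \<sigma>) = sign \<tau> * sign \<sigma>"
        using permutation_lessThan[OF \<sigma>] permutation_lessThan[OF \<tau>] by (rule sign_compose[rotated])
      show "wedge_term A B xs k (\<tau> \<circ> \<sigma>) = of_int (sign \<tau>) * wedge_term A B (permute_list \<tau> xs) k \<sigma>"
        by (simp add: wedge_term_def s permute_list_compose[OF \<sigma>])
    qed
    finally have "(\<Sum>\<sigma> | \<sigma> permutes {..<length xs}. wedge_term A B xs k \<sigma>)
        = of_int (sign \<tau>) * (\<Sum>\<sigma> | \<sigma> permutes {..<length xs}. wedge_term A B (permute_list \<tau> xs) k \<sigma>)"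
      by (simp add: sum_distrib_left)
    moreover have "of_int (sign \<tau>) * of_int (sign \<tau>) = (1::real)"
      by (cases \<tau> rule: sign_cases) auto
    ultimately show ?thesis by (simp add: mult.assoc[symmetric])
  qed
  then show "wedge A B (permute_list \<tau> xs) = of_int (sign \<tau>) * wedge A B xs"
    by (simp add: wedge_eq_wedge_term sum_distrib_left mult.assoc mult.left_commute)
qed

lemmas alternating_intros =
  alternating_add alternating_scl alternating_minus alternating_diff alternating_0 alternating_sum
  alternating_ext_one alternating_wedge alternating_slot alternating_invol

lemma slot_linear:
  "slot x (A + B) = slot x A + slot x B" "slot x (A - B) = slot x A - slot x B"
  "slot x (scl c A) = scl c (slot x A)" "slot x (- A) = - slot x A" "slot x 0 = 0"
  "slot x (\<Sum>i\<in>I. F i) = (\<Sum>i\<in>I. slot x (F i))"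
  by (auto simp: fun_eq_iff slot_def scl_def sum_fun_apply)

lemma invol_invol [simp]: "invol (invol A) = A"
  by (auto simp: fun_eq_iff invol_def simp flip: power_add mult.assoc)

lemma slot_invol: "slot x (invol A) = - invol (slot x A)"
  by (auto simp: fun_eq_iff slot_def invol_def)

lemma slot_ext_one [simp]: "slot x ext_one = 0"
  by (auto simp: fun_eq_iff slot_def ext_one_def)

lemma invol_ext_one [simp]: "invol ext_one = ext_one"
  by (auto simp: fun_eq_iff invol_def ext_one_def)

lemma invol_wedge: "invol (wedge A B) = wedge (invol A) (invol B)"
proof
  fix xs :: "('a + 'b) list"
  have "(-1) ^ length xs * wedge_term A B xs k \<sigma> = wedge_term (invol A) (invol B) xs k \<sigma>"
    if "k \<le> length xs" for k \<sigma>
  proof -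
    have "(-1::real) ^ length xs = (-1) ^ k * (-1) ^ (length xs - k)"
      using that by (simp flip: power_add)
    then show ?thesis using that by (simp add: wedge_term_def invol_def min_def)
  qed
  then show "invol (wedge A B) xs = wedge (invol A) (invol B) xs"
    by (auto simp: invol_def[of "wedge A B"] wedge_eq_wedge_term sum_distrib_left mult.left_commute
        intro!: sum.cong)
qed

lemma slot_wedge:
  assumes "alternating A" "alternating B"
  shows "slot x (wedge A B) = wedge (slot x A) B + wedge (invol A) (slot x B)"
  by (rule ext) (simp add: slot_def[of x "wedge A B"] wedge_Cons[OF assms])

lemma slot_slot:
  assumes "alternating A"
  shows "slot x (slot y A) = - slot y (slot x A)"
proof
  fix xs :: "'a list"
  let ?t = "swap_perm 0 (Suc 0)"
  have t: "?t permutes {..<length (x # y # xs)}" by (rule permutes_swap_id) auto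
  have "permute_list ?t (x # y # xs) = y # x # xs"
    by (rule nth_equalityI) (use t in \<open>auto simp: permute_list_nth Transposition.transpose_def nth_Cons'\<close>)
  then show "slot x (slot y A) xs = (- slot y (slot x A)) xs"
    using alternatingD[OF assms t] by (simp add: slot_def sign_swap_id)
qed

text \<open>The antiderivation rule replaces the factors by contractions and involutions, so the
  induction on the index list has to generalise all three forms.\<close>

lemma wedge_assoc:
  assumes "alternating A" "alternating B" "alternating C"
  shows "wedge (wedge A B) C = wedge A (wedge B C)"
proof
  fix xs
  show "wedge (wedge A B) C xs = wedge A (wedge B C) xs"
    using assms
  proof (induction xs arbitrary: A B C)
    case (Cons x xs)
    then show ?case
      by (simp add: wedge_Cons alternating_intros slot_wedge wedge_add_left wedge_add_right invol_wedge)
  qed simp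
qed

lemma wedge_ext_one_left:
  assumes "alternating A"
  shows "wedge ext_one A = A"
proof
  fix xs
  show "wedge ext_one A xs = A xs"
    using assms
  proof (induction xs arbitrary: A)
    case (Cons x xs)
    then show ?case by (simp add: wedge_Cons alternating_intros) (simp add: slot_def)
  qed (simp add: ext_one_def)
qed

lemma wedge_ext_one_right:
  assumes "alternating A"
  shows "wedge A ext_one = A"
proof
  fix xs
  show "wedge A ext_one xs = A xs"
    using assms
  proof (induction xs arbitrary: A)
    case (Cons x xs)
    then show ?case by (simp add: wedge_Cons alternating_intros) (simp add: slot_def)
  qed (simp add: ext_one_def)
qed

section \<open>Graded commutativity in total degrees one and two\<close>

definition homog :: "nat \<Rightarrow> ('a list \<Rightarrow> real) \<Rightarrow> bool" where
  "homog p A \<longleftrightarrow> (\<forall>xs. A xs \<noteq> 0 \<longrightarrow> length xs = p)"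

lemma homog_invol: "homog p A \<Longrightarrow> invol A = scl ((-1) ^ p) A"
  by (auto simp: fun_eq_iff homog_def invol_def scl_def)

lemma homog_slot: "homog (Suc p) A \<Longrightarrow> homog p (slot x A)"
  by (auto simp: homog_def slot_def)

lemma homog_0: "homog 0 A \<Longrightarrow> A = scl (A []) ext_one"
  by (auto simp: fun_eq_iff homog_def scl_def ext_one_def)

text \<open>The contraction of \<open>B\<close> is a multiple of \<open>ext_one\<close>, so the
  antiderivation rule reduces both sides to the same claim for the contraction of
  \<open>A\<close>.\<close>

lemma wedge_commute_1:
  assumes "alternating A" "alternating B" "homog 1 B"
  shows "wedge A B = wedge B (invol A)"
proof
  fix xs
  show "wedge A B xs = wedge B (invol A) xs"
    using assms(1)
  proof (induction xs arbitrary: A)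
    case (Cons x xs)
    note 1 = assms(2)
    have B: "invol B = - B" using homog_invol[OF assms(3)] by simp
    obtain c where c: "slot x B = scl c ext_one"
      using homog_0[OF homog_slot] assms(3) by (metis One_nat_def)
    have a: "alternating (invol A)" using Cons.prems by (rule alternating_invol)
    from Cons 1 a show ?case
      by (simp add: wedge_Cons alternating_intros c wedge_scl_left wedge_scl_right
          wedge_ext_one_left wedge_ext_one_right slot_invol B wedge_minus_left wedge_minus_right)
  qed (simp add: invol_def)
qed

text \<open>Contraction lowers \<open>B\<close> to total degree one, where
  \<open>wedge_commute_1\<close> applies. Degree two is the case of the coframe.\<close>

lemma wedge_commute_2:
  assumes "alternating A" "alternating B" "homog 2 B"
  shows "wedge A B = wedge B A"
proof
  fix xs
  show "wedge A B xs = wedge B A xs"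
    using assms(1)
  proof (induction xs arbitrary: A)
    case (Cons x xs)
    note 1 = assms(2)
    have B: "invol B = B" using homog_invol[OF assms(3)] by simp
    have c: "homog 1 (slot x B)"
      using homog_slot assms(3) by (metis One_nat_def Suc_1)
    have "wedge (invol A) (slot x B) = wedge (slot x B) A"
      using wedge_commute_1[OF _ _ c, of "invol A"] Cons.prems 1 by (simp add: alternating_intros)
    with Cons 1 show ?case
      by (simp add: wedge_Cons alternating_intros B)
  qed simp
qed

lemma wedge_self_1:
  assumes "alternating A" "homog 1 A"
  shows "wedge A A = 0"
proof -
  have "wedge A A = - wedge A A"
    using wedge_commute_1[OF assms(1,1,2)] homog_invol[OF assms(2)] by (simp add: wedge_minus_right)
  then show ?thesis by (auto simp: fun_eq_iff)
qed

section \<open>Bidegrees\<close>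

lemma bidegree_iff:
  "bidegree i j A \<longleftrightarrow> alternating A \<and>
     (\<forall>xs. A xs \<noteq> 0 \<longrightarrow> length (filter isl xs) = i \<and> length (filter (\<lambda>x. \<not> isl x) xs) = j)"
  by (auto simp: bidegree_def alternating_def)

lemma bidegree_alternating: "bidegree i j A \<Longrightarrow> alternating A"
  by (simp add: bidegree_iff)

lemma bidegree_homog: "bidegree i j A \<Longrightarrow> homog (i + j) A"
  unfolding homog_def
proof (intro allI impI)
  fix xs assume "bidegree i j A" "A xs \<noteq> 0"
  then show "length xs = i + j"
    using sum_length_filter_compl[of isl xs] by (auto simp: bidegree_iff)
qed

lemma bidegree_invol: "bidegree i j A \<Longrightarrow> invol A = scl ((-1) ^ (i + j)) A"
  by (simp add: bidegree_homog homog_invol)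

lemma bidegree_linear:
  "bidegree i j A \<Longrightarrow> bidegree i j B \<Longrightarrow> bidegree i j (A + B)"
  "bidegree i j A \<Longrightarrow> bidegree i j B \<Longrightarrow> bidegree i j (A - B)"
  "bidegree i j A \<Longrightarrow> bidegree i j (scl c A)" "bidegree i j A \<Longrightarrow> bidegree i j (- A)"
  "bidegree i j 0"
  unfolding bidegree_iff by (simp add: alternating_intros, metis add.right_neutral)
    (simp add: alternating_intros, metis diff_zero, simp_all add: alternating_intros scl_def)

lemma bidegree_sum: "(\<And>k. k \<in> I \<Longrightarrow> bidegree i j (F k)) \<Longrightarrow> bidegree i j (\<Sum>k\<in>I. F k)"
  by (induction I rule: infinite_finite_induct) (auto simp: bidegree_linear)

lemma bidegree_wedge:
  assumes "bidegree i j A" "bidegree k l B"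
  shows "bidegree (i + k) (j + l) (wedge A B)"
  unfolding bidegree_iff
proof -
  have "length (filter isl xs) = i + k \<and> length (filter (\<lambda>x. \<not> isl x) xs) = j + l"
    if "wedge A B xs \<noteq> 0" for xs
  proof -
    from that obtain r \<sigma> where \<sigma>: "\<sigma> permutes {..<length xs}" and "wedge_term A B xs r \<sigma> \<noteq> 0"
      unfolding wedge_eq_wedge_term
      by (smt (verit, ccfv_threshold) mem_Collect_eq mult_eq_0_iff sum.neutral)
    then have nz: "A (take r (permute_list \<sigma> xs)) \<noteq> 0" "B (drop r (permute_list \<sigma> xs)) \<noteq> 0"
      by (auto simp: wedge_term_def)
    let ?zs = "permute_list \<sigma> xs"
    have f: "length (filter P xs) = length (filter P (take r ?zs)) + length (filter P (drop r ?zs))" for P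
    proof -
      have "mset (filter P xs) = mset (filter P ?zs)"
        using mset_permute_list[OF \<sigma>] by simp
      then have "length (filter P xs) = length (filter P ?zs)" by (metis size_mset)
      also have "\<dots> = length (filter P (take r ?zs @ drop r ?zs))" by simp
      finally show ?thesis by (simp only: filter_append length_append)
    qed
    show ?thesis
      using nz assms unfolding f by (simp add: bidegree_iff)
  qed
  then show "alternating (wedge A B) \<and> (\<forall>xs. wedge A B xs \<noteq> 0 \<longrightarrow>
      length (filter isl xs) = i + k \<and> length (filter (\<lambda>x. \<not> isl x) xs) = j + l)"
    using alternating_wedge by blast
qed

text \<open>With more form indices than coordinates some entry is repeated, and exchanging the two
  equal entries changes the sign of the component.\<close>

lemma bidegree_vanish:
  fixes A :: "('m::finite, 'n) ext"
  assumes "bidegree i j A" "i > CARD('m)"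
  shows "A = 0"
proof (rule ext, rule ccontr)
  fix xs assume "A xs \<noteq> 0 xs"
  then have nz: "A xs \<noteq> 0" by simp
  have "\<not> distinct xs"
  proof
    assume "distinct xs"
    then have "length (filter isl xs) = card (set (filter isl xs))"
      by (simp add: distinct_card[symmetric] del: set_filter)
    also have "\<dots> \<le> card (range (Inl :: 'm \<Rightarrow> 'm + 'n))"
      by (rule card_mono) (auto simp: isl_def)
    also have "\<dots> = CARD('m)" by (simp add: card_image)
    finally show False using assms nz by (auto simp: bidegree_iff)
  qed
  then obtain a b where ab: "a < length xs" "b < length xs" "a \<noteq> b" "xs ! a = xs ! b"
    by (auto simp: distinct_conv_nth)
  let ?t = "swap_perm a b"
  have t: "?t permutes {..<length xs}" using ab by (auto intro!: permutes_swap_id)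
  have "permute_list ?t xs = xs"
    by (rule nth_equalityI) (use t ab in \<open>auto simp: permute_list_nth Transposition.transpose_def\<close>)
  then have "A xs = - A xs"
    using alternatingD[OF bidegree_alternating[OF assms(1)] t] ab by (simp add: sign_swap_id)
  then show False using nz by simp
qed

section \<open>Basis elements and number operators\<close>

definition gen :: "'a \<Rightarrow> 'a list \<Rightarrow> real" where
  "gen z xs = (if xs = [z] then 1 else 0)"

lemma slot_gen: "slot x (gen z) = (if x = z then ext_one else 0)"
  by (auto simp: fun_eq_iff slot_def gen_def ext_one_def)

lemma homog_gen: "homog 1 (gen z)"
  by (auto simp: homog_def gen_def)

lemma alternating_homog_1:
  assumes "homog 1 A" shows "alternating A"
  unfolding alternating_def
proof (intro allI impI)
  fix xs :: "'a list" and \<sigma> assume \<sigma>: "\<sigma> permutes {..<length xs}"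
  show "A (permute_list \<sigma> xs) = of_int (sign \<sigma>) * A xs"
  proof (cases "length xs = 1")
    case True
    then have "\<sigma> = id" using \<sigma> by (simp add: lessThan_Suc)
    then show ?thesis by simp
  next
    case False
    then have "A xs = 0" "A (permute_list \<sigma> xs) = 0"
      using assms by (auto simp: homog_def)
    then show ?thesis by simp
  qed
qed

lemma wedge_gen_Cons:
  assumes "alternating A"
  shows "wedge (gen z) A (x # xs) = (if x = z then A xs else 0) - wedge (gen z) (slot x A) xs"
  using assms homog_invol[OF homog_gen[of z]] alternating_homog_1[OF homog_gen[of z]]
  by (simp add: wedge_Cons slot_gen wedge_ext_one_left wedge_minus_left)

text \<open>The number operator that counts the indices in \<open>S\<close>. Taken over the form
  indices or the fibre indices it yields the two degrees that enter the Lefschetz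
  commutator.\<close>

lemma sum_wedge_gen_slot:
  assumes "alternating A" "finite S"
  shows "(\<Sum>z\<in>S. wedge (gen z) (slot z A)) xs = real (length (filter (\<lambda>x. x \<in> S) xs)) * A xs"
  using assms(1)
proof (induction xs arbitrary: A)
  case Nil
  then show ?case by (simp add: sum_fun_apply gen_def)
next
  case (Cons x xs)
  have "(\<Sum>z\<in>S. wedge (gen z) (slot z A)) (x # xs)
      = (\<Sum>z\<in>S. (if x = z then slot z A xs else 0) + wedge (gen z) (slot z (slot x A)) xs)"
    unfolding sum_fun_apply
    by (rule sum.cong[OF refl])
       (simp add: wedge_gen_Cons alternating_intros Cons.prems slot_slot[OF Cons.prems, of x] wedge_minus_right)
  also have "\<dots> = (if x \<in> S then slot x A xs else 0) + (\<Sum>z\<in>S. wedge (gen z) (slot z (slot x A))) xs"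
    using assms(2) by (simp add: sum.distrib sum_fun_apply)
  also have "\<dots> = real (length (filter (\<lambda>x. x \<in> S) (x # xs))) * A (x # xs)"
    using Cons.IH[of "slot x A"] Cons.prems by (simp add: alternating_intros) (simp add: slot_def algebra_simps)
  finally show ?case .
qed

section \<open>Change of basis\<close>

text \<open>The same matrix acts on every index, so the transition law of \<open>Omega\<close> is
  \<open>transform (index_change B \<alpha> \<beta> p)\<close>, which is compatible with the algebra
  structure.\<close>

definition transform :: "('a \<Rightarrow> 'a \<Rightarrow> real) \<Rightarrow> ('a list \<Rightarrow> real) \<Rightarrow> 'a::finite list \<Rightarrow> real" where
  "transform M A xs = (\<Sum>ys | length ys = length xs. (\<Prod>k<length xs. M (xs ! k) (ys ! k)) * A ys)"

lemma sum_lists_Suc: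
  "(\<Sum>ys | length ys = Suc n. f ys) = (\<Sum>z\<in>UNIV. \<Sum>ys | length ys = n. f (z # ys :: 'a::finite list))"
proof -
  have "(\<Sum>z\<in>UNIV. \<Sum>ys | length ys = n. f (z # ys)) = (\<Sum>(z, ys)\<in>UNIV \<times> {ys. length ys = n}. f (z # ys))"
    by (rule sum.cartesian_product)
  also have "\<dots> = (\<Sum>ys | length ys = Suc n. f ys)"
    by (rule sum.reindex_bij_witness[where j = "\<lambda>(z, ys). z # ys" and i = "\<lambda>ys. (hd ys, tl ys)"])
       (auto simp: length_Suc_conv)
  finally show ?thesis ..
qed

lemma transform_linear:
  "transform M (A + B) = transform M A + transform M B"
  "transform M (A - B) = transform M A - transform M B"
  "transform M (scl c A) = scl c (transform M A)"
  "transform M 0 = 0"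
  by (auto simp: fun_eq_iff transform_def scl_def algebra_simps sum.distrib sum_subtractf sum_distrib_left)

lemma transform_sum: "transform M (\<Sum>i\<in>I. F i) = (\<Sum>i\<in>I. transform M (F i))"
  by (induction I rule: infinite_finite_induct)
     (simp_all only: transform_linear sum.infinite sum.empty sum.insert not_False_eq_True)

lemma transform_Nil [simp]: "transform M A [] = A []"
  by (simp add: transform_def)

lemma slot_transform: "slot x (transform M A) = (\<Sum>z\<in>UNIV. scl (M x z) (transform M (slot z A)))"
proof
  fix xs
  show "slot x (transform M A) xs = (\<Sum>z\<in>UNIV. scl (M x z) (transform M (slot z A))) xs"
    by (simp add: slot_def[of x] transform_def sum_lists_Suc prod.lessThan_Suc_shift sum_fun_apply
        scl_def sum_distrib_left mult.assoc del: prod.lessThan_Suc) (simp add: slot_def)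
qed

lemma transform_Cons: "transform M A (x # xs) = (\<Sum>z\<in>UNIV. M x z * transform M (slot z A) xs)"
  using fun_cong[OF slot_transform[of x M A], of xs]
  by (simp add: slot_def[of x] sum_fun_apply) (simp add: scl_def)

lemma transform_invol: "transform M (invol A) = invol (transform M A)"
  by (auto simp: fun_eq_iff transform_def invol_def sum_distrib_left mult.left_commute intro!: sum.cong)

lemma alternating_transform:
  assumes "alternating A"
  shows "alternating (transform M A)"
  unfolding alternating_def
proof (intro allI impI)
  fix xs :: "'a list" and \<sigma> assume \<sigma>: "\<sigma> permutes {..<length xs}"
  have "transform M A (permute_list \<sigma> xs)
     = (\<Sum>ys | length ys = length xs. (\<Prod>k<length xs. M (permute_list \<sigma> xs ! k) (permute_list \<sigma> ys ! k)) * A (permute_list \<sigma> ys))"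
    unfolding transform_def length_permute_list
  proof (rule sum.reindex_bij_witness[where i = "permute_list \<sigma>" and j = "permute_list (inv \<sigma>)"])
    fix ys :: "'a list" assume "ys \<in> {ys. length ys = length xs}"
    then have l: "length ys = length xs" by simp
    show a: "permute_list \<sigma> (permute_list (inv \<sigma>) ys) = ys"
      using permute_list_compose[of \<sigma> ys "inv \<sigma>"] \<sigma> l by (simp add: permutes_inv_o)
    show "permute_list (inv \<sigma>) (permute_list \<sigma> ys) = ys"
      using permute_list_compose[of "inv \<sigma>" ys \<sigma>] \<sigma> l by (simp add: permutes_inv_o permutes_inv)
    show "(\<Prod>k<length xs. M (permute_list \<sigma> xs ! k) (permute_list \<sigma> (permute_list (inv \<sigma>) ys) ! k)) *
         A (permute_list \<sigma> (permute_list (inv \<sigma>) ys)) =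
         (\<Prod>k<length xs. M (permute_list \<sigma> xs ! k) (ys ! k)) * A ys"
      unfolding a ..
  qed auto
  also have "\<dots> = (\<Sum>ys | length ys = length xs. of_int (sign \<sigma>) * ((\<Prod>k<length xs. M (xs ! k) (ys ! k)) * A ys))"
  proof (rule sum.cong[OF refl])
    fix ys :: "'a list" assume "ys \<in> {ys. length ys = length xs}"
    then have l: "length ys = length xs" by simp
    have "(\<Prod>k<length xs. M (permute_list \<sigma> xs ! k) (permute_list \<sigma> ys ! k)) = (\<Prod>k<length xs. M (xs ! \<sigma> k) (ys ! \<sigma> k))"
      by (rule prod.cong) (use \<sigma> l in \<open>auto simp: permute_list_nth\<close>)
    also have "\<dots> = (\<Prod>k<length xs. M (xs ! k) (ys ! k))"
      using prod.permute[OF \<sigma>, of "\<lambda>k. M (xs ! k) (ys ! k)"] by (simp add: o_def)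
    finally show "(\<Prod>k<length xs. M (permute_list \<sigma> xs ! k) (permute_list \<sigma> ys ! k)) * A (permute_list \<sigma> ys)
       = of_int (sign \<sigma>) * ((\<Prod>k<length xs. M (xs ! k) (ys ! k)) * A ys)"
      using alternatingD[OF assms, of \<sigma> ys] \<sigma> l by simp
  qed
  finally show "transform M A (permute_list \<sigma> xs) = of_int (sign \<sigma>) * transform M A xs"
    by (simp add: transform_def sum_distrib_left)
qed

lemma bidegree_transform:
  assumes "bidegree i j A" and M: "\<And>x y. M x y \<noteq> 0 \<Longrightarrow> isl x = isl y"
  shows "bidegree i j (transform M A)"
proof -
  have "length (filter isl xs) = i \<and> length (filter (\<lambda>x. \<not> isl x) xs) = j"
    if nz: "transform M A xs \<noteq> 0" for xs
  proof -
    obtain ys where l: "length ys = length xs" and t: "(\<Prod>k<length xs. M (xs ! k) (ys ! k)) * A ys \<noteq> 0"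
      using nz unfolding transform_def by (metis (mono_tags, lifting) mem_Collect_eq sum.neutral)
    then have "A ys \<noteq> 0" "\<And>k. k < length xs \<Longrightarrow> isl (xs ! k) = isl (ys ! k)"
      using M by auto
    then have eq: "map isl xs = map isl ys" and A: "A ys \<noteq> 0"
      using l by (auto intro: nth_equalityI)
    have f: "length (filter (\<lambda>x. P (isl x)) zs) = length (filter P (map isl zs))" for P and zs :: "('a + 'b) list"
      by (simp add: filter_map o_def)
    from f[of "\<lambda>x. x"] f[of Not] eq have "length (filter isl xs) = length (filter isl ys)"
      "length (filter (\<lambda>x. \<not> isl x) xs) = length (filter (\<lambda>x. \<not> isl x) ys)" by metis+
    then show ?thesis using assms(1) A by (simp add: bidegree_iff)
  qed
  then show ?thesis
    using alternating_transform assms(1) by (auto simp: bidegree_iff)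
qed

text \<open>A contraction of a transformed form is a linear combination of transformed contractions,
  so the antiderivation rule carries the induction.\<close>

lemma wedge_transform:
  assumes "alternating A" "alternating B"
  shows "wedge (transform M A) (transform M B) = transform M (wedge A B)"
proof
  fix xs
  show "wedge (transform M A) (transform M B) xs = transform M (wedge A B) xs"
    using assms
  proof (induction xs arbitrary: A B)
    case (Cons x xs)
    have "wedge (transform M A) (transform M B) (x # xs)
        = wedge (slot x (transform M A)) (transform M B) xs + wedge (invol (transform M A)) (slot x (transform M B)) xs"
      using Cons.prems by (simp add: wedge_Cons alternating_transform)
    also have "\<dots> = (\<Sum>z\<in>UNIV. M x z * (wedge (transform M (slot z A)) (transform M B) xs
        + wedge (transform M (invol A)) (transform M (slot z B)) xs))"
      by (simp add: slot_transform wedge_sum_left wedge_sum_right wedge_scl_left wedge_scl_right sum_fun_apply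
          transform_invol distrib_left sum.distrib) (simp add: scl_def)
    also have "\<dots> = (\<Sum>z\<in>UNIV. M x z * transform M (slot z (wedge A B)) xs)"
      using Cons by (simp add: slot_wedge alternating_intros transform_linear)
    finally show ?case by (simp add: transform_Cons)
  qed simp
qed

text \<open>A permutation moves all form indices to the front, and alternation transports the
  equality of those components to the others.\<close>

lemma bidegree_eqI:
  assumes A: "bidegree i j A" and B: "bidegree i j B"
    and eq: "\<And>\<mu>s as. length \<mu>s = i \<Longrightarrow> length as = j \<Longrightarrow>
      A (map Inl \<mu>s @ map Inr as) = B (map Inl \<mu>s @ map Inr as)"
  shows "A = B"
proof
  fix xs
  show "A xs = B xs"
  proof (cases "length (filter isl xs) = i \<and> length (filter (\<lambda>x. \<not> isl x) xs) = j")
    case True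
    define \<mu>s where "\<mu>s = map projl (filter isl xs)"
    define as where "as = map projr (filter (\<lambda>x. \<not> isl x) xs)"
    let ?ys = "map Inl \<mu>s @ map Inr as"
    have "map (Inl \<circ> projl) (filter isl xs) = filter isl xs"
      "map (Inr \<circ> projr) (filter (\<lambda>x. \<not> isl x) xs) = filter (\<lambda>x. \<not> isl x) xs"
      by (rule map_idI, auto)+
    then have "?ys = filter isl xs @ filter (\<lambda>x. \<not> isl x) xs" by (simp add: \<mu>s_def as_def)
    then have "mset ?ys = mset xs" by (simp del: mset_map flip: multiset_partition)
    then obtain \<sigma> where \<sigma>: "\<sigma> permutes {..<length xs}" "permute_list \<sigma> xs = ?ys"
      by (metis mset_eq_permutation)
    have "A ?ys = B ?ys" using True by (intro eq) (auto simp: \<mu>s_def as_def)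
    then show ?thesis
      using alternatingD[OF bidegree_alternating[OF A] \<sigma>(1)] alternatingD[OF bidegree_alternating[OF B] \<sigma>(1)]
      unfolding \<sigma>(2) by simp
  next
    case False
    then have "A xs = 0" "B xs = 0" using A B by (auto simp: bidegree_iff)
    then show ?thesis by simp
  qed
qed

section \<open>Contractions and powers of the coframe\<close>

lemma bidegree_slot_Inl: "bidegree (Suc i) j A \<Longrightarrow> bidegree i j (slot (Inl \<mu>) A)"
  unfolding bidegree_iff slot_def[abs_def]
  using alternating_slot[of A "Inl \<mu>", unfolded slot_def[abs_def]] by fastforce

lemma bidegree_slot_Inr: "bidegree i (Suc j) A \<Longrightarrow> bidegree i j (slot (Inr a) A)"
  unfolding bidegree_iff slot_def[abs_def]
  using alternating_slot[of A "Inr a", unfolded slot_def[abs_def]] by fastforce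

lemma slot_Inl_0: "bidegree 0 j A \<Longrightarrow> slot (Inl \<mu>) A = 0"
  by (rule ext) (auto simp: bidegree_iff slot_def)

lemma slot_Inr_0: "bidegree i 0 A \<Longrightarrow> slot (Inr a) A = 0"
  by (rule ext) (auto simp: bidegree_iff slot_def)

lemma homog_1_sum_gen:
  fixes A :: "('a::finite) list \<Rightarrow> real"
  assumes "homog 1 A"
  shows "A = (\<Sum>z\<in>UNIV. scl (A [z]) (gen z))"
proof
  fix xs
  show "A xs = (\<Sum>z\<in>UNIV. scl (A [z]) (gen z)) xs"
  proof (cases "\<exists>z. xs = [z]")
    case True
    then obtain z where "xs = [z]" by blast
    then have "(\<Sum>y\<in>UNIV. scl (A [y]) (gen y)) xs = (\<Sum>y\<in>UNIV. if y = z then A [y] else 0)"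
      unfolding sum_fun_apply by (intro sum.cong) (auto simp: scl_def gen_def)
    then show ?thesis using \<open>xs = [z]\<close> by simp
  next
    case False
    then have "A xs = 0" using assms by (auto simp: homog_def length_Suc_conv)
    moreover have "gen z xs = 0" for z using False by (auto simp: gen_def)
    ultimately show ?thesis by (simp add: sum_fun_apply scl_def)
  qed
qed

lemma sum_UNIV_Plus:
  "(\<Sum>z\<in>UNIV. f z) = (\<Sum>\<mu>\<in>UNIV. f (Inl \<mu>)) + (\<Sum>a\<in>UNIV. f (Inr a))"
  for f :: "'m::finite + 'n::finite \<Rightarrow> 'b::comm_monoid_add"
  using sum.Plus[of UNIV UNIV f] by (simp add: o_def)

lemma bidegree_10:
  fixes A :: "('m::finite, 'n::finite) ext"
  assumes "bidegree 1 0 A"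
  shows "A = (\<Sum>\<mu>\<in>UNIV. scl (A [Inl \<mu>]) (gen (Inl \<mu>)))"
proof -
  have "A [Inr a] = 0" for a using assms by (auto simp: bidegree_iff)
  with homog_1_sum_gen[of A] show ?thesis
    using bidegree_homog[OF assms] by (simp add: sum_UNIV_Plus)
qed

lemma bidegree_01:
  fixes A :: "('m::finite, 'n::finite) ext"
  assumes "bidegree 0 1 A"
  shows "A = (\<Sum>a\<in>UNIV. scl (A [Inr a]) (gen (Inr a)))"
proof -
  have "A [Inl a] = 0" for a using assms by (auto simp: bidegree_iff)
  with homog_1_sum_gen[of A] show ?thesis
    using bidegree_homog[OF assms] by (simp add: sum_UNIV_Plus)
qed

text \<open>The interior product with a covector \<open>x\<close> on the fibre.\<close>

definition contr :: "('n \<Rightarrow> real) \<Rightarrow> ('m, 'n::finite) ext \<Rightarrow> ('m, 'n) ext" where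
  "contr x A = (\<Sum>a\<in>UNIV. scl (x a) (slot (Inr a) A))"

lemma contr_linear:
  "contr x (A + B) = contr x A + contr x B" "contr x (A - B) = contr x A - contr x B"
  "contr x (scl c A) = scl c (contr x A)" "contr x 0 = 0" "contr x (- A) = - contr x A"
  by (simp_all add: contr_def slot_linear scl_add sum.distrib scl_minus sum_negf sum_subtractf
      scl_sum mult.commute
      scl_add(1)[of _ _ "- B" for B, unfolded scl_minus add_uminus_conv_diff])

lemma bidegree_contr: "bidegree i (Suc j) A \<Longrightarrow> bidegree i j (contr x A)"
  unfolding contr_def by (intro bidegree_sum bidegree_linear bidegree_slot_Inr)

lemma contr_0: "bidegree i 0 A \<Longrightarrow> contr x A = 0"
  by (simp add: contr_def slot_Inr_0)

lemma contr_wedge: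
  assumes "alternating A" "alternating B"
  shows "contr x (wedge A B) = wedge (contr x A) B + wedge (invol A) (contr x B)"
  by (simp add: contr_def slot_wedge[OF assms] scl_add sum.distrib wedge_sum_left wedge_sum_right
      wedge_scl_left wedge_scl_right)

section \<open>Powers of the coframe as an iterated operator\<close>

primrec epow :: "('m, 'n) ext \<Rightarrow> nat \<Rightarrow> ('m, 'n) ext" where
  "epow e 0 = ext_one"
| "epow e (Suc k) = wedge e (epow e k)"

lemma alternating_epow: "alternating (epow e k)"
  by (cases k) (simp_all add: alternating_intros)

lemma alternating_funpow_wedge: "alternating A \<Longrightarrow> alternating ((wedge e ^^ k) A)"
  by (cases k) (simp_all add: alternating_intros)

lemma bidegree_funpow_wedge:
  assumes "bidegree 1 1 e" "bidegree i j A"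
  shows "bidegree (i + k) (j + k) ((wedge e ^^ k) A)"
proof (induction k)
  case (Suc k)
  from bidegree_wedge[OF assms(1) this] show ?case by simp
qed (use assms in simp)

lemma funpow_wedge_linear:
  "(wedge e ^^ k) (A + B) = (wedge e ^^ k) A + (wedge e ^^ k) B"
  "(wedge e ^^ k) (A - B) = (wedge e ^^ k) A - (wedge e ^^ k) B"
  "(wedge e ^^ k) (scl c A) = scl c ((wedge e ^^ k) A)"
  "(wedge e ^^ k) 0 = 0"
  by (induction k) (simp_all only: funpow.simps id_apply o_apply wedge_add_right wedge_diff_right
      wedge_scl_right wedge_0_right)

lemma wedge_even_left_commute:
  assumes e: "bidegree 1 1 e" and AB: "alternating A" "alternating B"
  shows "wedge A (wedge e B) = wedge e (wedge A B)"
proof -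
  have 1: "alternating e" "homog 2 e"
    using bidegree_alternating[OF e] bidegree_homog[OF e] by (simp_all add: numeral_2_eq_2)
  have "wedge A (wedge e B) = wedge (wedge A e) B" using wedge_assoc[of A e B] AB 1 by simp
  also have "\<dots> = wedge (wedge e A) B" using wedge_commute_2[of A e] AB 1 by simp
  finally show ?thesis using wedge_assoc[of e A B] AB 1 by simp
qed

text \<open>Multiplication by a power of \<open>e\<close> becomes the iteration of one operator, the
  form in which commutators with \<Lambda> can be summed.\<close>

lemma wedge_epow:
  assumes e: "bidegree 1 1 e" and A: "alternating A"
  shows "wedge A (epow e k) = (wedge e ^^ k) A"
  by (induction k)
     (simp_all add: wedge_ext_one_right A wedge_even_left_commute[OF e A alternating_epow])

lemma wedge_funpow_left:
  assumes e: "bidegree 1 1 e" and AB: "alternating A" "alternating B"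
  shows "wedge ((wedge e ^^ k) A) B = (wedge e ^^ k) (wedge A B)"
  by (induction k)
     (simp_all add: wedge_assoc bidegree_alternating[OF e] AB alternating_funpow_wedge)

text \<open>The expression \<open>[A, e]\<close> on one fibre, written with interior products so
  that its derivation property becomes visible.\<close>

definition bracket :: "('n \<Rightarrow> 'n \<Rightarrow> real) \<Rightarrow> ('m, 'n::finite) ext \<Rightarrow> ('m, 'n) ext \<Rightarrow> ('m, 'n) ext" where
  "bracket g e A = (\<Sum>a\<in>UNIV. \<Sum>b\<in>UNIV. scl (g a b) (wedge (slot (Inr b) e) (slot (Inr a) A)))"

lemma bidegree_bracket:
  assumes "bidegree (Suc i) (Suc j) e" "bidegree k (Suc l) A"
  shows "bidegree (Suc i + k) (j + l) (bracket g e A)"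
  unfolding bracket_def using assms
  by (intro bidegree_sum bidegree_linear bidegree_wedge bidegree_slot_Inr)

text \<open>The bracket with \<open>e\<close> is an even derivation. It kills \<open>e\<close>, since \<open>g\<close> is symmetric and the
  contractions of \<open>e\<close> anticommute, hence it commutes with multiplication by \<open>e\<close>.\<close>

lemma bracket_wedge:
  assumes e: "bidegree 1 1 e" and A: "alternating A" and g: "\<And>a b. g a b = g b a"
  shows "bracket g e (wedge e A) = wedge e (bracket g e A)"
proof -
  let ?e = "\<lambda>a. slot (Inr a) e"
  have ae: "alternating e" using e by (rule bidegree_alternating)
  have he: "homog 1 (?e a)" for a using bidegree_homog[OF bidegree_slot_Inr] e by (metis One_nat_def add.right_neutral)
  have anti: "wedge (?e b) (?e a) = - wedge (?e a) (?e b)" for a b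
    using wedge_commute_1[of "?e b" "?e a"] ae he by (simp add: alternating_intros homog_invol[OF he] wedge_minus_right)
  have "(\<Sum>a\<in>UNIV. \<Sum>b\<in>UNIV. scl (g a b) (wedge (?e b) (?e a)))
      = (\<Sum>b\<in>UNIV. \<Sum>a\<in>UNIV. scl (g a b) (wedge (?e b) (?e a)))" by (rule sum.swap)
  also have "\<dots> = - (\<Sum>b\<in>UNIV. \<Sum>a\<in>UNIV. scl (g b a) (wedge (?e a) (?e b)))"
    unfolding sum_negf[symmetric] by (intro sum.cong refl) (metis anti g scl_minus(1))
  finally have z: "(\<Sum>a\<in>UNIV. \<Sum>b\<in>UNIV. scl (g a b) (wedge (?e b) (?e a))) = 0"
    by (auto simp: fun_eq_iff)
  have "bracket g e (wedge e A) = (\<Sum>a\<in>UNIV. \<Sum>b\<in>UNIV. scl (g a b)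
      (wedge (wedge (?e b) (?e a)) A + wedge e (wedge (?e b) (slot (Inr a) A))))"
    unfolding bracket_def
    using bidegree_invol[OF e]
    by (intro sum.cong refl)
       (simp add: slot_wedge ae A wedge_add_right wedge_assoc alternating_intros wedge_even_left_commute[OF e])
  also have "\<dots> = wedge (\<Sum>a\<in>UNIV. \<Sum>b\<in>UNIV. scl (g a b) (wedge (?e b) (?e a))) A + wedge e (bracket g e A)"
    by (simp add: bracket_def scl_add sum.distrib wedge_sum_left wedge_sum_right wedge_scl_left wedge_scl_right)
  finally show ?thesis by (simp add: z)
qed

lemma bracket_funpow_wedge:
  assumes e: "bidegree 1 1 e" and A: "alternating A" and g: "\<And>a b. g a b = g b a"
  shows "bracket g e ((wedge e ^^ k) A) = (wedge e ^^ k) (bracket g e A)"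
  by (induction k) (simp_all add: bracket_wedge[OF e _ g] A alternating_funpow_wedge)

section \<open>The Lefschetz operators of an adapted frame\<close>

definition lowering :: "('m \<Rightarrow> 'n \<Rightarrow> real) \<Rightarrow> ('m::finite, 'n::finite) ext \<Rightarrow> ('m, 'n) ext" where
  "lowering \<theta> A = (\<Sum>\<mu>\<in>UNIV. contr (\<theta> \<mu>) (slot (Inl \<mu>) A))"

text \<open>This is the \<gamma> in the splitting A = K + e \<gamma> + en \<beta>. On degree
  \<open>(1, 0)\<close> the composition of multiplication by \<open>e\<close> with \<Lambda> is the
  scalar m - 1, whose inverse is the constant here.\<close>

definition trace_part ::
  "('m::finite, 'n::finite) ext \<Rightarrow> ('m \<Rightarrow> 'n \<Rightarrow> real) \<Rightarrow> ('n \<Rightarrow> real) \<Rightarrow> ('m, 'n) ext \<Rightarrow> ('m, 'n) ext" where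
  "trace_part en \<theta> \<nu> A = scl (1 / (real CARD('m) - 1)) (lowering \<theta> (A - wedge en (contr \<nu> A)))"

lemma slot_Inl_11:
  fixes e :: "('m::finite, 'n::finite) ext"
  assumes "bidegree 1 1 e"
  shows "slot (Inl \<mu>) e = (\<Sum>a\<in>UNIV. scl (e [Inl \<mu>, Inr a]) (gen (Inr a)))"
  using bidegree_01[OF bidegree_slot_Inl[of 0 1 e \<mu>]] assms by (simp add: slot_def)

text \<open>The sign comes from moving the fibre index in front of the form index, which stands
  first in the components of \<open>e\<close>.\<close>

lemma slot_Inr_11:
  fixes e :: "('m::finite, 'n::finite) ext"
  assumes e: "bidegree 1 1 e"
  shows "slot (Inr a) e = - (\<Sum>\<mu>\<in>UNIV. scl (e [Inl \<mu>, Inr a]) (gen (Inl \<mu>)))"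
proof -
  have b: "bidegree 1 0 (slot (Inr a) e)" using bidegree_slot_Inr[of 1 0 e a] e by simp
  have "e [Inr a, Inl \<mu>] = - e [Inl \<mu>, Inr a]" for \<mu>
    using fun_cong[OF slot_slot[OF bidegree_alternating[OF e], of "Inr a" "Inl \<mu>"], of "[]"]
    by (simp add: slot_def)
  then show ?thesis
    using bidegree_10[OF b] by (simp add: slot_def scl_minus sum_negf)
qed

text \<open>\<open>\<theta>\<close> and \<open>\<nu>\<close> form the coframe dual to the frame \<open>e(\<partial>\<^sub>\<mu>), en\<close> of the fibre. The operator \<open>\<Lambda>\<close> is the
  lowering partner of multiplication by \<open>e\<close> in the Lefschetz \<open>sl\<^sub>2\<close>-structure on the forms that
  are tangential, i.e. annihilated by \<open>contr \<nu>\<close>.\<close>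

locale adapted_frame =
  fixes e en :: "('m::finite, 'n::finite) ext" and \<theta> :: "'m \<Rightarrow> 'n \<Rightarrow> real" and \<nu> :: "'n \<Rightarrow> real"
  assumes e: "bidegree 1 1 e" and en: "bidegree 0 1 en"
    and \<theta>_e: "(\<Sum>a\<in>UNIV. \<theta> \<mu> a * e [Inl \<rho>, Inr a]) = (if \<mu> = \<rho> then 1 else 0)"
    and \<theta>_en: "(\<Sum>a\<in>UNIV. \<theta> \<mu> a * en [Inr a]) = 0"
    and \<nu>_e: "(\<Sum>a\<in>UNIV. \<nu> a * e [Inl \<rho>, Inr a]) = 0"
    and \<nu>_en: "(\<Sum>a\<in>UNIV. \<nu> a * en [Inr a]) = 1"
    and resolution: "(\<Sum>\<mu>\<in>UNIV. e [Inl \<mu>, Inr a] * \<theta> \<mu> c) + en [Inr a] * \<nu> c = (if a = c then 1 else 0)"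
begin

abbreviation L :: "nat \<Rightarrow> ('m, 'n) ext \<Rightarrow> ('m, 'n) ext" where "L k \<equiv> wedge e ^^ k"

abbreviation \<Lambda> :: "('m, 'n) ext \<Rightarrow> ('m, 'n) ext" where "\<Lambda> \<equiv> lowering \<theta>"

lemmas alternating_e = bidegree_alternating[OF e]
lemmas alternating_en = bidegree_alternating[OF en]

lemma invol_e: "invol e = e" using bidegree_invol[OF e] by simp
lemma invol_en: "invol en = - en" using bidegree_invol[OF en] by simp

lemmas slot_Inl_e = slot_Inl_11[OF e]
lemmas slot_Inr_e = slot_Inr_11[OF e]

lemma bidegree_slot_Inl_e: "bidegree 0 1 (slot (Inl \<mu>) e)"
  using bidegree_slot_Inl[of 0 1 e \<mu>] e by simp

lemma contr_e: "contr x e = - (\<Sum>\<mu>\<in>UNIV. scl (\<Sum>a\<in>UNIV. x a * e [Inl \<mu>, Inr a]) (gen (Inl \<mu>)))"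
proof -
  have "contr x e = - (\<Sum>a\<in>UNIV. \<Sum>\<mu>\<in>UNIV. scl (x a * e [Inl \<mu>, Inr a]) (gen (Inl \<mu>)))"
    by (simp add: contr_def slot_Inr_e scl_minus scl_sum sum_negf)
  also have "(\<Sum>a\<in>UNIV. \<Sum>\<mu>\<in>UNIV. scl (x a * e [Inl \<mu>, Inr a]) (gen (Inl \<mu> :: 'm + 'n)))
      = (\<Sum>\<mu>\<in>UNIV. \<Sum>a\<in>UNIV. scl (x a * e [Inl \<mu>, Inr a]) (gen (Inl \<mu>)))"
    by (rule sum.swap)
  finally show ?thesis by (simp only: scl_sum_left)
qed

lemma contr_\<theta>_e: "contr (\<theta> \<mu>) e = - gen (Inl \<mu>)"
proof -
  have "(\<Sum>\<rho>\<in>UNIV. scl (if \<mu> = \<rho> then 1 else 0) (gen (Inl \<rho> :: 'm + 'n))) = (\<Sum>\<rho>\<in>UNIV. if \<mu> = \<rho> then gen (Inl \<rho>) else 0)"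
    by (rule sum.cong) auto
  then show ?thesis by (simp add: contr_e \<theta>_e)
qed

lemma contr_\<nu>_e: "contr \<nu> e = 0"
  by (simp add: contr_e \<nu>_e)

lemma contr_01:
  assumes "bidegree 0 1 A"
  shows "contr x A = scl (\<Sum>a\<in>UNIV. x a * A [Inr a]) ext_one"
proof -
  have "slot (Inr a) A = scl (A [Inr a]) ext_one" for a
    using homog_0[of "slot (Inr a) A"] bidegree_homog[OF bidegree_slot_Inr[of 0 0 A a]] assms
    by (simp add: slot_def)
  then show ?thesis by (simp add: contr_def scl_sum_left)
qed

lemma contr_en: "contr \<nu> en = ext_one"
  by (simp add: contr_01[OF en] \<nu>_en)

lemma contr_slot_e: "contr (\<theta> \<mu>) (slot (Inl \<rho>) e) = (if \<mu> = \<rho> then ext_one else 0)"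
  by (simp add: contr_01[OF bidegree_slot_Inl_e]) (simp add: slot_def \<theta>_e)

text \<open>The covector \<open>\<nu>\<close> annihilates the image of \<open>e\<close>, and
  \<open>e\<close> is even, so the contraction passes through every factor. It serves to extract the
  component along \<open>en\<close> from an equation.\<close>

lemma contr_\<nu>_L: "alternating A \<Longrightarrow> contr \<nu> (L k A) = L k (contr \<nu> A)"
  by (induction k)
     (simp_all add: contr_wedge alternating_e alternating_funpow_wedge contr_\<nu>_e invol_e)

lemma contr_en_wedge: "alternating A \<Longrightarrow> contr \<nu> (wedge en A) = A - wedge en (contr \<nu> A)"
  by (simp add: contr_wedge alternating_en contr_en wedge_ext_one_left invol_en wedge_minus_left)

lemma sum_gen_slot_Inl:
  fixes A :: "('m, 'n) ext"
  assumes "bidegree i j A"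
  shows "(\<Sum>\<mu>\<in>UNIV. wedge (gen (Inl \<mu>)) (slot (Inl \<mu>) A)) = scl (real i) A"
proof
  fix xs
  have "(\<Sum>\<mu>\<in>UNIV. wedge (gen (Inl \<mu>)) (slot (Inl \<mu>) A)) xs
      = (\<Sum>z\<in>range Inl. wedge (gen z) (slot z A)) xs"
    by (simp add: sum.reindex)
  also have "\<dots> = real (length (filter (\<lambda>x. x \<in> range Inl) xs)) * A xs"
    by (rule sum_wedge_gen_slot) (use bidegree_alternating[OF assms] in auto)
  also have "filter (\<lambda>x. x \<in> range Inl) xs = filter isl xs"
    by (rule filter_cong) (auto simp: isl_def)
  finally show "(\<Sum>\<mu>\<in>UNIV. wedge (gen (Inl \<mu>)) (slot (Inl \<mu>) A)) xs = scl (real i) A xs"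
    using assms by (cases "A xs = 0") (auto simp: scl_def bidegree_iff)
qed

lemma sum_gen_slot_Inr:
  fixes A :: "('m, 'n) ext"
  assumes "bidegree i j A"
  shows "(\<Sum>a\<in>UNIV. wedge (gen (Inr a)) (slot (Inr a) A)) = scl (real j) A"
proof
  fix xs
  have "(\<Sum>a\<in>UNIV. wedge (gen (Inr a)) (slot (Inr a) A)) xs
      = (\<Sum>z\<in>range Inr. wedge (gen z) (slot z A)) xs"
    by (simp add: sum.reindex)
  also have "\<dots> = real (length (filter (\<lambda>x. x \<in> range Inr) xs)) * A xs"
    by (rule sum_wedge_gen_slot) (use bidegree_alternating[OF assms] in auto)
  also have "filter (\<lambda>x. x \<in> range Inr) xs = filter (\<lambda>x. \<not> isl x) xs"
    by (rule filter_cong) (auto simp: isl_def image_iff, metis sum.exhaust)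
  finally show "(\<Sum>a\<in>UNIV. wedge (gen (Inr a)) (slot (Inr a) A)) xs = scl (real j) A xs"
    using assms by (cases "A xs = 0") (auto simp: scl_def bidegree_iff)
qed

text \<open>By the resolution of the identity the left side is the fibre number operator up to the
  component along \<open>en\<close>, and a tangential form has no such component.\<close>

lemma sum_slot_e_contr:
  assumes A: "bidegree i j A" and tangential: "contr \<nu> A = 0"
  shows "(\<Sum>\<mu>\<in>UNIV. wedge (slot (Inl \<mu>) e) (contr (\<theta> \<mu>) A)) = scl (real j) A"
proof -
  let ?g = "\<lambda>a c. wedge (gen (Inr a)) (slot (Inr c) A)"
  have en_gen: "en = (\<Sum>a\<in>UNIV. scl (en [Inr a]) (gen (Inr a)))"
    by (rule bidegree_01[OF en])
  have 1: "wedge (slot (Inl \<mu>) e) (contr (\<theta> \<mu>) A)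
      = (\<Sum>a\<in>UNIV. \<Sum>c\<in>UNIV. scl (e [Inl \<mu>, Inr a] * \<theta> \<mu> c) (?g a c))" for \<mu>
    unfolding slot_Inl_e contr_def wedge_sum_left wedge_sum_right wedge_scl_left wedge_scl_right
    by (subst sum.swap) (simp add: scl_sum mult.commute)
  have 2: "wedge en (contr \<nu> A) = (\<Sum>a\<in>UNIV. \<Sum>c\<in>UNIV. scl (en [Inr a] * \<nu> c) (?g a c))"
    by (subst en_gen, unfold contr_def wedge_sum_left wedge_sum_right wedge_scl_left wedge_scl_right, subst sum.swap)
       (simp add: scl_sum mult.commute)
  have "(\<Sum>\<mu>\<in>UNIV. wedge (slot (Inl \<mu>) e) (contr (\<theta> \<mu>) A))
      = (\<Sum>a\<in>UNIV. \<Sum>\<mu>\<in>UNIV. \<Sum>c\<in>UNIV. scl (e [Inl \<mu>, Inr a] * \<theta> \<mu> c) (?g a c))"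
    unfolding 1 by (rule sum.swap)
  also have "\<dots> = (\<Sum>a\<in>UNIV. \<Sum>c\<in>UNIV. \<Sum>\<mu>\<in>UNIV. scl (e [Inl \<mu>, Inr a] * \<theta> \<mu> c) (?g a c))"
    by (intro sum.cong refl sum.swap)
  also have "\<dots> = (\<Sum>a\<in>UNIV. \<Sum>c\<in>UNIV. scl (\<Sum>\<mu>\<in>UNIV. e [Inl \<mu>, Inr a] * \<theta> \<mu> c) (?g a c))"
    by (simp add: scl_sum_left)
  finally have "(\<Sum>\<mu>\<in>UNIV. wedge (slot (Inl \<mu>) e) (contr (\<theta> \<mu>) A)) + wedge en (contr \<nu> A)
      = (\<Sum>a\<in>UNIV. \<Sum>c\<in>UNIV. scl ((\<Sum>\<mu>\<in>UNIV. e [Inl \<mu>, Inr a] * \<theta> \<mu> c) + en [Inr a] * \<nu> c) (?g a c))"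
    unfolding 2 by (simp add: scl_add sum.distrib)
  also have "\<dots> = (\<Sum>a\<in>UNIV. \<Sum>c\<in>UNIV. if a = c then ?g a c else 0)"
    unfolding resolution by (intro sum.cong refl) auto
  also have "\<dots> = (\<Sum>a\<in>UNIV. ?g a a)" by simp
  also have "\<dots> = scl (real j) A" by (rule sum_gen_slot_Inr[OF A])
  finally show ?thesis by (simp add: tangential)
qed

section \<open>The lowering operator and its commutator with the coframe\<close>

lemma bidegree_\<Lambda>: "bidegree (Suc i) (Suc j) A \<Longrightarrow> bidegree i j (\<Lambda> A)"
  unfolding lowering_def by (intro bidegree_sum bidegree_contr bidegree_slot_Inl)

lemma \<Lambda>_0: "bidegree 0 j A \<Longrightarrow> \<Lambda> A = 0" "bidegree i 0 A \<Longrightarrow> \<Lambda> A = 0"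
proof -
  show "\<Lambda> A = 0" if "bidegree 0 j A" using that by (simp add: lowering_def slot_Inl_0 contr_linear)
  show "\<Lambda> A = 0" if "bidegree i 0 A"
  proof (cases i)
    case 0
    then show ?thesis using that by (simp add: lowering_def slot_Inl_0 contr_linear)
  next
    case (Suc i')
    then have "contr x (slot (Inl \<mu>) A) = 0" for x \<mu>
      using that by (intro contr_0 bidegree_slot_Inl) simp
    then show ?thesis by (simp add: lowering_def)
  qed
qed

lemma \<Lambda>_linear: "\<Lambda> (A + B) = \<Lambda> A + \<Lambda> B" "\<Lambda> (A - B) = \<Lambda> A - \<Lambda> B" "\<Lambda> (scl c A) = scl c (\<Lambda> A)"
  by (simp_all add: lowering_def slot_linear contr_linear sum.distrib sum_subtractf scl_sum)

text \<open>The scalar has three sources: the full contraction of \<open>e\<close> gives m, and the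
  two terms in which only one contraction meets \<open>e\<close> are number operators, giving -i in
  the form and -j in the fibre directions.\<close>

lemma \<Lambda>_wedge_e:
  assumes A: "bidegree i j A" and tangential: "contr \<nu> A = 0"
  shows "\<Lambda> (wedge e A) = scl (real CARD('m) - real i - real j) A + wedge e (\<Lambda> A)"
proof -
  have al: "alternating A" using A by (rule bidegree_alternating)
  have inv: "invol (slot (Inl \<mu>) e) = - slot (Inl \<mu>) e" for \<mu>
    using bidegree_invol[OF bidegree_slot_Inl_e] by simp
  have "contr (\<theta> \<mu>) (slot (Inl \<mu>) (wedge e A)) = A - wedge (slot (Inl \<mu>) e) (contr (\<theta> \<mu>) A)
      + (wedge e (contr (\<theta> \<mu>) (slot (Inl \<mu>) A)) - wedge (gen (Inl \<mu>)) (slot (Inl \<mu>) A))" for \<mu>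
    by (simp add: slot_wedge alternating_e al contr_linear contr_wedge alternating_intros invol_e inv
        contr_slot_e wedge_ext_one_left wedge_minus_left contr_\<theta>_e)
  then have "\<Lambda> (wedge e A) = (\<Sum>\<mu>\<in>(UNIV::'m set). A) - (\<Sum>\<mu>\<in>UNIV. wedge (slot (Inl \<mu>) e) (contr (\<theta> \<mu>) A))
      + (wedge e (\<Lambda> A) - (\<Sum>\<mu>\<in>UNIV. wedge (gen (Inl \<mu>)) (slot (Inl \<mu>) A)))"
    by (simp add: lowering_def sum.distrib sum_subtractf wedge_sum_right)
  also have "(\<Sum>\<mu>\<in>(UNIV::'m set). A) = scl (real CARD('m)) A"
    by (rule ext) (simp add: sum_fun_apply scl_def)
  finally show ?thesis
    by (simp add: sum_slot_e_contr[OF A tangential] sum_gen_slot_Inl[OF A])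
       (auto simp: fun_eq_iff scl_def algebra_simps)
qed

text \<open>Each factor \<open>e\<close> raises both degrees by one and lowers the commutator by
  two; the sum of m - i - j - 2l over l = 0, ..., k is (k + 1)(m - i - j - k).\<close>

lemma \<Lambda>_L_Suc:
  assumes A: "bidegree i j A" and tangential: "contr \<nu> A = 0"
  shows "\<Lambda> (L (Suc k) A) = scl (real (Suc k) * (real CARD('m) - real i - real j - real k)) (L k A) + L (Suc k) (\<Lambda> A)"
proof (induction k)
  case 0
  then show ?case using \<Lambda>_wedge_e[OF assms] by simp
next
  case (Suc k)
  have t: "contr \<nu> (L (Suc k) A) = 0"
    using contr_\<nu>_L[OF bidegree_alternating[OF A], of "Suc k"] tangential funpow_wedge_linear(4)[of "Suc k" e] by simp
  have "\<Lambda> (L (Suc (Suc k)) A) = \<Lambda> (wedge e (L (Suc k) A))" by simp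
  also have "\<dots> = scl (real CARD('m) - real (i + Suc k) - real (j + Suc k)) (L (Suc k) A) + wedge e (\<Lambda> (L (Suc k) A))"
    by (rule \<Lambda>_wedge_e[OF bidegree_funpow_wedge[OF e A] t])
  also have "wedge e (\<Lambda> (L (Suc k) A)) = scl (real (Suc k) * (real CARD('m) - real i - real j - real k)) (L (Suc k) A) + L (Suc (Suc k)) (\<Lambda> A)"
    unfolding Suc.IH wedge_add_right wedge_scl_right by simp
  finally show ?case by (auto simp: fun_eq_iff scl_def algebra_simps)
qed

text \<open>In fibre degree zero \<Lambda> kills \<open>A\<close>, so \<Lambda> strips one factor
  \<open>e\<close> from the power, with a coefficient that does not vanish in the given
  range.\<close>

lemma L_inj_0:
  assumes "bidegree i 0 A" "L k A = 0" "i + k \<le> CARD('m)"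
  shows "A = 0"
  using assms(2,3)
proof (induction k)
  case (Suc k)
  have "0 = \<Lambda> (L (Suc k) A)" by (simp only: Suc.prems(1) \<Lambda>_0(1)[OF bidegree_linear(5)])
  also have "\<dots> = scl (real (Suc k) * (real CARD('m) - real i - real k)) (L k A)"
    using \<Lambda>_L_Suc[OF assms(1) contr_0[OF assms(1)], of k] \<Lambda>_0(2)[OF assms(1)] funpow_wedge_linear(4)[of "Suc k" e]
    by simp
  finally have "L k A = 0"
    by (rule scl_eq_0D[OF sym]) (use Suc.prems(2) in auto)
  then show ?case using Suc by simp
qed simp

text \<open>Here \<Lambda> A need not vanish a priori, but it has fibre degree zero. Once it is
  shown to vanish by \<open>L_inj_0\<close>, the descent works as before.\<close>

lemma L_inj_1:
  assumes A: "bidegree i 1 A" and tangential: "contr \<nu> A = 0" and "L k A = 0" "i + 1 + k \<le> CARD('m)"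
  shows "A = 0"
  using assms(3,4)
proof (induction k)
  case (Suc k)
  let ?c = "real (Suc k) * (real CARD('m) - real i - 1 - real k)"
  have "0 = \<Lambda> (L (Suc k) A)" by (simp only: Suc.prems(1) \<Lambda>_0(1)[OF bidegree_linear(5)])
  also have "\<dots> = scl ?c (L k A) + L (Suc k) (\<Lambda> A)"
    using \<Lambda>_L_Suc[OF A tangential, of k] by simp
  finally have eq: "scl ?c (L k A) + L (Suc k) (\<Lambda> A) = 0" ..
  \<comment> \<open>One further factor \<open>e\<close> turns the first term into a multiple of the
    vanishing power and isolates \<Lambda> A. The degree bound survives because \<Lambda> lowers the
    form degree by one: (i - 1) + (k + 2) = i + 1 + k.\<close>
  have "L (Suc (Suc k)) (\<Lambda> A) = wedge e (scl ?c (L k A) + L (Suc k) (\<Lambda> A)) - scl ?c (L (Suc k) A)"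
    by (simp add: wedge_add_right wedge_scl_right)
  also have "\<dots> = 0" unfolding eq Suc.prems(1) by simp
  finally have LL: "L (Suc (Suc k)) (\<Lambda> A) = 0" .
  have "\<Lambda> A = 0"
  proof (cases i)
    case 0
    then show ?thesis using A by (simp add: \<Lambda>_0)
  next
    case (Suc i')
    then have "bidegree i' 0 (\<Lambda> A)" using A bidegree_\<Lambda>[of i' 0 A] by simp
    then show ?thesis by (rule L_inj_0[OF _ LL]) (use Suc Suc.prems(2) in simp)
  qed
  then have "scl ?c (L k A) = 0" using eq funpow_wedge_linear(4)[of "Suc k" e] by simp
  then have "L k A = 0" by (rule scl_eq_0D) (use Suc.prems(2) in auto)
  then show ?case using Suc by simp
qed simp

text \<open>At k = m - 3 the coefficient m - 3 - k in \<open>\<Lambda>_L_Suc\<close> vanishes, so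
  \<Lambda> kills the product. The product has bidegree (m, m - 1), hence \<open>e\<close> kills it
  as well, and the commutator acts on it by the nonzero scalar 1 - m.\<close>

lemma L_primitive_21:
  assumes A: "bidegree 2 1 A" and tangential: "contr \<nu> A = 0" and "\<Lambda> A = 0" and m: "CARD('m) \<ge> 3"
  shows "L (CARD('m) - 2) A = 0"
proof -
  define k where "k = CARD('m) - 3"
  have k: "CARD('m) = k + 3" "CARD('m) - 2 = Suc k" using m by (auto simp: k_def)
  let ?P = "L (Suc k) A"
  have P: "bidegree (k + 3) (k + 2) ?P"
    using bidegree_funpow_wedge[OF e A, of "Suc k"] by (simp add: eval_nat_numeral)
  have "\<Lambda> ?P = 0"
    using \<Lambda>_L_Suc[OF A tangential, of k] assms(3) funpow_wedge_linear(4)[of "Suc k" e] k by simp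
  moreover have "bidegree (k + 4) (k + 3) (wedge e ?P)"
    using bidegree_wedge[OF e P] by (simp add: eval_nat_numeral)
  then have "wedge e ?P = 0" by (rule bidegree_vanish) (simp add: k)
  moreover have "contr \<nu> ?P = 0"
    using contr_\<nu>_L[OF bidegree_alternating[OF A], of "Suc k"] tangential funpow_wedge_linear(4)[of "Suc k" e] by simp
  ultimately have "0 = scl (real CARD('m) - real (k + 3) - real (k + 2)) ?P"
    using \<Lambda>_wedge_e[OF P] \<Lambda>_0(1)[OF bidegree_linear(5)] by simp
  then have "?P = 0" by (rule scl_eq_0D[OF sym]) (simp add: k)
  then show ?thesis by (simp add: k)
qed

text \<open>The covector \<open>\<nu>\<close> is contracted into both equations. The first shows
  that \<open>A\<close> is tangential, the second that e^(m-3) kills A - e s, where s is the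
  contraction of \<open>S\<close>. All three injectivity statements used are limiting cases: 2 + (m
  - 2), 2 + 1 + (m - 3) and 1 + (m - 1) all equal m.\<close>

lemma transversal_injective:
  assumes A: "bidegree 2 1 A" and LA: "L (CARD('m) - 2) A = 0" and m: "CARD('m) \<ge> 3"
    and S: "bidegree 1 1 S" and eq: "L (CARD('m) - 3) (wedge en A) = L (CARD('m) - 2) S"
  shows "A = 0"
proof -
  have al: "alternating A" "alternating S" using A S by (auto intro: bidegree_alternating)
  define s where "s = contr \<nu> S"
  have s: "bidegree 1 0 s" using bidegree_contr[of 1 0 S] S by (simp add: s_def)
  have b: "bidegree 2 0 (contr \<nu> A)" using bidegree_contr[of 2 0 A] A by simp
  have "L (CARD('m) - 2) (contr \<nu> A) = 0"
    using contr_\<nu>_L[OF al(1), of "CARD('m) - 2"] LA by (simp add: contr_linear)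
  then have nA: "contr \<nu> A = 0" by (rule L_inj_0[OF b]) (use m in simp)
  have "L (CARD('m) - 3) A = contr \<nu> (L (CARD('m) - 3) (wedge en A))"
    by (simp add: contr_\<nu>_L alternating_intros contr_en_wedge al nA)
  also have "\<dots> = L (CARD('m) - 2) s"
    unfolding eq s_def by (rule contr_\<nu>_L[OF al(2)])
  also have "\<dots> = L (CARD('m) - 3) (wedge e s)"
  proof -
    have "CARD('m) - 2 = Suc (CARD('m) - 3)" using m by simp
    then show ?thesis by (simp add: funpow_swap1)
  qed
  finally have "L (CARD('m) - 3) (A - wedge e s) = 0" by (simp add: funpow_wedge_linear)
  moreover have es: "bidegree 2 1 (wedge e s)" using bidegree_wedge[OF e s] by (simp add: numeral_2_eq_2)
  moreover have "contr \<nu> (wedge e s) = 0"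
    using contr_\<nu>_L[OF bidegree_alternating[OF s], of 1] contr_0[OF s] by simp
  ultimately have "A - wedge e s = 0"
    using L_inj_1[of 2 "A - wedge e s" "CARD('m) - 3"] A nA m by (simp add: contr_linear bidegree_linear)
  then have As: "A = wedge e s" by simp
  then have "L (CARD('m) - 1) s = 0"
  proof -
    have "CARD('m) - 1 = Suc (CARD('m) - 2)" using m by simp
    then show ?thesis using LA As by (simp add: funpow_swap1)
  qed
  then have "s = 0" by (rule L_inj_0[OF s]) (use m in simp)
  then show ?thesis by (simp add: As)
qed

section \<open>The splitting of forms of degree \<open>(2, 1)\<close> at a point\<close>

abbreviation gamma_part :: "('m, 'n) ext \<Rightarrow> ('m, 'n) ext" where
  "gamma_part \<equiv> trace_part en \<theta> \<nu>"

abbreviation primitive_part :: "('m, 'n) ext \<Rightarrow> ('m, 'n) ext" where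
  "primitive_part A \<equiv> A - wedge en (contr \<nu> A) - wedge e (gamma_part A)"

lemma bidegree_parts:
  assumes A: "bidegree 2 1 A"
  shows "bidegree 2 0 (contr \<nu> A)" "bidegree 1 0 (gamma_part A)" "bidegree 2 1 (primitive_part A)"
proof -
  show b: "bidegree 2 0 (contr \<nu> A)" using bidegree_contr[of 2 0 A] A by simp
  have 1: "bidegree 2 1 (A - wedge en (contr \<nu> A))"
    using bidegree_wedge[OF en b] A by (simp add: bidegree_linear numeral_2_eq_2)
  show g: "bidegree 1 0 (gamma_part A)"
    unfolding trace_part_def using bidegree_\<Lambda>[of 1 0] 1 by (simp add: bidegree_linear numeral_2_eq_2)
  show "bidegree 2 1 (primitive_part A)"
    using 1 bidegree_wedge[OF e g]
    by (simp add: bidegree_linear numeral_2_eq_2)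
qed

lemma L_primitive_part:
  assumes A: "bidegree 2 1 A" and m: "CARD('m) \<ge> 3"
  shows "L (CARD('m) - 2) (primitive_part A) = 0"
proof (rule L_primitive_21[OF bidegree_parts(3)[OF A] _ _ m])
  note b = bidegree_parts(1)[OF A] and g = bidegree_parts(2)[OF A]
  have eg: "contr \<nu> (wedge e (gamma_part A)) = 0"
    using contr_\<nu>_L[OF bidegree_alternating[OF g], of 1] contr_0[OF g] by simp
  show "contr \<nu> (primitive_part A) = 0"
    using contr_0[OF b] eg
    by (simp add: contr_linear contr_en_wedge bidegree_alternating[OF b])
  have "\<Lambda> (wedge e (gamma_part A)) = scl (real CARD('m) - 1) (gamma_part A)"
    using \<Lambda>_wedge_e[OF g contr_0[OF g]] \<Lambda>_0(2)[OF g] by simp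
  also have "\<dots> = \<Lambda> (A - wedge en (contr \<nu> A))"
    unfolding trace_part_def using m by simp
  finally show "\<Lambda> (primitive_part A) = 0"
    by (simp add: \<Lambda>_linear)
qed

text \<open>Contraction with \<open>\<nu>\<close> expresses \<open>b\<close> through
  \<open>K\<close>, so e^(m-2) kills \<open>b\<close>; what remains says that e^(m-1) kills
  \<open>g\<close>. Besides directness of the sum, this later yields independence of the
  chart.\<close>

lemma parts_unique:
  assumes bgK: "bidegree 2 0 b" "bidegree 1 0 g" "bidegree 2 1 K" and m: "CARD('m) \<ge> 3"
    and K: "L (CARD('m) - 2) K = 0" and eq: "K + wedge e g + wedge en b = 0"
  shows "b = 0" "g = 0" "K = 0"
proof -
  have al: "alternating b" "alternating g" "alternating K" using bgK by (auto intro: bidegree_alternating)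
  have cK: "contr \<nu> K = - b"
  proof -
    have "contr \<nu> (wedge e g) = 0"
      using contr_\<nu>_L[OF al(2), of 1] contr_0[OF bgK(2)] by simp
    then have "contr \<nu> (K + wedge e g + wedge en b) = contr \<nu> K + b"
      using contr_0[OF bgK(1)] by (simp only: contr_linear contr_en_wedge[OF al(1)]) simp
    then show ?thesis unfolding eq by (simp add: contr_linear eq_neg_iff_add_eq_0)
  qed
  have "L (CARD('m) - 2) (- b) = 0"
    using contr_\<nu>_L[OF al(3), of "CARD('m) - 2"] unfolding K cK by (simp add: contr_linear)
  then have "- b = 0" using L_inj_0[of 2 "- b" "CARD('m) - 2"] bgK m by (simp add: bidegree_linear)
  then show b: "b = 0" by simp
  then have Kg: "K = - wedge e g" using eq by (simp add: eq_neg_iff_add_eq_0)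
  have "CARD('m) - 1 = Suc (CARD('m) - 2)" using m by simp
  then have "L (CARD('m) - 1) (- g) = L (CARD('m) - 2) K"
    unfolding Kg by (simp add: funpow_swap1 wedge_minus_right)
  then have "- g = 0" using K L_inj_0[of 1 "- g" "CARD('m) - 1"] bgK m by (simp add: bidegree_linear)
  then show "g = 0" by simp
  then show "K = 0" by (simp add: Kg)
qed

end

section \<open>Smooth functions\<close>

text \<open>Derivatives are taken at interior points, so on an open set equal functions also have
  equal derivatives, and the induction passes to these.\<close>

lemma Ck_on_cong:
  assumes "open S" "\<And>x. x \<in> S \<Longrightarrow> f x = g x" "Ck_on k S f"
  shows "Ck_on k S g"
  using assms(2,3)
proof (induction k arbitrary: f g)
  case 0
  then show ?case by (simp cong: continuous_on_cong)
next
  case (Suc k)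
  have d: "f differentiable (at x)" if "x \<in> S" for x using Suc.prems(2) that by simp
  have d': "g differentiable (at x)" if "x \<in> S" for x
    using d[OF that] has_derivative_transform_within_open[OF _ assms(1) that] Suc.prems(1)
    unfolding differentiable_def by metis
  have "frechet_derivative f (at x) v = frechet_derivative g (at x) v" if "x \<in> S" for x v
    using frechet_derivative_transform_within_open[OF d[OF that] assms(1) that] Suc.prems(1) by metis
  then have "Ck_on k S (\<lambda>x. frechet_derivative g (at x) v)" for v
    using Suc.IH[of "\<lambda>x. frechet_derivative f (at x) v" "\<lambda>x. frechet_derivative g (at x) v"] Suc.prems(2) by simp
  then show ?case using d' by simp
qed

lemma Ck_on_Suc_imp: "Ck_on (Suc k) S f \<Longrightarrow> Ck_on k S f"
proof (induction k arbitrary: f)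
  case 0
  then show ?case
    by (auto intro!: continuous_at_imp_continuous_on differentiable_imp_continuous_within)
qed auto

lemma Ck_on_const: "Ck_on k S (\<lambda>x. c)"
  by (induction k arbitrary: c) auto

lemma Ck_on_bounded_linear:
  assumes l: "bounded_linear l" and S: "open S" and f: "Ck_on k S f"
  shows "Ck_on k S (\<lambda>x. l (f x))"
  using f
proof (induction k arbitrary: f)
  case 0
  then show ?case using bounded_linear.continuous_on[OF l] by simp
next
  case (Suc k)
  have h: "((\<lambda>x. l (f x)) has_derivative (\<lambda>v. l (frechet_derivative f (at x) v))) (at x)" if "x \<in> S" for x
    using Suc.prems that by (auto intro!: bounded_linear.has_derivative[OF l] simp: frechet_derivative_works[symmetric])
  have "Ck_on k S (\<lambda>x. frechet_derivative (\<lambda>x. l (f x)) (at x) v)" for v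
  proof (rule Ck_on_cong[OF S])
    show "Ck_on k S (\<lambda>x. l (frechet_derivative f (at x) v))" using Suc by simp
  qed (simp add: frechet_derivative_at[OF h, symmetric])
  then show ?case using h by (auto simp: differentiable_def)
qed

lemma Ck_on_add:
  assumes S: "open S" and "Ck_on k S f" "Ck_on k S g"
  shows "Ck_on k S (\<lambda>x. f x + g x)"
  using assms(2,3)
proof (induction k arbitrary: f g)
  case 0
  then show ?case by (simp add: continuous_on_add)
next
  case (Suc k)
  have h: "((\<lambda>x. f x + g x) has_derivative (\<lambda>v. frechet_derivative f (at x) v + frechet_derivative g (at x) v)) (at x)"
    if "x \<in> S" for x
    using Suc.prems that by (auto intro!: has_derivative_add simp: frechet_derivative_works[symmetric])
  have "Ck_on k S (\<lambda>x. frechet_derivative (\<lambda>x. f x + g x) (at x) v)" for v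
  proof (rule Ck_on_cong[OF S])
    show "Ck_on k S (\<lambda>x. frechet_derivative f (at x) v + frechet_derivative g (at x) v)" using Suc by simp
  qed (simp add: frechet_derivative_at[OF h, symmetric])
  then show ?case using h by (auto simp: differentiable_def)
qed

lemma Ck_on_mult:
  fixes f g :: "'a::real_normed_vector \<Rightarrow> real"
  assumes S: "open S" and "Ck_on k S f" "Ck_on k S g"
  shows "Ck_on k S (\<lambda>x. f x * g x)"
  using assms(2,3)
proof (induction k arbitrary: f g)
  case 0
  then show ?case by (simp add: continuous_on_mult)
next
  case (Suc k)
  have h: "((\<lambda>x. f x * g x) has_derivative
      (\<lambda>v. f x * frechet_derivative g (at x) v + frechet_derivative f (at x) v * g x)) (at x)"
    if "x \<in> S" for x
    using Suc.prems that by (auto intro!: has_derivative_mult simp: frechet_derivative_works[symmetric])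
  have "Ck_on k S (\<lambda>x. frechet_derivative (\<lambda>x. f x * g x) (at x) v)" for v
  proof (rule Ck_on_cong[OF S])
    show "Ck_on k S (\<lambda>x. f x * frechet_derivative g (at x) v + frechet_derivative f (at x) v * g x)"
      using Suc Ck_on_Suc_imp[OF Suc.prems(1)] Ck_on_Suc_imp[OF Suc.prems(2)]
      by (intro Ck_on_add[OF S] Suc.IH) simp_all
  qed (simp add: frechet_derivative_at[OF h, symmetric])
  then show ?case using h by (auto simp: differentiable_def)
qed

lemma Ck_on_inverse:
  fixes f :: "'a::real_normed_vector \<Rightarrow> real"
  assumes S: "open S" and "Ck_on k S f" and nz: "\<And>x. x \<in> S \<Longrightarrow> f x \<noteq> 0"
  shows "Ck_on k S (\<lambda>x. inverse (f x))"
  using assms(2)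
proof (induction k)
  case 0
  then show ?case using nz by (simp add: continuous_on_inverse)
next
  case (Suc k)
  have h: "((\<lambda>x. inverse (f x)) has_derivative
      (\<lambda>v. - (inverse (f x) * frechet_derivative f (at x) v * inverse (f x)))) (at x)"
    if "x \<in> S" for x
    using Suc.prems that nz by (auto intro!: has_derivative_inverse simp: frechet_derivative_works[symmetric])
  have "Ck_on k S (\<lambda>x. frechet_derivative (\<lambda>x. inverse (f x)) (at x) v)" for v
  proof (rule Ck_on_cong[OF S])
    \<comment> \<open>The derivative of the inverse contains the inverse again, but is needed only
      to one order less, where the induction hypothesis supplies it.\<close>
    have "Ck_on k S (\<lambda>x. inverse (f x))" using Suc Ck_on_Suc_imp[OF Suc.prems] by simp
    then show "Ck_on k S (\<lambda>x. - (inverse (f x) * frechet_derivative f (at x) v * inverse (f x)))"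
      using Suc.prems
      by (intro Ck_on_bounded_linear[OF bounded_linear_minus[OF bounded_linear_ident] S] Ck_on_mult[OF S]) simp_all
  qed (simp add: frechet_derivative_at[OF h, symmetric])
  then show ?case using h by (auto simp: differentiable_def)
qed

lemma smooth_on_cong: "open S \<Longrightarrow> (\<And>x. x \<in> S \<Longrightarrow> f x = g x) \<Longrightarrow> smooth_on S f \<Longrightarrow> smooth_on S g"
  unfolding smooth_on_def using Ck_on_cong by metis

lemma smooth_on_const: "smooth_on S (\<lambda>x. c)"
  by (simp add: smooth_on_def Ck_on_const)

lemma smooth_on_bounded_linear: "bounded_linear l \<Longrightarrow> open S \<Longrightarrow> smooth_on S f \<Longrightarrow> smooth_on S (\<lambda>x. l (f x))"
  by (simp add: smooth_on_def Ck_on_bounded_linear)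

lemma smooth_on_add: "open S \<Longrightarrow> smooth_on S f \<Longrightarrow> smooth_on S g \<Longrightarrow> smooth_on S (\<lambda>x. f x + g x)"
  by (simp add: smooth_on_def Ck_on_add)

lemma smooth_on_mult:
  fixes f g :: "'a::real_normed_vector \<Rightarrow> real"
  shows "open S \<Longrightarrow> smooth_on S f \<Longrightarrow> smooth_on S g \<Longrightarrow> smooth_on S (\<lambda>x. f x * g x)"
  by (simp add: smooth_on_def Ck_on_mult)

lemma smooth_on_inverse:
  fixes f :: "'a::real_normed_vector \<Rightarrow> real"
  shows "open S \<Longrightarrow> smooth_on S f \<Longrightarrow> (\<And>x. x \<in> S \<Longrightarrow> f x \<noteq> 0) \<Longrightarrow> smooth_on S (\<lambda>x. inverse (f x))"
  by (simp add: smooth_on_def Ck_on_inverse)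

lemma smooth_on_minus: "open S \<Longrightarrow> smooth_on S f \<Longrightarrow> smooth_on S (\<lambda>x. - f x)"
  by (rule smooth_on_bounded_linear) (simp_all add: bounded_linear_minus bounded_linear_ident)

lemma smooth_on_diff: "open S \<Longrightarrow> smooth_on S f \<Longrightarrow> smooth_on S g \<Longrightarrow> smooth_on S (\<lambda>x. f x - g x)"
  using smooth_on_add[of S f "\<lambda>x. - g x"] smooth_on_minus[of S g] by simp

lemma smooth_on_vec_nth: "open S \<Longrightarrow> smooth_on S f \<Longrightarrow> smooth_on S (\<lambda>x. f x $ i)"
  by (rule smooth_on_bounded_linear) (simp_all add: bounded_linear_vec_nth)

lemma smooth_on_sum:
  "open S \<Longrightarrow> (\<And>i. i \<in> I \<Longrightarrow> smooth_on S (f i)) \<Longrightarrow> smooth_on S (\<lambda>x. \<Sum>i\<in>I. f i x)"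
  by (induction I rule: infinite_finite_induct) (auto simp: smooth_on_const smooth_on_add)

lemma smooth_on_prod:
  fixes f :: "'i \<Rightarrow> 'a::real_normed_vector \<Rightarrow> real"
  shows "open S \<Longrightarrow> (\<And>i. i \<in> I \<Longrightarrow> smooth_on S (f i)) \<Longrightarrow> smooth_on S (\<lambda>x. \<Prod>i\<in>I. f i x)"
  by (induction I rule: infinite_finite_induct) (auto simp: smooth_on_const smooth_on_mult)

lemma smooth_on_frechet_derivative:
  assumes "smooth_on S f"
  shows "smooth_on S (\<lambda>x. frechet_derivative f (at x) v)"
  unfolding smooth_on_def
proof
  fix k
  have "Ck_on (Suc k) S f" using assms unfolding smooth_on_def by blast
  then show "Ck_on k S (\<lambda>x. frechet_derivative f (at x) v)" by simp
qed

lemma smooth_on_differentiable: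
  assumes "smooth_on S f" "x \<in> S"
  shows "f differentiable (at x)"
proof -
  have "Ck_on (Suc 0) S f" using assms(1) unfolding smooth_on_def by blast
  then show ?thesis using assms(2) by simp
qed

lemma smooth_on_continuous:
  assumes "smooth_on S f"
  shows "continuous_on S f"
proof -
  have "Ck_on 0 S f" using assms(1) unfolding smooth_on_def by blast
  then show ?thesis by simp
qed

section \<open>Symmetry of second derivatives\<close>

lemma has_real_derivative_along_line:
  fixes f :: "'a::real_normed_vector \<Rightarrow> real"
  assumes "f differentiable (at (a + s *\<^sub>R u))"
  shows "((\<lambda>s. f (a + s *\<^sub>R u)) has_real_derivative frechet_derivative f (at (a + s *\<^sub>R u)) u) (at s)"
proof -
  let ?D = "frechet_derivative f (at (a + s *\<^sub>R u))"
  have f: "(f has_derivative ?D) (at (a + s *\<^sub>R u))" using assms by (simp add: frechet_derivative_works)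
  have "((\<lambda>s. a + s *\<^sub>R u) has_derivative (\<lambda>h. h *\<^sub>R u)) (at s)"
    by (auto intro!: derivative_eq_intros)
  from has_derivative_compose[OF this f]
  have "((\<lambda>s. f (a + s *\<^sub>R u)) has_derivative (\<lambda>h. ?D (h *\<^sub>R u))) (at s)" .
  moreover have "?D (h *\<^sub>R u) = h * ?D u" for h
    using linear_scale[OF has_derivative_linear[OF f], of h u] by simp
  ultimately show ?thesis
    by (simp add: has_field_derivative_def mult.commute[of _ "?D u"])
qed

text \<open>The mean value theorem is applied twice: along \<open>u\<close> to the increment of
  \<open>f\<close> under translation by \<open>t *\<^sub>R v\<close>, then along \<open>v\<close> to
  the derivative in direction \<open>u\<close>.\<close>

lemma second_difference_mean_value:
  fixes f :: "'a::real_normed_vector \<Rightarrow> real"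
  assumes f: "\<And>y. y \<in> ball x r \<Longrightarrow> f differentiable (at y)"
    and f': "\<And>y. y \<in> ball x r \<Longrightarrow> (\<lambda>y. frechet_derivative f (at y) u) differentiable (at y)"
    and t: "0 < t" "t * (norm u + norm v) < r"
  obtains y where "norm (y - x) \<le> t * (norm u + norm v)"
    "f (x + t *\<^sub>R v + t *\<^sub>R u) - f (x + t *\<^sub>R u) - (f (x + t *\<^sub>R v) - f x)
      = t * t * frechet_derivative (\<lambda>y. frechet_derivative f (at y) u) (at y) v"
proof -
  have nb: "norm (a *\<^sub>R u + b *\<^sub>R v) \<le> t * (norm u + norm v)" if "0 \<le> a" "a \<le> t" "0 \<le> b" "b \<le> t" for a b
  proof -
    have "norm (a *\<^sub>R u + b *\<^sub>R v) \<le> a * norm u + b * norm v"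
      using norm_triangle_ineq[of "a *\<^sub>R u" "b *\<^sub>R v"] that by simp
    also have "\<dots> \<le> t * norm u + t * norm v"
      using that by (intro add_mono mult_right_mono) auto
    finally show ?thesis by (simp add: distrib_left)
  qed
  have inb: "x + b *\<^sub>R v + a *\<^sub>R u \<in> ball x r" if "0 \<le> a" "a \<le> t" "0 \<le> b" "b \<le> t" for a b
    using nb[OF that] t(2) by (simp add: dist_norm norm_minus_commute algebra_simps)
  let ?g = "\<lambda>y. frechet_derivative f (at y) u"
  have "\<exists>z>0. z < t \<and> (\<lambda>s. f (x + t *\<^sub>R v + s *\<^sub>R u) - f (x + s *\<^sub>R u)) t - (\<lambda>s. f (x + t *\<^sub>R v + s *\<^sub>R u) - f (x + s *\<^sub>R u)) 0
      = (t - 0) * (?g (x + t *\<^sub>R v + z *\<^sub>R u) - ?g (x + z *\<^sub>R u))"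
  proof (rule MVT2)
    fix s assume s: "0 \<le> s" "s \<le> t"
    show "((\<lambda>s. f (x + t *\<^sub>R v + s *\<^sub>R u) - f (x + s *\<^sub>R u)) has_real_derivative
        ?g (x + t *\<^sub>R v + s *\<^sub>R u) - ?g (x + s *\<^sub>R u)) (at s)"
      using f[OF inb[of s t]] f[OF inb[of s 0]] s t(1)
      by (intro DERIV_diff has_real_derivative_along_line) simp_all
  qed (use t in simp)
  then obtain z where z: "0 < z" "z < t" and eq1: "f (x + t *\<^sub>R v + t *\<^sub>R u) - f (x + t *\<^sub>R u) - (f (x + t *\<^sub>R v) - f x)
      = t * (?g (x + t *\<^sub>R v + z *\<^sub>R u) - ?g (x + z *\<^sub>R u))" by auto
  have "\<exists>w>0. w < t \<and> (\<lambda>s. ?g (x + z *\<^sub>R u + s *\<^sub>R v)) t - (\<lambda>s. ?g (x + z *\<^sub>R u + s *\<^sub>R v)) 0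
      = (t - 0) * frechet_derivative ?g (at (x + z *\<^sub>R u + w *\<^sub>R v)) v"
  proof (rule MVT2)
    fix s assume s: "0 \<le> s" "s \<le> t"
    show "((\<lambda>s. ?g (x + z *\<^sub>R u + s *\<^sub>R v)) has_real_derivative
        frechet_derivative ?g (at (x + z *\<^sub>R u + s *\<^sub>R v)) v) (at s)"
      using f'[OF inb[of z s]] s z
      by (intro has_real_derivative_along_line) (simp add: algebra_simps)
  qed (use t in simp)
  then obtain w where w: "0 < w" "w < t" and eq2: "?g (x + z *\<^sub>R u + t *\<^sub>R v) - ?g (x + z *\<^sub>R u)
      = t * frechet_derivative ?g (at (x + z *\<^sub>R u + w *\<^sub>R v)) v" by auto
  show ?thesis
  proof (rule that[of "x + z *\<^sub>R u + w *\<^sub>R v"])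
    show "norm (x + z *\<^sub>R u + w *\<^sub>R v - x) \<le> t * (norm u + norm v)"
      using nb[of z w] z w by (simp add: algebra_simps)
    have swap: "x + t *\<^sub>R v + z *\<^sub>R u = x + z *\<^sub>R u + t *\<^sub>R v" by simp
    show "f (x + t *\<^sub>R v + t *\<^sub>R u) - f (x + t *\<^sub>R u) - (f (x + t *\<^sub>R v) - f x)
      = t * t * frechet_derivative ?g (at (x + z *\<^sub>R u + w *\<^sub>R v)) v"
      using eq1[unfolded swap] eq2 by simp
  qed
qed

text \<open>The second difference is symmetric in \<open>u\<close> and \<open>v\<close>, so the two
  mixed derivatives agree at pairs of points tending to \<open>x\<close>, and both are continuous
  there.\<close>

lemma symmetric_second_derivative:
  fixes f :: "'a::real_normed_vector \<Rightarrow> real"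
  assumes S: "open S" "x \<in> S" and f: "smooth_on S f"
  shows "frechet_derivative (\<lambda>y. frechet_derivative f (at y) u) (at x) v
       = frechet_derivative (\<lambda>y. frechet_derivative f (at y) v) (at x) u"
proof -
  let ?F = "\<lambda>y. frechet_derivative (\<lambda>y. frechet_derivative f (at y) u) (at y) v"
  let ?G = "\<lambda>y. frechet_derivative (\<lambda>y. frechet_derivative f (at y) v) (at y) u"
  obtain r where r: "r > 0" "ball x r \<subseteq> S" using S openE by blast
  have sm: "smooth_on S (\<lambda>y. frechet_derivative f (at y) w)" for w
    by (rule smooth_on_frechet_derivative[OF f])
  have d: "f differentiable (at y)" "(\<lambda>y. frechet_derivative f (at y) w) differentiable (at y)"
    if "y \<in> ball x r" for y w
    using smooth_on_differentiable[OF f] smooth_on_differentiable[OF sm] r that by blast+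
  \<comment> \<open>The summand 1 makes \<open>N\<close> positive also when both directions vanish,
    so that it can be divided by.\<close>
  define N where "N = norm u + norm v + 1"
  have N: "N \<ge> 1" by (simp add: N_def)
  have NN: "norm u + norm v \<le> N" by (simp add: N_def)
  \<comment> \<open>With offset 2 the product of \<open>t n\<close> and \<open>N\<close> is r / (n +
    2), strictly below \<open>r\<close> already for n = 0.\<close>
  define t where "t n = r / N / (real n + 2)" for n
  have t: "0 < t n" "t n * N < r" for n
  proof -
    show "0 < t n" using r N by (simp add: t_def)
    have "t n * N = r / (real n + 2)" using N by (simp add: t_def)
    also have "\<dots> < r" using r by (simp add: field_simps add_pos_nonneg)
    finally show "t n * N < r" .
  qed
  have tle: "t n * (norm u + norm v) \<le> t n * N" for n
    using NN t(1)[of n] by (intro mult_left_mono) auto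
  have "(\<lambda>n. r / N * inverse (real (Suc (Suc n)))) \<longlonglongrightarrow> r / N * 0"
    by (intro tendsto_mult tendsto_const LIMSEQ_Suc[OF LIMSEQ_inverse_real_of_nat])
  then have tN: "(\<lambda>n. t n * N) \<longlonglongrightarrow> 0"
    using tendsto_mult_right[of t 0 sequentially N] by (simp add: t_def[abs_def] divide_inverse add.commute)
  have "\<exists>y y'. norm (y - x) \<le> t n * N \<and> norm (y' - x) \<le> t n * N \<and> ?F y = ?G y'" for n
  proof -
    have lt: "t n * (norm u + norm v) < r" "t n * (norm v + norm u) < r"
      using tle[of n] t(2)[of n] by (simp_all add: add.commute)
    obtain y where y: "norm (y - x) \<le> t n * (norm u + norm v)"
      "f (x + t n *\<^sub>R v + t n *\<^sub>R u) - f (x + t n *\<^sub>R u) - (f (x + t n *\<^sub>R v) - f x) = t n * t n * ?F y"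
      using second_difference_mean_value[OF d(1) d(2) t(1) lt(1)] by metis
    obtain y' where y': "norm (y' - x) \<le> t n * (norm v + norm u)"
      "f (x + t n *\<^sub>R u + t n *\<^sub>R v) - f (x + t n *\<^sub>R v) - (f (x + t n *\<^sub>R u) - f x) = t n * t n * ?G y'"
      using second_difference_mean_value[OF d(1) d(2) t(1) lt(2)] by metis
    have swap: "x + t n *\<^sub>R u + t n *\<^sub>R v = x + t n *\<^sub>R v + t n *\<^sub>R u" by simp
    have "t n * t n * ?F y = t n * t n * ?G y'" using y(2) y'(2)[unfolded swap] by linarith
    then have "?F y = ?G y'" using t(1)[of n] by simp
    moreover have "norm (y - x) \<le> t n * N" "norm (y' - x) \<le> t n * N"
      using y(1) y'(1) tle[of n] by (simp_all add: add.commute)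
    ultimately show ?thesis by blast
  qed
  then obtain y y' where yy: "\<And>n. norm (y n - x) \<le> t n * N" "\<And>n. norm (y' n - x) \<le> t n * N"
    "\<And>n. ?F (y n) = ?G (y' n)" by metis
  have lim: "y \<longlonglongrightarrow> x" "y' \<longlonglongrightarrow> x"
    using Lim_null_comparison[of "\<lambda>n. y n - x" "\<lambda>n. t n * N" sequentially]
      Lim_null_comparison[of "\<lambda>n. y' n - x" "\<lambda>n. t n * N" sequentially] yy tN
    by (simp_all add: LIM_zero_iff)
  have c: "isCont ?F x" "isCont ?G x"
    using smooth_on_continuous[OF smooth_on_frechet_derivative[OF sm]] S continuous_on_eq_continuous_at by blast+
  have "(\<lambda>n. ?F (y n)) \<longlonglongrightarrow> ?F x" by (rule isCont_tendsto_compose[OF c(1) lim(1)])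
  moreover have "(\<lambda>n. ?F (y n)) \<longlonglongrightarrow> ?G x"
    unfolding yy(3) by (rule isCont_tendsto_compose[OF c(2) lim(2)])
  ultimately show ?thesis by (rule LIMSEQ_unique)
qed

section \<open>Sections\<close>

lemma bundle_chart:
  assumes "lorentz_bundle B"
  shows "open (chart B \<alpha> ` cdom B \<alpha>)"
    and "x \<in> chart B \<alpha> ` cdom B \<alpha> \<Longrightarrow> chart B \<alpha> (coord B \<alpha> x) = x"
    and "x \<in> chart B \<alpha> ` cdom B \<alpha> \<Longrightarrow> coord B \<alpha> x \<in> cdom B \<alpha>"
    and "p \<in> cdom B \<alpha> \<Longrightarrow> coord B \<alpha> (chart B \<alpha> p) = p"
    and "open (chart B \<alpha> ` (cdom B \<alpha> \<inter> cdom B \<beta>))"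
proof -
  have o: "open (cdom B \<alpha>)" "open (cdom B \<beta>)"
    and oi: "open (chart B \<alpha> ` cdom B \<alpha>)"
    and h: "homeomorphism (cdom B \<alpha>) (chart B \<alpha> ` cdom B \<alpha>) (chart B \<alpha>) (coord B \<alpha>)"
    using assms unfolding lorentz_bundle_def by blast+
  show "open (chart B \<alpha> ` cdom B \<alpha>)" by (rule oi)
  show "chart B \<alpha> (coord B \<alpha> x) = x" if "x \<in> chart B \<alpha> ` cdom B \<alpha>"
    using homeomorphism_apply2[OF h that] .
  show "coord B \<alpha> x \<in> cdom B \<alpha>" if "x \<in> chart B \<alpha> ` cdom B \<alpha>"
    using homeomorphism_image2[OF h] that by blast
  show "coord B \<alpha> (chart B \<alpha> p) = p" if "p \<in> cdom B \<alpha>"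
    using homeomorphism_apply1[OF h that] .
  have "openin (top_of_set (cdom B \<alpha>)) (cdom B \<alpha> \<inter> cdom B \<beta>)"
    using o by (simp add: openin_open_Int)
  from homeomorphism_imp_open_map[OF h this]
  show "open (chart B \<alpha> ` (cdom B \<alpha> \<inter> cdom B \<beta>))"
    using oi openin_open_trans by blast
qed

lemma isl_index_change: "index_change B \<alpha> \<beta> p x y \<noteq> 0 \<Longrightarrow> isl x = isl y"
  by (auto simp: index_change_def split: sum.splits)

section \<open>Smooth families of forms in one chart\<close>

definition smooth_family :: "'v::real_normed_vector set \<Rightarrow> ('v \<Rightarrow> 'a list \<Rightarrow> real) \<Rightarrow> bool" where
  "smooth_family S F \<longleftrightarrow> (\<forall>ys. smooth_on S (\<lambda>x. F x ys))"

lemma smooth_family_wedge: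
  "open S \<Longrightarrow> smooth_family S F \<Longrightarrow> smooth_family S G \<Longrightarrow> smooth_family S (\<lambda>x. wedge (F x) (G x))"
  unfolding smooth_family_def wedge_def
  by (intro allI smooth_on_sum smooth_on_mult smooth_on_const) simp_all

lemma smooth_family_add:
  "open S \<Longrightarrow> smooth_family S F \<Longrightarrow> smooth_family S G \<Longrightarrow> smooth_family S (\<lambda>x. F x + G x)"
  unfolding smooth_family_def by (auto intro!: smooth_on_add)

lemma smooth_family_diff:
  "open S \<Longrightarrow> smooth_family S F \<Longrightarrow> smooth_family S G \<Longrightarrow> smooth_family S (\<lambda>x. F x - G x)"
  unfolding smooth_family_def by (auto intro!: smooth_on_diff)

lemma smooth_family_scl:
  "open S \<Longrightarrow> smooth_on S c \<Longrightarrow> smooth_family S F \<Longrightarrow> smooth_family S (\<lambda>x. scl (c x) (F x))"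
  unfolding smooth_family_def scl_def by (auto intro!: smooth_on_mult)

lemma smooth_family_slot: "smooth_family S F \<Longrightarrow> smooth_family S (\<lambda>x. slot z (F x))"
  unfolding smooth_family_def slot_def by auto

lemma smooth_family_sum:
  "open S \<Longrightarrow> (\<And>i. i \<in> I \<Longrightarrow> smooth_family S (F i)) \<Longrightarrow> smooth_family S (\<lambda>x. \<Sum>i\<in>I. F i x)"
  unfolding smooth_family_def sum_fun_apply by (auto intro!: smooth_on_sum)

lemma smooth_family_contr:
  "open S \<Longrightarrow> (\<And>a. smooth_on S (\<lambda>x. c x a)) \<Longrightarrow> smooth_family S F \<Longrightarrow> smooth_family S (\<lambda>x. contr (c x) (F x))"
  unfolding contr_def
  by (rule smooth_family_sum[where F = "\<lambda>a x. scl (c x a) (slot (Inr a) (F x))"], assumption)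
     (simp add: smooth_family_scl smooth_family_slot)

lemma smooth_family_cong:
  assumes "open S" "\<And>x. x \<in> S \<Longrightarrow> F x = G x" "smooth_family S F"
  shows "smooth_family S G"
  unfolding smooth_family_def
proof
  fix ys
  show "smooth_on S (\<lambda>x. G x ys)"
  proof (rule smooth_on_cong[OF assms(1)])
    show "F x ys = G x ys" if "x \<in> S" for x using assms(2)[OF that] by simp
    show "smooth_on S (\<lambda>x. F x ys)" using assms(3) by (simp add: smooth_family_def)
  qed
qed

text \<open>The transition law becomes one equation between forms, so that the algebra of
  \<open>transform\<close> applies to sections.\<close>

lemma Omega_iff:
  fixes B :: "('p::topological_space, 'c, 'm::finite, 'n::finite) lbundle"
  shows
  "A \<in> Omega B i j \<longleftrightarrow>
     (\<forall>\<alpha> p. p \<notin> cdom B \<alpha> \<longrightarrow> A \<alpha> p = 0) \<and>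
     (\<forall>\<alpha>. \<forall>p\<in>cdom B \<alpha>. bidegree i j (A \<alpha> p)) \<and>
     (\<forall>\<alpha>. smooth_family (chart B \<alpha> ` cdom B \<alpha>) (\<lambda>x. A \<alpha> (coord B \<alpha> x))) \<and>
     (\<forall>\<alpha> \<beta>. \<forall>p\<in>cdom B \<alpha> \<inter> cdom B \<beta>. A \<alpha> p = transform (index_change B \<alpha> \<beta> p) (A \<beta> p))"
  unfolding Omega_def smooth_family_def mem_Collect_eq
  by (simp only: fun_eq_iff[of "_ :: ('m + 'n) list \<Rightarrow> real" "transform _ _"] transform_def)

lemma OmegaI:
  assumes "\<And>\<alpha> p. p \<notin> cdom B \<alpha> \<Longrightarrow> A \<alpha> p = 0"
    and "\<And>\<alpha> p. p \<in> cdom B \<alpha> \<Longrightarrow> bidegree i j (A \<alpha> p)"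
    and "\<And>\<alpha>. smooth_family (chart B \<alpha> ` cdom B \<alpha>) (\<lambda>x. A \<alpha> (coord B \<alpha> x))"
    and "\<And>\<alpha> \<beta> p. p \<in> cdom B \<alpha> \<Longrightarrow> p \<in> cdom B \<beta> \<Longrightarrow> A \<alpha> p = transform (index_change B \<alpha> \<beta> p) (A \<beta> p)"
  shows "A \<in> Omega B i j"
  unfolding Omega_iff using assms by blast

lemma OmegaD:
  assumes "A \<in> Omega B i j"
  shows "p \<notin> cdom B \<alpha> \<Longrightarrow> A \<alpha> p = 0"
    and "p \<in> cdom B \<alpha> \<Longrightarrow> bidegree i j (A \<alpha> p)"
    and "smooth_family (chart B \<alpha> ` cdom B \<alpha>) (\<lambda>x. A \<alpha> (coord B \<alpha> x))"
    and "p \<in> cdom B \<alpha> \<Longrightarrow> p \<in> cdom B \<beta> \<Longrightarrow> A \<alpha> p = transform (index_change B \<alpha> \<beta> p) (A \<beta> p)"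
  using assms unfolding Omega_iff by blast+

lemma Omega_bidegree: "A \<in> Omega B i j \<Longrightarrow> bidegree i j (A \<alpha> p)"
  using OmegaD(1,2)[of A B i j] by (cases "p \<in> cdom B \<alpha>") (simp_all add: bidegree_linear)

lemma Omega_alternating: "A \<in> Omega B i j \<Longrightarrow> alternating (A \<alpha> p)"
  by (rule bidegree_alternating[OF Omega_bidegree])

lemma fscale_apply: "fscale c A \<alpha> p = scl c (A \<alpha> p)"
  by (auto simp: fscale_def scl_def)

lemma Omega_add:
  assumes "lorentz_bundle B" "A \<in> Omega B i j" "C \<in> Omega B i j"
  shows "A + C \<in> Omega B i j"
proof (rule OmegaI)
  show "(A + C) \<alpha> p = 0" if "p \<notin> cdom B \<alpha>" for \<alpha> p
    using OmegaD(1)[OF assms(2) that] OmegaD(1)[OF assms(3) that] by simp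
  show "bidegree i j ((A + C) \<alpha> p)" for \<alpha> p
    using Omega_bidegree[OF assms(2)] Omega_bidegree[OF assms(3)] by (simp add: bidegree_linear)
  show "smooth_family (chart B \<alpha> ` cdom B \<alpha>) (\<lambda>x. (A + C) \<alpha> (coord B \<alpha> x))" for \<alpha>
    using smooth_family_add[OF bundle_chart(1)[OF assms(1)] OmegaD(3)[OF assms(2)] OmegaD(3)[OF assms(3)]] by simp
  show "(A + C) \<alpha> p = transform (index_change B \<alpha> \<beta> p) ((A + C) \<beta> p)"
    if "p \<in> cdom B \<alpha>" "p \<in> cdom B \<beta>" for \<alpha> \<beta> p
    using OmegaD(4)[OF assms(2) that] OmegaD(4)[OF assms(3) that] by (simp add: transform_linear)
qed

lemma Omega_fscale:
  assumes "lorentz_bundle B" "A \<in> Omega B i j"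
  shows "fscale c A \<in> Omega B i j"
proof (rule OmegaI)
  show "fscale c A \<alpha> p = 0" if "p \<notin> cdom B \<alpha>" for \<alpha> p
    using OmegaD(1)[OF assms(2) that] by (simp add: fscale_apply)
  show "bidegree i j (fscale c A \<alpha> p)" for \<alpha> p
    using Omega_bidegree[OF assms(2)] by (simp add: bidegree_linear fscale_apply)
  show "smooth_family (chart B \<alpha> ` cdom B \<alpha>) (\<lambda>x. fscale c A \<alpha> (coord B \<alpha> x))" for \<alpha>
    unfolding fscale_apply
    by (rule smooth_family_scl[OF bundle_chart(1)[OF assms(1)] smooth_on_const OmegaD(3)[OF assms(2)]])
  show "fscale c A \<alpha> p = transform (index_change B \<alpha> \<beta> p) (fscale c A \<beta> p)"
    if "p \<in> cdom B \<alpha>" "p \<in> cdom B \<beta>" for \<alpha> \<beta> p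
    using OmegaD(4)[OF assms(2) that] by (simp add: transform_linear fscale_apply)
qed

lemma Omega_diff:
  assumes "lorentz_bundle B" "A \<in> Omega B i j" "C \<in> Omega B i j"
  shows "A - C \<in> Omega B i j"
proof -
  have "A - C = A + fscale (-1) C" by (auto simp: fun_eq_iff fscale_def)
  then show ?thesis using Omega_add Omega_fscale assms by metis
qed

lemma Omega_fwedge:
  assumes "lorentz_bundle B" "A \<in> Omega B i j" "C \<in> Omega B k l"
  shows "fwedge A C \<in> Omega B (i + k) (j + l)"
proof (rule OmegaI)
  show "fwedge A C \<alpha> p = 0" if "p \<notin> cdom B \<alpha>" for \<alpha> p
    using OmegaD(1)[OF assms(2) that] by (simp add: fwedge_def)
  show "bidegree (i + k) (j + l) (fwedge A C \<alpha> p)" for \<alpha> p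
    unfolding fwedge_def by (rule bidegree_wedge[OF Omega_bidegree[OF assms(2)] Omega_bidegree[OF assms(3)]])
  show "smooth_family (chart B \<alpha> ` cdom B \<alpha>) (\<lambda>x. fwedge A C \<alpha> (coord B \<alpha> x))" for \<alpha>
    unfolding fwedge_def
    by (rule smooth_family_wedge[OF bundle_chart(1)[OF assms(1)] OmegaD(3)[OF assms(2)] OmegaD(3)[OF assms(3)]])
  show "fwedge A C \<alpha> p = transform (index_change B \<alpha> \<beta> p) (fwedge A C \<beta> p)"
    if "p \<in> cdom B \<alpha>" "p \<in> cdom B \<beta>" for \<alpha> \<beta> p
    unfolding fwedge_def
    using wedge_transform[OF Omega_alternating[OF assms(2)] Omega_alternating[OF assms(3)]]
    by (simp only: OmegaD(4)[OF assms(2) that] OmegaD(4)[OF assms(3) that])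
qed

lemma fpow_apply: "fpow e k \<alpha> p = epow (e \<alpha> p) k"
  by (induction k) (auto simp: fwedge_def)

lemma W_apply:
  assumes "e \<in> Omega B 1 1" "A \<in> Omega B i j"
  shows "W e k A \<alpha> p = (wedge (e \<alpha> p) ^^ k) (A \<alpha> p)"
  unfolding W_def fwedge_def fpow_apply
  by (rule wedge_epow[OF Omega_bidegree[OF assms(1)] Omega_alternating[OF assms(2)]])

section \<open>The adapted frame\<close>

text \<open>An arbitrary labelling of the fibre directions by the form indices and one extra label
  for \<open>en\<close>. It serves to write the frame as a square matrix, whose determinant is then
  defined.\<close>

definition frame_index :: "'m::finite option \<Rightarrow> 'n::finite" where
  "frame_index = (SOME h. bij h)"

lemma bij_frame_index:
  assumes "CARD('n::finite) = CARD('m::finite) + 1"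
  shows "bij (frame_index :: 'm option \<Rightarrow> 'n)"
proof -
  have "card (UNIV :: 'm option set) = card (UNIV :: 'n set)"
    using assms by (simp add: card_UNIV_option)
  then have "\<exists>h. bij (h :: 'm option \<Rightarrow> 'n)"
    using finite_same_card_bij[of "UNIV :: 'm option set" "UNIV :: 'n set"] by simp
  then show ?thesis unfolding frame_index_def by (rule someI_ex)
qed

definition frame_matrix :: "('m::finite, 'n::finite) ext \<Rightarrow> ('m, 'n) ext \<Rightarrow> real ^ 'n ^ 'n" where
  "frame_matrix e en = (\<chi> i a. case inv frame_index i of Some \<mu> \<Rightarrow> e [Inl \<mu>, Inr a] | None \<Rightarrow> en [Inr a])"

text \<open>The column \<open>k\<close> of the inverse of the frame matrix by Cramer's rule, which makes its
  smoothness evident.\<close>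

definition dual_vector :: "('m::finite, 'n::finite) ext \<Rightarrow> ('m, 'n) ext \<Rightarrow> 'm option \<Rightarrow> 'n \<Rightarrow> real" where
  "dual_vector e en k a = det (\<chi> i j. if j = a then axis (frame_index k) 1 $ i else frame_matrix e en $ i $ j)
      / det (frame_matrix e en)"

lemma frame_matrix_dual_vector:
  fixes e en :: "('m::finite, 'n::finite) ext"
  assumes "det (frame_matrix e en) \<noteq> 0"
  shows "(\<Sum>a\<in>UNIV. frame_matrix e en $ i $ a * dual_vector e en k a) = (if i = frame_index k then 1 else 0)"
proof -
  let ?x = "\<chi> a. dual_vector e en k a"
  have "frame_matrix e en *v ?x = axis (frame_index k) 1"
    using cramer[OF assms, of ?x "axis (frame_index k) 1"] by (simp add: dual_vector_def)
  then have "(frame_matrix e en *v ?x) $ i = axis (frame_index k) 1 $ i" by simp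
  then show ?thesis by (simp add: matrix_vector_mult_def axis_def)
qed

text \<open>The right inverse of a square matrix is also a left inverse: one product expresses
  duality with the frame, the other the resolution of the identity.\<close>

lemma adapted_frame_dual_vector:
  fixes e en :: "('m::finite, 'n::finite) ext"
  assumes card: "CARD('n) = CARD('m) + 1" and e: "bidegree 1 1 e" and en: "bidegree 0 1 en"
    and nz: "det (frame_matrix e en) \<noteq> 0"
  shows "adapted_frame e en (\<lambda>\<mu>. dual_vector e en (Some \<mu>)) (dual_vector e en None)"
proof -
  let ?h = "frame_index :: 'm option \<Rightarrow> 'n" and ?M = "frame_matrix e en"
  have bij: "bij ?h" by (rule bij_frame_index[OF card])
  then have inj: "inj ?h" by (rule bij_is_inj)
  have M: "?M $ ?h (Some \<mu>) $ a = e [Inl \<mu>, Inr a]" "?M $ ?h None $ a = en [Inr a]" for \<mu> a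
    by (simp_all add: frame_matrix_def inv_f_f[OF inj])
  have dual: "(\<Sum>a\<in>UNIV. dual_vector e en k a * ?M $ ?h l $ a) = (if k = l then 1 else 0)" for k l
    using frame_matrix_dual_vector[OF nz, of "?h l" k] inj by (auto simp: mult.commute inj_eq)
  let ?R = "\<chi> a k. dual_vector e en (inv ?h k) a"
  have "?M ** ?R = mat 1"
    using frame_matrix_dual_vector[OF nz] bij
    by (auto simp: vec_eq_iff matrix_matrix_mult_def mat_def bij_is_surj surj_f_inv_f)
  then have "?R ** ?M = mat 1" by (simp add: matrix_left_right_inverse)
  then have "(\<Sum>k\<in>UNIV. dual_vector e en (inv ?h k) c * ?M $ k $ a) = (if c = a then 1 else 0)" for a c
    by (auto simp: vec_eq_iff matrix_matrix_mult_def mat_def)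
  moreover have "(\<Sum>k\<in>UNIV. dual_vector e en (inv ?h k) c * ?M $ k $ a)
      = (\<Sum>l\<in>UNIV. dual_vector e en l c * ?M $ ?h l $ a)" for a c
    using sum.reindex_bij_betw[OF bij, of "\<lambda>k. dual_vector e en (inv ?h k) c * ?M $ k $ a"]
    by (simp add: inv_f_f[OF inj])
  ultimately have res: "(\<Sum>l\<in>UNIV. dual_vector e en l c * ?M $ ?h l $ a) = (if c = a then 1 else 0)" for a c
    by simp
  show ?thesis
  proof
    show "(\<Sum>\<mu>\<in>UNIV. e [Inl \<mu>, Inr a] * dual_vector e en (Some \<mu>) c) + en [Inr a] * dual_vector e en None c
      = (if a = c then 1 else 0)" for a c
      using res[of c a] by (simp add: UNIV_option_conv sum.reindex M mult.commute add.commute eq_commute)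
  qed (use e en dual[of "Some _" "Some _", unfolded M] dual[of "Some _" None, unfolded M]
      dual[of None "Some _", unfolded M] dual[of None None, unfolded M] in simp_all)
qed

text \<open>A kernel vector is Euclidean-orthogonal to every row, hence to the span of
  \<open>en\<close> and the image of \<open>e\<close>. This span is the whole fibre, so the vector
  is orthogonal to itself.\<close>

lemma det_frame_matrix_nonzero:
  fixes e en :: "('p::topological_space, 'c, 'm::finite, 'n::finite) field"
  assumes card: "CARD('n) = CARD('m) + 1" and "completes_frame B e en" and p: "p \<in> cdom B \<alpha>"
  shows "det (frame_matrix (e \<alpha> p) (en \<alpha> p)) \<noteq> 0"
proof -
  let ?M = "frame_matrix (e \<alpha> p) (en \<alpha> p)" and ?h = "frame_index :: 'm option \<Rightarrow> 'n"
  have inj: "inj ?h" using bij_frame_index[OF card] by (rule bij_is_inj)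
  have M: "?M $ ?h (Some \<mu>) $ a = e \<alpha> p [Inl \<mu>, Inr a]" "?M $ ?h None $ a = en \<alpha> p [Inr a]" for \<mu> a
    by (simp_all add: frame_matrix_def inv_f_f[OF inj])
  have sp: "span (insert (\<chi> a. en \<alpha> p [Inr a]) (range (coframe_map e \<alpha> p))) = UNIV"
    using assms by (simp add: completes_frame_def)
  have "x = 0" if x: "?M *v x = 0" for x
  proof -
    have row: "(\<Sum>a\<in>UNIV. ?M $ i $ a * x $ a) = 0" for i
      using x by (simp add: vec_eq_iff matrix_vector_mult_def)
    have "x \<bullet> y = 0" if y: "y \<in> insert (\<chi> a. en \<alpha> p [Inr a]) (range (coframe_map e \<alpha> p))" for y
    proof -
      consider "y = (\<chi> a. en \<alpha> p [Inr a])" | u where "y = coframe_map e \<alpha> p u" using y by blast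
      then show ?thesis
      proof cases
        case 1
        then show ?thesis using row[of "?h None"] by (simp add: inner_vec_def M mult.commute)
      next
        case 2
        have "x \<bullet> y = (\<Sum>a\<in>UNIV. \<Sum>\<mu>\<in>UNIV. u $ \<mu> * (e \<alpha> p [Inl \<mu>, Inr a] * x $ a))"
          unfolding 2 by (simp add: inner_vec_def coframe_map_def sum_distrib_left mult_ac)
        also have "\<dots> = (\<Sum>\<mu>\<in>UNIV. u $ \<mu> * (\<Sum>a\<in>UNIV. e \<alpha> p [Inl \<mu>, Inr a] * x $ a))"
          by (subst sum.swap) (simp add: sum_distrib_left)
        also have "\<dots> = 0" using row[of "?h (Some _)"] by (simp add: M)
        finally show ?thesis .
      qed
    qed
    then have "span (insert (\<chi> a. en \<alpha> p [Inr a]) (range (coframe_map e \<alpha> p))) \<subseteq> {y. x \<bullet> y = 0}"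
      by (intro span_minimal subspace_hyperplane) blast
    then have "UNIV \<subseteq> {y. x \<bullet> y = 0}" unfolding sp .
    then have "x \<in> {y. x \<bullet> y = 0}" by (rule subsetD) simp
    then show ?thesis by simp
  qed
  then have "inj ((*v) ?M)"
    using linear_injective_0[OF matrix_vector_mul_linear[of ?M]] by simp
  then show ?thesis
    using det_nz_iff_inj[OF matrix_vector_mul_linear[of ?M]] by (simp add: matrix_of_matrix_vector_mul)
qed

lemma smooth_on_det:
  "open S \<Longrightarrow> (\<And>i j. smooth_on S (\<lambda>x. M x $ i $ j)) \<Longrightarrow> smooth_on S (\<lambda>x. det (M x :: real ^ 'n ^ 'n))"
  unfolding det_def by (intro smooth_on_sum smooth_on_mult smooth_on_prod smooth_on_const)

lemma smooth_on_dual_vector: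
  fixes F G :: "'v::real_normed_vector \<Rightarrow> ('m::finite, 'n::finite) ext" 
  assumes S: "open S" and F: "smooth_family S F" and G: "smooth_family S G"
    and nz: "\<And>x. x \<in> S \<Longrightarrow> det (frame_matrix (F x) (G x)) \<noteq> 0"
  shows "smooth_on S (\<lambda>x. dual_vector (F x) (G x) k a)"
proof -
  have M: "smooth_on S (\<lambda>x. frame_matrix (F x) (G x) $ i $ j)" for i j
    using F G by (cases "inv (frame_index :: 'm option \<Rightarrow> 'n) i") (simp_all add: frame_matrix_def smooth_family_def)
  have "smooth_on S (\<lambda>x. if j = a then axis (frame_index k) 1 $ i else frame_matrix (F x) (G x) $ i $ j)" for i j
    using M smooth_on_const by (cases "j = a") simp_all
  then show ?thesis
    unfolding dual_vector_def divide_inverse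
    by (intro smooth_on_mult smooth_on_inverse smooth_on_det S nz M) (simp_all add: M)
qed

section \<open>The smooth splitting of sections of degree \<open>(2, 1)\<close>\<close>

lemma transform_funpow_wedge:
  assumes "alternating e" "alternating A"
  shows "(wedge (transform M e) ^^ k) (transform M A) = transform M ((wedge e ^^ k) A)"
  by (induction k) (simp_all add: wedge_transform assms alternating_funpow_wedge)

lemma smooth_family_lowering:
  "open S \<Longrightarrow> (\<And>\<mu> a. smooth_on S (\<lambda>x. \<theta> x \<mu> a)) \<Longrightarrow> smooth_family S F \<Longrightarrow>
    smooth_family S (\<lambda>x. lowering (\<theta> x) (F x))"
  unfolding lowering_def
  by (rule smooth_family_sum[where F = "\<lambda>\<mu> x. contr (\<theta> x \<mu>) (slot (Inl \<mu>) (F x))"], assumption)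
     (simp add: smooth_family_contr smooth_family_slot)

text \<open>The parts are defined chart by chart from the dual frame. Transporting the parts of one
  chart to another gives a second splitting of the same form, so \<open>parts_unique\<close>
  supplies the transition law.\<close>

lemma Omega_21_decomposition:
  fixes B :: "('p::{t2_space, second_countable_topology}, 'c, 'm::finite, 'n::finite) lbundle"
  assumes B: "lorentz_bundle B" and card: "CARD('n) = CARD('m) + 1" and m: "CARD('m) \<ge> 3"
    and e: "e \<in> Omega B 1 1" and en: "completes_frame B e en" and A: "A \<in> Omega B 2 1"
  obtains K \<gamma> \<beta> where "K \<in> kerW B e (CARD('m) - 2) 2 1" "\<gamma> \<in> Omega B 1 0" "\<beta> \<in> Omega B 2 0"
    "A = K + (fwedge e \<gamma> + fwedge en \<beta>)"
proof -
  have en': "en \<in> Omega B 0 1" using en by (simp add: completes_frame_def)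
  define th where "th \<alpha> p \<mu> = dual_vector (e \<alpha> p) (en \<alpha> p) (Some \<mu>)" for \<alpha> p and \<mu> :: 'm
  define nu where "nu \<alpha> p = dual_vector (e \<alpha> p) (en \<alpha> p) None" for \<alpha> p
  define \<beta> where "\<beta> = (\<lambda>\<alpha> p. if p \<in> cdom B \<alpha> then contr (nu \<alpha> p) (A \<alpha> p) else 0)"
  define \<gamma> where "\<gamma> = (\<lambda>\<alpha> p. if p \<in> cdom B \<alpha> then trace_part (en \<alpha> p) (th \<alpha> p) (nu \<alpha> p) (A \<alpha> p) else 0)"
  define K where "K = A - fwedge en \<beta> - fwedge e \<gamma>"
  have frame: "adapted_frame (e \<alpha> p) (en \<alpha> p) (th \<alpha> p) (nu \<alpha> p)" if "p \<in> cdom B \<alpha>" for \<alpha> p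
    unfolding th_def[abs_def] nu_def
    by (rule adapted_frame_dual_vector[OF card Omega_bidegree[OF e] Omega_bidegree[OF en']
          det_frame_matrix_nonzero[OF card en that]])
  have bid: "bidegree 2 0 (\<beta> \<alpha> p)" "bidegree 1 0 (\<gamma> \<alpha> p)" for \<alpha> p
  proof -
    have "bidegree 2 0 (\<beta> \<alpha> p) \<and> bidegree 1 0 (\<gamma> \<alpha> p)"
    proof (cases "p \<in> cdom B \<alpha>")
      case True
      then show ?thesis
        using adapted_frame.bidegree_parts(1,2)[OF frame[OF True] Omega_bidegree[OF A]] by (simp add: \<beta>_def \<gamma>_def)
    qed (simp add: \<beta>_def \<gamma>_def bidegree_linear)
    then show "bidegree 2 0 (\<beta> \<alpha> p)" "bidegree 1 0 (\<gamma> \<alpha> p)" by auto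
  qed
  have K_prim: "bidegree 2 1 (K \<alpha> p)" "(wedge (e \<alpha> p) ^^ (CARD('m) - 2)) (K \<alpha> p) = 0" if "p \<in> cdom B \<alpha>" for \<alpha> p
  proof -
    have "K \<alpha> p = A \<alpha> p - wedge (en \<alpha> p) (contr (nu \<alpha> p) (A \<alpha> p))
        - wedge (e \<alpha> p) (trace_part (en \<alpha> p) (th \<alpha> p) (nu \<alpha> p) (A \<alpha> p))"
      using that by (simp add: K_def fwedge_def \<beta>_def \<gamma>_def)
    then show "bidegree 2 1 (K \<alpha> p)" "(wedge (e \<alpha> p) ^^ (CARD('m) - 2)) (K \<alpha> p) = 0"
      using adapted_frame.bidegree_parts(3)[OF frame[OF that] Omega_bidegree[OF A]]
        adapted_frame.L_primitive_part[OF frame[OF that] Omega_bidegree[OF A] m] by simp_all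
  qed
  have split: "A \<alpha> p = K \<alpha> p + wedge (e \<alpha> p) (\<gamma> \<alpha> p) + wedge (en \<alpha> p) (\<beta> \<alpha> p)" for \<alpha> p
    by (simp add: K_def fwedge_def)
  have trans: "\<beta> \<alpha> p = transform (index_change B \<alpha> \<alpha>' p) (\<beta> \<alpha>' p) \<and> \<gamma> \<alpha> p = transform (index_change B \<alpha> \<alpha>' p) (\<gamma> \<alpha>' p)"
    if p: "p \<in> cdom B \<alpha>" "p \<in> cdom B \<alpha>'" for \<alpha> \<alpha>' p
  proof -
    let ?T = "transform (index_change B \<alpha> \<alpha>' p)"
    note al = bidegree_alternating[OF bid(1)] bidegree_alternating[OF bid(2)] Omega_alternating[OF e] Omega_alternating[OF en']
      bidegree_alternating[OF K_prim(1)[OF p(2)]]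
    have T: "e \<alpha> p = ?T (e \<alpha>' p)" "en \<alpha> p = ?T (en \<alpha>' p)" "A \<alpha> p = ?T (A \<alpha>' p)"
      using OmegaD(4)[OF e p] OmegaD(4)[OF en' p] OmegaD(4)[OF A p] .
    have bT: "bidegree i j X \<Longrightarrow> bidegree i j (?T X)" for i j X
      by (rule bidegree_transform[OF _ isl_index_change])
    \<comment> \<open>This is the competing splitting of \<open>A \<alpha> p\<close>. Its first part
      is again killed by the power of \<open>e\<close>, since \<open>?T\<close> respects
      products.\<close>
    have TA: "A \<alpha> p = ?T (K \<alpha>' p) + wedge (e \<alpha> p) (?T (\<gamma> \<alpha>' p)) + wedge (en \<alpha> p) (?T (\<beta> \<alpha>' p))"
      unfolding T split[of \<alpha>'] transform_linear by (simp only: wedge_transform[OF al(3,2)] wedge_transform[OF al(4,1)])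
    have "(wedge (e \<alpha> p) ^^ (CARD('m) - 2)) (?T (K \<alpha>' p)) = ?T ((wedge (e \<alpha>' p) ^^ (CARD('m) - 2)) (K \<alpha>' p))"
      unfolding T(1) by (rule transform_funpow_wedge[OF al(3) al(5)])
    then have LT: "(wedge (e \<alpha> p) ^^ (CARD('m) - 2)) (K \<alpha> p - ?T (K \<alpha>' p)) = 0"
      by (simp add: K_prim(2) p transform_linear funpow_wedge_linear)
    have eq: "(K \<alpha> p - ?T (K \<alpha>' p)) + wedge (e \<alpha> p) (\<gamma> \<alpha> p - ?T (\<gamma> \<alpha>' p)) + wedge (en \<alpha> p) (\<beta> \<alpha> p - ?T (\<beta> \<alpha>' p)) = 0"
      using split[of \<alpha> p] TA by (simp add: wedge_diff_right algebra_simps)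
    have "\<beta> \<alpha> p - ?T (\<beta> \<alpha>' p) = 0" "\<gamma> \<alpha> p - ?T (\<gamma> \<alpha>' p) = 0"
      using adapted_frame.parts_unique(1,2)[OF frame[OF p(1)] _ _ _ m LT eq] bid bT K_prim(1) p
      by (simp_all add: bidegree_linear)
    then show ?thesis by simp
  qed
  have sm: "smooth_family (chart B \<alpha> ` cdom B \<alpha>) (\<lambda>x. \<beta> \<alpha> (coord B \<alpha> x))"
    "smooth_family (chart B \<alpha> ` cdom B \<alpha>) (\<lambda>x. \<gamma> \<alpha> (coord B \<alpha> x))" for \<alpha>
  proof -
    let ?S = "chart B \<alpha> ` cdom B \<alpha>" and ?c = "coord B \<alpha>"
    note S = bundle_chart(1)[OF B, of \<alpha>] and c = bundle_chart(3)[OF B]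
    note smA = OmegaD(3)[OF A, of \<alpha>] and sme = OmegaD(3)[OF e, of \<alpha>] and smen = OmegaD(3)[OF en', of \<alpha>]
    have dual: "smooth_on ?S (\<lambda>x. dual_vector (e \<alpha> (?c x)) (en \<alpha> (?c x)) k a)" for k a
      by (rule smooth_on_dual_vector[OF S sme smen]) (rule det_frame_matrix_nonzero[OF card en c])
    have sb: "smooth_family ?S (\<lambda>x. contr (nu \<alpha> (?c x)) (A \<alpha> (?c x)))"
      by (rule smooth_family_contr[OF S _ smA]) (simp add: nu_def dual)
    show "smooth_family ?S (\<lambda>x. \<beta> \<alpha> (?c x))"
      by (rule smooth_family_cong[OF S _ sb]) (simp add: \<beta>_def c)
    have "smooth_family ?S (\<lambda>x. lowering (th \<alpha> (?c x)) (A \<alpha> (?c x) - wedge (en \<alpha> (?c x)) (contr (nu \<alpha> (?c x)) (A \<alpha> (?c x)))))"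
      by (rule smooth_family_lowering[OF S _ smooth_family_diff[OF S smA smooth_family_wedge[OF S smen sb]]])
         (simp add: th_def dual)
    then have sg: "smooth_family ?S (\<lambda>x. trace_part (en \<alpha> (?c x)) (th \<alpha> (?c x)) (nu \<alpha> (?c x)) (A \<alpha> (?c x)))"
      unfolding trace_part_def by (rule smooth_family_scl[OF S smooth_on_const])
    show "smooth_family ?S (\<lambda>x. \<gamma> \<alpha> (?c x))"
      by (rule smooth_family_cong[OF S _ sg]) (simp add: \<gamma>_def c)
  qed
  have \<beta>: "\<beta> \<in> Omega B 2 0"
  proof (rule OmegaI[OF _ bid(1) sm(1)])
    show "\<beta> \<alpha> p = 0" if "p \<notin> cdom B \<alpha>" for \<alpha> p using that by (simp add: \<beta>_def)
  qed (use trans in blast)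
  have \<gamma>: "\<gamma> \<in> Omega B 1 0"
  proof (rule OmegaI[OF _ bid(2) sm(2)])
    show "\<gamma> \<alpha> p = 0" if "p \<notin> cdom B \<alpha>" for \<alpha> p using that by (simp add: \<gamma>_def)
  qed (use trans in blast)
  have "fwedge en \<beta> \<in> Omega B 2 1" "fwedge e \<gamma> \<in> Omega B 2 1"
    using Omega_fwedge[OF B en' \<beta>] Omega_fwedge[OF B e \<gamma>] by (simp_all add: numeral_2_eq_2)
  then have K: "K \<in> Omega B 2 1" unfolding K_def by (intro Omega_diff[OF B] A)
  have "W e (CARD('m) - 2) K \<alpha> p = 0" for \<alpha> p
  proof (cases "p \<in> cdom B \<alpha>")
    case False
    then show ?thesis
      using OmegaD(1)[OF K False] funpow_wedge_linear(4) unfolding W_apply[OF e K] by simp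
  qed (simp only: W_apply[OF e K] K_prim(2))
  then have "K \<in> kerW B e (CARD('m) - 2) 2 1" using K by (auto simp: kerW_def fun_eq_iff)
  then show ?thesis using \<gamma> \<beta> by (rule that) (simp add: K_def)
qed

section \<open>The bracket with the coframe\<close>

text \<open>Separating the term \<open>k = 0\<close> gives the recursion of
  \<open>wedge_gen_Cons\<close>: in all later terms the head is kept, at the cost of one
  sign.\<close>

lemma dx_wedge_eq_wedge:
  fixes F :: "'m::finite \<Rightarrow> ('m, 'n) ext"
  assumes "\<And>\<mu>. alternating (F \<mu>)"
  shows "dx_wedge F = (\<Sum>\<mu>\<in>UNIV. wedge (gen (Inl \<mu>)) (F \<mu>))"
proof
  fix xs
  show "dx_wedge F xs = (\<Sum>\<mu>\<in>UNIV. wedge (gen (Inl \<mu>)) (F \<mu>)) xs"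
    using assms
  proof (induction xs arbitrary: F)
    case Nil
    then show ?case by (simp add: dx_wedge_def sum_fun_apply gen_def)
  next
    case (Cons x xs)
    have "dx_wedge F (x # xs) = (case x of Inl \<mu> \<Rightarrow> F \<mu> xs | Inr a \<Rightarrow> 0)
        + (\<Sum>k<length xs. case xs ! k of
            Inl \<mu> \<Rightarrow> (-1) ^ Suc k * F \<mu> (x # take k xs @ drop (Suc k) xs) | Inr a \<Rightarrow> 0)"
      unfolding dx_wedge_def length_Cons sum.lessThan_Suc_shift
      by (simp cong: sum.cong sum.case_cong)
    also have "(\<Sum>k<length xs. case xs ! k of
            Inl \<mu> \<Rightarrow> (-1) ^ Suc k * F \<mu> (x # take k xs @ drop (Suc k) xs) | Inr a \<Rightarrow> 0)
        = - dx_wedge (\<lambda>\<mu>. slot x (F \<mu>)) xs"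
      unfolding dx_wedge_def sum_negf[symmetric] by (intro sum.cong refl) (simp add: slot_def split: sum.split)
    also have "dx_wedge (\<lambda>\<mu>. slot x (F \<mu>)) xs = (\<Sum>\<mu>\<in>UNIV. wedge (gen (Inl \<mu>)) (slot x (F \<mu>)) xs)"
      using Cons.IH[of "\<lambda>\<mu>. slot x (F \<mu>)"] Cons.prems by (simp add: alternating_slot sum_fun_apply)
    also have "(case x of Inl \<mu> \<Rightarrow> F \<mu> xs | Inr a \<Rightarrow> 0) = (\<Sum>\<mu>\<in>UNIV. if x = Inl \<mu> then F \<mu> xs else 0)"
      by (cases x) simp_all
    finally show ?case
      by (simp add: sum_fun_apply wedge_gen_Cons Cons.prems sum_subtractf)
  qed
qed

lemma alternating_append_single:
  assumes "alternating A"
  shows "A (ys @ [z]) = (-1) ^ length ys * A (z # ys)"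
proof -
  have "permute_list (cyc (length ys)) (z # ys) = ys @ [z]"
    by (simp add: permute_list_cyc)
  then show ?thesis
    using alternatingD[OF assms cyc_permutes, of "length ys" "z # ys"] by (simp add: sign_cyc)
qed

text \<open>The minus sign in \<open>rho\<close> cancels the one in \<open>slot_Inr_11\<close>.
  Moving the contracted index from the last to the first place costs no sign, because the
  contraction of \<open>A\<close> has even total degree two.\<close>

lemma rho_eq_bracket:
  assumes e: "bidegree 1 1 (e \<alpha> p)" and A: "bidegree 1 2 (A \<alpha> p)"
  shows "rho B e A \<alpha> p = bracket (\<lambda>a b. eta B $ a $ b) (e \<alpha> p) (A \<alpha> p)"
proof -
  let ?e = "e \<alpha> p" and ?A = "A \<alpha> p"
  let ?t = "\<lambda>a b \<nu>. scl (eta B $ a $ b) (wedge (scl (?e [Inl \<nu>, Inr b]) (gen (Inl \<nu>))) (slot (Inr a) ?A))"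
  let ?F = "\<lambda>\<nu>. \<Sum>a\<in>UNIV. \<Sum>b\<in>UNIV. scl (eta B $ a $ b * ?e [Inl \<nu>, Inr b]) (slot (Inr a) ?A)"
  have al: "alternating ?A" using A by (rule bidegree_alternating)
  have "(\<lambda>ys. ?A (ys @ [Inr a])) = slot (Inr a) ?A" for a
  proof -
    have "bidegree 1 1 (slot (Inr a) ?A)" using bidegree_slot_Inr[of 1 1 ?A a] A by (simp add: numeral_2_eq_2)
    from bidegree_invol[OF this] have "invol (slot (Inr a) ?A) = slot (Inr a) ?A" by simp
    then show ?thesis
      by (simp add: alternating_append_single[OF al] fun_eq_iff invol_def slot_def)
  qed
  then have s: "?A (ys @ [Inr a]) = slot (Inr a) ?A ys" for ys a by metis
  have "(\<lambda>\<nu> ys. \<Sum>a\<in>UNIV. \<Sum>b\<in>UNIV. ?A (ys @ [Inr a]) * eta B $ a $ b * ?e [Inl \<nu>, Inr b]) = ?F"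
    by (intro ext) (simp add: s sum_fun_apply scl_def mult_ac)
  then have "rho B e A \<alpha> p = - (\<Sum>\<nu>\<in>UNIV. wedge (gen (Inl \<nu>)) (?F \<nu>))"
    unfolding rho_def by (simp add: dx_wedge_eq_wedge alternating_intros al)
  also have "(\<Sum>\<nu>\<in>UNIV. wedge (gen (Inl \<nu>)) (?F \<nu>))
     = (\<Sum>\<nu>\<in>UNIV. \<Sum>a\<in>UNIV. \<Sum>b\<in>UNIV. ?t a b \<nu>)"
    by (simp add: wedge_sum_right wedge_scl_right wedge_scl_left)
  also have "\<dots> = (\<Sum>a\<in>UNIV. \<Sum>\<nu>\<in>UNIV. \<Sum>b\<in>UNIV. ?t a b \<nu>)"
    by (rule sum.swap)
  also have "\<dots> = (\<Sum>a\<in>UNIV. \<Sum>b\<in>UNIV. \<Sum>\<nu>\<in>UNIV. ?t a b \<nu>)"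
    by (intro sum.cong refl sum.swap)
  also have "\<dots> = (\<Sum>a\<in>UNIV. \<Sum>b\<in>UNIV. scl (eta B $ a $ b) (wedge (- slot (Inr b) ?e) (slot (Inr a) ?A)))"
    unfolding slot_Inr_11[OF e] by (simp add: scl_sum wedge_sum_left)
  also have "\<dots> = - bracket (\<lambda>a b. eta B $ a $ b) ?e ?A"
    unfolding bracket_def wedge_minus_left scl_minus sum_negf ..
  finally show ?thesis by simp
qed

lemma bracket_linear: "bracket g e (A + C) = bracket g e A + bracket g e C"
  "bracket g e (A - C) = bracket g e A - bracket g e C" "bracket g e 0 = 0"
  unfolding bracket_def slot_linear wedge_add_right wedge_diff_right wedge_0_right
  by (simp_all add: scl_add sum.distrib)
     (simp add: sum_subtractf[symmetric] scl_add(1)[of _ _ "- X" for X, unfolded scl_minus add_uminus_conv_diff])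

lemma eta_sym: "eta B $ a $ b = eta B $ b $ a"
  by (simp add: eta_def)

text \<open>The two fibre matrices produced by the contractions meet \<open>eta\<close>, and
  pseudo-orthogonality of \<open>gtrans\<close> turns the result back into
  \<open>eta\<close>.\<close>

lemma bracket_transform:
  fixes B :: "('p::topological_space, 'c, 'm::finite, 'n::finite) lbundle"
  assumes al: "alternating e" "alternating A"
    and g: "transpose (gtrans B \<alpha> \<beta> p) ** eta B ** gtrans B \<alpha> \<beta> p = eta B"
  shows "bracket (\<lambda>a b. eta B $ a $ b) (transform (index_change B \<alpha> \<beta> p) e) (transform (index_change B \<alpha> \<beta> p) A)
       = transform (index_change B \<alpha> \<beta> p) (bracket (\<lambda>a b. eta B $ a $ b) e A)"
proof -
  let ?T = "transform (index_change B \<alpha> \<beta> p)" and ?g = "\<lambda>a b. gtrans B \<alpha> \<beta> p $ a $ b"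
  let ?w = "\<lambda>d c. wedge (slot (Inr d) e) (slot (Inr c) A)"
  let ?t = "\<lambda>a b c d. scl (eta B $ a $ b * ?g a c * ?g b d) (?T (?w d c))"
  have sl: "slot (Inr a) (?T X) = (\<Sum>c\<in>UNIV. scl (?g a c) (?T (slot (Inr c) X)))" for a X
    by (simp add: slot_transform sum_UNIV_Plus index_change_def)
  have w: "wedge (?T (slot (Inr d) e)) (?T (slot (Inr c) A)) = ?T (?w d c)" for c d
    by (rule wedge_transform) (use al in \<open>auto intro: alternating_slot\<close>)
  have gc: "(\<Sum>a\<in>UNIV. \<Sum>b\<in>UNIV. eta B $ a $ b * ?g a c * ?g b d) = eta B $ c $ d" for c d
  proof -
    have "(\<Sum>b\<in>UNIV. (\<Sum>a\<in>UNIV. ?g a c * eta B $ a $ b) * ?g b d) = eta B $ c $ d"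
      using g by (simp add: vec_eq_iff matrix_matrix_mult_def transpose_def)
    moreover have "(\<Sum>b\<in>UNIV. (\<Sum>a\<in>UNIV. ?g a c * eta B $ a $ b) * ?g b d)
        = (\<Sum>a\<in>UNIV. \<Sum>b\<in>UNIV. eta B $ a $ b * ?g a c * ?g b d)"
      unfolding sum_distrib_right by (subst sum.swap) (simp add: mult_ac)
    ultimately show ?thesis by simp
  qed
  have "bracket (\<lambda>a b. eta B $ a $ b) (?T e) (?T A)
     = (\<Sum>a\<in>UNIV. \<Sum>b\<in>UNIV. \<Sum>d\<in>UNIV. \<Sum>c\<in>UNIV. ?t a b c d)"
    unfolding bracket_def sl wedge_sum_left wedge_scl_left
    by (simp add: wedge_sum_right wedge_scl_right w scl_sum mult_ac)
  also have "\<dots> = (\<Sum>a\<in>UNIV. \<Sum>d\<in>UNIV. \<Sum>b\<in>UNIV. \<Sum>c\<in>UNIV. ?t a b c d)"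
    by (intro sum.cong refl sum.swap)
  also have "\<dots> = (\<Sum>a\<in>UNIV. \<Sum>d\<in>UNIV. \<Sum>c\<in>UNIV. \<Sum>b\<in>UNIV. ?t a b c d)"
    by (intro sum.cong refl sum.swap)
  also have "\<dots> = (\<Sum>d\<in>UNIV. \<Sum>a\<in>UNIV. \<Sum>c\<in>UNIV. \<Sum>b\<in>UNIV. ?t a b c d)"
    by (rule sum.swap)
  also have "\<dots> = (\<Sum>d\<in>UNIV. \<Sum>c\<in>UNIV. \<Sum>a\<in>UNIV. \<Sum>b\<in>UNIV. ?t a b c d)"
    by (intro sum.cong refl sum.swap)
  also have "\<dots> = (\<Sum>d\<in>UNIV. \<Sum>c\<in>UNIV. scl (eta B $ c $ d) (?T (?w d c)))"
    by (simp add: scl_sum_left[symmetric] gc)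
  also have "\<dots> = (\<Sum>c\<in>UNIV. \<Sum>d\<in>UNIV. scl (eta B $ c $ d) (?T (?w d c)))"
    by (rule sum.swap)
  also have "\<dots> = ?T (bracket (\<lambda>a b. eta B $ a $ b) e A)"
    unfolding bracket_def by (simp add: transform_sum transform_linear)
  finally show ?thesis .
qed

lemma rho_apply:
  assumes "e \<in> Omega B 1 1" "A \<in> Omega B 1 2"
  shows "rho B e A \<alpha> p = bracket (\<lambda>a b. eta B $ a $ b) (e \<alpha> p) (A \<alpha> p)"
  by (rule rho_eq_bracket[OF Omega_bidegree[OF assms(1)] Omega_bidegree[OF assms(2)]])

lemma rho_Omega:
  assumes B: "lorentz_bundle B" and e: "e \<in> Omega B 1 1" and A: "A \<in> Omega B 1 2"
  shows "rho B e A \<in> Omega B 2 1"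
proof (rule OmegaI)
  let ?t = "\<lambda>\<alpha> a b x. scl (eta B $ a $ b) (wedge (slot (Inr b) (e \<alpha> (coord B \<alpha> x))) (slot (Inr a) (A \<alpha> (coord B \<alpha> x))))"
  show "rho B e A \<alpha> p = 0" if "p \<notin> cdom B \<alpha>" for \<alpha> p
    using OmegaD(1)[OF A that] by (simp add: rho_apply[OF e A] bracket_linear)
  show "bidegree 2 1 (rho B e A \<alpha> p)" for \<alpha> p
    using bidegree_bracket[of 0 0 "e \<alpha> p" 1 1 "A \<alpha> p"] Omega_bidegree[OF e] Omega_bidegree[OF A]
    by (simp add: rho_apply[OF e A] numeral_2_eq_2)
  show "smooth_family (chart B \<alpha> ` cdom B \<alpha>) (\<lambda>x. rho B e A \<alpha> (coord B \<alpha> x))" for \<alpha>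
    unfolding rho_apply[OF e A] bracket_def
    using bundle_chart(1)[OF B] OmegaD(3)[OF e] OmegaD(3)[OF A]
    by (intro smooth_family_sum[where F = "\<lambda>a x. \<Sum>b\<in>UNIV. ?t \<alpha> a b x"]
        smooth_family_sum[where F = "\<lambda>b x. ?t \<alpha> a b x" for a]
        smooth_family_scl smooth_on_const smooth_family_wedge)
       (simp_all add: smooth_family_slot)
  show "rho B e A \<alpha> p = transform (index_change B \<alpha> \<beta> p) (rho B e A \<beta> p)"
    if p: "p \<in> cdom B \<alpha>" "p \<in> cdom B \<beta>" for \<alpha> \<beta> p
  proof -
    have "transpose (gtrans B \<alpha> \<beta> p) ** eta B ** gtrans B \<alpha> \<beta> p = eta B"
      using B p unfolding lorentz_bundle_def by blast
    from bracket_transform[OF Omega_alternating[OF e] Omega_alternating[OF A] this]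
    show ?thesis unfolding rho_apply[OF e A] OmegaD(4)[OF e p] OmegaD(4)[OF A p] .
  qed
qed

lemma rho_diff:
  assumes B: "lorentz_bundle B" and e: "e \<in> Omega B 1 1" and A: "A \<in> Omega B 1 2" "C \<in> Omega B 1 2"
  shows "rho B e (A - C) = rho B e A - rho B e C"
  unfolding fun_eq_iff minus_apply rho_apply[OF e A(1)] rho_apply[OF e A(2)]
    rho_apply[OF e Omega_diff[OF B A]] bracket_linear by simp

lemma rho_kerW:
  assumes B: "lorentz_bundle B" and e: "e \<in> Omega B 1 1" and A: "A \<in> kerW B e k 1 2"
  shows "rho B e A \<in> kerW B e k 2 1"
proof -
  have A': "A \<in> Omega B 1 2" and WA: "W e k A = 0" using A by (auto simp: kerW_def)
  have "W e k (rho B e A) \<alpha> p = bracket (\<lambda>a b. eta B $ a $ b) (e \<alpha> p) (W e k A \<alpha> p)" for \<alpha> p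
    unfolding W_apply[OF e rho_Omega[OF B e A']] W_apply[OF e A'] rho_apply[OF e A']
    by (rule bracket_funpow_wedge[OF Omega_bidegree[OF e] Omega_alternating[OF A'] eta_sym, symmetric])
  then have "W e k (rho B e A) = 0" by (intro ext) (simp add: WA bracket_linear)
  then show ?thesis using rho_Omega[OF B e A'] by (simp add: kerW_def)
qed

section \<open>The covariant derivative\<close>

lemma frechet_derivative_cmult:
  fixes f :: "'a::real_normed_vector \<Rightarrow> real"
  assumes "f differentiable (at x)"
  shows "frechet_derivative (\<lambda>x. c * f x) (at x) v = c * frechet_derivative f (at x) v"
proof -
  have "((\<lambda>x. c * f x) has_derivative (\<lambda>v. c * frechet_derivative f (at x) v)) (at x)"
    using assms by (intro has_derivative_mult_right) (simp add: frechet_derivative_works)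
  from frechet_derivative_at[OF this] show ?thesis by metis
qed

text \<open>Alternation and the vanishing of components are linear relations that hold on an open
  set, so they pass to the derivative.\<close>

lemma bidegree_frechet_derivative:
  assumes S: "open S" "x \<in> S" and F: "smooth_family S F"
    and bid: "\<And>x. x \<in> S \<Longrightarrow> bidegree i j (F x)"
  shows "bidegree i j (\<lambda>ys. frechet_derivative (\<lambda>x. F x ys) (at x) v)"
  unfolding bidegree_iff alternating_def
proof (intro conjI allI impI)
  have d: "(\<lambda>x. F x ys) differentiable (at x)" for ys
    using F S by (auto simp: smooth_family_def intro: smooth_on_differentiable)
  show "frechet_derivative (\<lambda>x. F x (permute_list \<sigma> xs)) (at x) v
      = of_int (sign \<sigma>) * frechet_derivative (\<lambda>x. F x xs) (at x) v" if "\<sigma> permutes {..<length xs}" for \<sigma> xs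
  proof -
    have "F y (permute_list \<sigma> xs) = of_int (sign \<sigma>) * F y xs" if "y \<in> S" for y
      using alternatingD[OF bidegree_alternating[OF bid[OF that]] \<open>\<sigma> permutes {..<length xs}\<close>] .
    then have "frechet_derivative (\<lambda>x. F x (permute_list \<sigma> xs)) (at x)
        = frechet_derivative (\<lambda>x. of_int (sign \<sigma>) * F x xs) (at x)"
      by (intro frechet_derivative_transform_within_open[OF d S])
    then show ?thesis using frechet_derivative_cmult[OF d] by metis
  qed
  fix xs assume nz: "frechet_derivative (\<lambda>x. F x xs) (at x) v \<noteq> 0"
  have "\<exists>y\<in>S. F y xs \<noteq> 0"
  proof (rule ccontr)
    assume "\<not> ?thesis"
    then have "F y xs = 0" if "y \<in> S" for y using that by blast
    then have "frechet_derivative (\<lambda>x. F x xs) (at x) = frechet_derivative (\<lambda>x. 0) (at x)"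
      by (intro frechet_derivative_transform_within_open[OF d S])
    then show False using nz by simp
  qed
  then show "length (filter isl xs) = i" "length (filter (\<lambda>x. \<not> isl x) xs) = j"
    using bid by (auto simp: bidegree_iff)
qed

text \<open>The matrix \<open>g\<close> acting on the fibre indices as a derivation, the algebraic
  part of \<open>cov_deriv\<close>.\<close>

definition fibre_action :: "('n \<Rightarrow> 'n \<Rightarrow> real) \<Rightarrow> ('m, 'n::finite) ext \<Rightarrow> ('m, 'n) ext" where
  "fibre_action g A ys = (\<Sum>l<length ys. case ys ! l of
      Inl \<nu> \<Rightarrow> 0 | Inr a \<Rightarrow> (\<Sum>b\<in>UNIV. g a b * A (ys[l := Inr b])))"

lemma permute_list_update:
  assumes \<sigma>: "\<sigma> permutes {..<length ys}" and l: "l < length ys"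
  shows "(permute_list \<sigma> ys)[l := z] = permute_list \<sigma> (ys[\<sigma> l := z])"
proof (rule nth_equalityI)
  fix i assume i: "i < length ((permute_list \<sigma> ys)[l := z])"
  have "\<sigma> i < length ys" "\<sigma> l < length ys"
    using permutes_in_image[OF \<sigma>, of i] permutes_in_image[OF \<sigma>, of l] i l by simp_all
  moreover have "\<sigma> l = \<sigma> i \<longleftrightarrow> l = i" using permutes_inj[OF \<sigma>] by (simp add: inj_eq)
  ultimately show "(permute_list \<sigma> ys)[l := z] ! i = permute_list \<sigma> (ys[\<sigma> l := z]) ! i"
    using \<sigma> l i by (simp add: nth_list_update permute_list_nth)
qed simp

lemma bidegree_fibre_action:
  assumes A: "bidegree i j A"
  shows "bidegree i j (fibre_action g A)"
  unfolding bidegree_iff alternating_def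
proof (intro conjI allI impI)
  fix ys :: "('a + 'b) list" and \<sigma> assume \<sigma>: "\<sigma> permutes {..<length ys}"
  let ?f = "\<lambda>l. case ys ! l of Inl \<nu> \<Rightarrow> 0 | Inr a \<Rightarrow> (\<Sum>b\<in>UNIV. g a b * A (ys[l := Inr b]))"
  have "fibre_action g A (permute_list \<sigma> ys) = (\<Sum>l<length ys. of_int (sign \<sigma>) * ?f (\<sigma> l))"
    unfolding fibre_action_def length_permute_list
  proof (rule sum.cong[OF refl])
    fix l assume "l \<in> {..<length ys}"
    then have l: "l < length ys" by simp
    have "A ((permute_list \<sigma> ys)[l := z]) = of_int (sign \<sigma>) * A (ys[\<sigma> l := z])" for z
      unfolding permute_list_update[OF \<sigma> l]
      by (rule alternatingD[OF bidegree_alternating[OF A]]) (simp add: \<sigma>)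
    then show "(case permute_list \<sigma> ys ! l of Inl \<nu> \<Rightarrow> 0
        | Inr a \<Rightarrow> \<Sum>b\<in>UNIV. g a b * A ((permute_list \<sigma> ys)[l := Inr b])) = of_int (sign \<sigma>) * ?f (\<sigma> l)"
      by (simp add: permute_list_nth[OF \<sigma> l] sum_distrib_left mult_ac split: sum.split)
  qed
  also have "\<dots> = of_int (sign \<sigma>) * (\<Sum>l<length ys. ?f (\<sigma> l))" by (simp add: sum_distrib_left)
  also have "(\<Sum>l<length ys. ?f (\<sigma> l)) = fibre_action g A ys"
    using sum.permute[OF \<sigma>, of ?f] by (simp add: fibre_action_def o_def)
  finally show "fibre_action g A (permute_list \<sigma> ys) = of_int (sign \<sigma>) * fibre_action g A ys" .
next
  fix ys assume "fibre_action g A ys \<noteq> 0"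
  then obtain l where l: "l < length ys" and
    nz: "(case ys ! l of Inl \<nu> \<Rightarrow> 0 | Inr a \<Rightarrow> (\<Sum>b\<in>UNIV. g a b * A (ys[l := Inr b]))) \<noteq> 0"
    unfolding fibre_action_def by (metis (no_types, lifting) lessThan_iff sum.neutral)
  from nz obtain a where a: "ys ! l = Inr a" and nz': "(\<Sum>b\<in>UNIV. g a b * A (ys[l := Inr b])) \<noteq> 0"
    by (cases "ys ! l") auto
  from nz' obtain b where "g a b * A (ys[l := Inr b]) \<noteq> 0" by (metis (no_types, lifting) sum.neutral)
  then have "A (ys[l := Inr b]) \<noteq> 0" by simp
  then have "length (filter isl (ys[l := Inr b])) = i" "length (filter (\<lambda>x. \<not> isl x) (ys[l := Inr b])) = j"
    using A by (simp_all add: bidegree_iff)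
  moreover have "map isl (ys[l := Inr b]) = map isl ys"
    using l a by (simp add: map_update list_update_same_conv)
  moreover have "length (filter (\<lambda>x. P (isl x)) zs) = length (filter P (map isl zs))" for P and zs :: "('a + 'b) list"
    by (simp add: filter_map o_def)
  from this[of "\<lambda>x. x"] this[of Not] have "length (filter isl zs) = length (filter (\<lambda>x. x) (map isl zs))"
    "length (filter (\<lambda>x. \<not> isl x) zs) = length (filter Not (map isl zs))" for zs :: "('a + 'b) list" .
  ultimately show "length (filter isl ys) = i" "length (filter (\<lambda>x. \<not> isl x) ys) = j" by metis+
qed

lemma cov_deriv_apply:
  assumes "p \<in> cdom B \<alpha>"
  shows "cov_deriv B G A \<alpha> p = dx_wedge (\<lambda>\<mu>.
      (\<lambda>ys. frechet_derivative (\<lambda>x. A \<alpha> (coord B \<alpha> x) ys) (at (chart B \<alpha> p)) (axis \<mu> 1))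
      + fibre_action (\<lambda>a b. G \<alpha> p \<mu> $ a $ b) (A \<alpha> p))"
  using assms by (simp add: cov_deriv_def plus_fun_def fibre_action_def)

lemma bidegree_dx_wedge:
  fixes F :: "'m::finite \<Rightarrow> ('m, 'n) ext"
  assumes "\<And>\<mu>. bidegree i j (F \<mu>)"
  shows "bidegree (Suc i) j (dx_wedge F)"
proof -
  have g: "bidegree 1 0 (gen (Inl \<mu>))" for \<mu> :: 'm
    using alternating_homog_1[OF homog_gen] by (auto simp: bidegree_iff gen_def split: if_splits)
  have "bidegree (Suc i) j (wedge (gen (Inl \<mu>)) (F \<mu>))" for \<mu>
    using bidegree_wedge[OF g assms] by simp
  then show ?thesis
    using dx_wedge_eq_wedge[of F, OF bidegree_alternating[OF assms]] by (simp add: bidegree_sum)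
qed

lemma bidegree_cov_deriv:
  assumes B: "lorentz_bundle B" and A: "A \<in> Omega B i j"
  shows "bidegree (Suc i) j (cov_deriv B G A \<alpha> p)"
proof (cases "p \<in> cdom B \<alpha>")
  case True
  have "bidegree i j ((\<lambda>ys. frechet_derivative (\<lambda>x. A \<alpha> (coord B \<alpha> x) ys) (at (chart B \<alpha> p)) v)
      + fibre_action g (A \<alpha> p))" for v g
    by (intro bidegree_linear bidegree_fibre_action Omega_bidegree[OF A]
        bidegree_frechet_derivative[OF bundle_chart(1)[OF B] _ OmegaD(3)[OF A]])
       (use True in simp)
  then show ?thesis unfolding cov_deriv_apply[OF True] by (rule bidegree_dx_wedge)
next
  case False
  then show ?thesis by (simp add: cov_deriv_def bidegree_linear)
qed

lemma smooth_family_cov_deriv: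
  assumes B: "lorentz_bundle B" and A: "A \<in> Omega B i j"
    and G: "\<And>\<mu>. smooth_on (chart B \<alpha> ` cdom B \<alpha>) (\<lambda>x. G \<alpha> (coord B \<alpha> x) \<mu>)"
  shows "smooth_family (chart B \<alpha> ` cdom B \<alpha>) (\<lambda>x. cov_deriv B G A \<alpha> (coord B \<alpha> x))"
proof -
  let ?S = "chart B \<alpha> ` cdom B \<alpha>" and ?c = "coord B \<alpha>"
  note S = bundle_chart(1)[OF B, of \<alpha>]
  have sA: "smooth_on ?S (\<lambda>x. A \<alpha> (?c x) ys)" for ys
    using OmegaD(3)[OF A] by (simp add: smooth_family_def)
  let ?F = "\<lambda>\<mu> x ys. frechet_derivative (\<lambda>x. A \<alpha> (?c x) ys) (at x) (axis \<mu> 1)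
      + fibre_action (\<lambda>a b. G \<alpha> (?c x) \<mu> $ a $ b) (A \<alpha> (?c x)) ys"
  have f: "smooth_on ?S (\<lambda>x. ?F \<mu> x ys)" for \<mu> ys
  proof (intro smooth_on_add[OF S] smooth_on_frechet_derivative sA)
    have "smooth_on ?S (\<lambda>x. case z of Inl \<nu> \<Rightarrow> 0
        | Inr a \<Rightarrow> (\<Sum>b\<in>UNIV. G \<alpha> (?c x) \<mu> $ a $ b * A \<alpha> (?c x) (ys[l := Inr b])))" for z l
      by (cases z) (auto intro!: smooth_on_const smooth_on_sum[OF S] smooth_on_mult[OF S] smooth_on_vec_nth[OF S] G sA)
    then show "smooth_on ?S (\<lambda>x. fibre_action (\<lambda>a b. G \<alpha> (?c x) \<mu> $ a $ b) (A \<alpha> (?c x)) ys)"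
      unfolding fibre_action_def by (intro smooth_on_sum[OF S])
  qed
  have "smooth_family ?S (\<lambda>x. dx_wedge (\<lambda>\<mu>. ?F \<mu> x))"
    unfolding smooth_family_def
  proof
    fix xs
    have "smooth_on ?S (\<lambda>x. case z of Inl \<mu> \<Rightarrow> (-1) ^ k * ?F \<mu> x ys | Inr a \<Rightarrow> 0)" for z k ys
    proof (cases z)
      case (Inl \<mu>)
      then show ?thesis using smooth_on_mult[OF S smooth_on_const f[where \<mu> = \<mu> and ys = ys], of "(-1) ^ k"] by simp
    qed (simp add: smooth_on_const)
    then show "smooth_on ?S (\<lambda>x. dx_wedge (\<lambda>\<mu>. ?F \<mu> x) xs)"
      unfolding dx_wedge_def by (intro smooth_on_sum[OF S])
  qed
  then show ?thesis
  proof (rule smooth_family_cong[OF S, rotated])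
    show "dx_wedge (\<lambda>\<mu>. ?F \<mu> x) = cov_deriv B G A \<alpha> (?c x)" if "x \<in> ?S" for x
      using that bundle_chart(2,3)[OF B that] by (simp add: cov_deriv_apply plus_fun_def)
  qed
qed

lemma cov_deriv_coframe_component:
  assumes "p \<in> cdom B \<alpha>"
  shows "cov_deriv B G e \<alpha> p [Inl \<mu>, Inl \<nu>, Inr a] =
      frechet_derivative (\<lambda>x. e \<alpha> (coord B \<alpha> x) [Inl \<nu>, Inr a]) (at (chart B \<alpha> p)) (axis \<mu> 1)
    - frechet_derivative (\<lambda>x. e \<alpha> (coord B \<alpha> x) [Inl \<mu>, Inr a]) (at (chart B \<alpha> p)) (axis \<nu> 1)
    + (\<Sum>b\<in>UNIV. G \<alpha> p \<mu> $ a $ b * e \<alpha> p [Inl \<nu>, Inr b])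
    - (\<Sum>b\<in>UNIV. G \<alpha> p \<nu> $ a $ b * e \<alpha> p [Inl \<mu>, Inr b])"
  using assms by (simp add: cov_deriv_def dx_wedge_def numeral_eq_Suc lessThan_Suc)

section \<open>The torsion under a change of chart\<close>

lemma transform_11:
  fixes B :: "('p::topological_space, 'c, 'm::finite, 'n::finite) lbundle"
  shows "transform (index_change B \<alpha> \<beta> p) A [Inl \<nu>, Inr a]
    = (\<Sum>\<rho>\<in>UNIV. \<Sum>b\<in>UNIV. jac B \<alpha> \<beta> p $ \<rho> $ \<nu> * gtrans B \<alpha> \<beta> p $ a $ b * A [Inl \<rho>, Inr b])"
  by (simp add: transform_Cons sum_UNIV_Plus index_change_def sum_distrib_left mult.assoc)
     (simp add: slot_def)

lemma transform_21:
  fixes B :: "('p::topological_space, 'c, 'm::finite, 'n::finite) lbundle"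
  shows "transform (index_change B \<alpha> \<beta> p) A [Inl \<mu>, Inl \<nu>, Inr a]
    = (\<Sum>\<sigma>\<in>UNIV. \<Sum>\<rho>\<in>UNIV. \<Sum>b\<in>UNIV. jac B \<alpha> \<beta> p $ \<sigma> $ \<mu> * jac B \<alpha> \<beta> p $ \<rho> $ \<nu>
        * gtrans B \<alpha> \<beta> p $ a $ b * A [Inl \<sigma>, Inl \<rho>, Inr b])"
  by (simp add: transform_Cons sum_UNIV_Plus index_change_def sum_distrib_left mult.assoc)
     (simp add: slot_def)

text \<open>The derivative along \<open>\<mu>\<close> of the transformation law of a coframe, combined with the gauge
  transformation law. The first sum, which contains the second derivatives of the transition map,
  is symmetric in \<open>\<mu>\<close> and \<open>\<nu>\<close>.\<close>

lemma gauge_covariance: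
  fixes J :: "'m::finite \<Rightarrow> 'm \<Rightarrow> real" and g :: "'n::finite \<Rightarrow> 'n \<Rightarrow> real" and Ga :: "'n \<Rightarrow> 'n \<Rightarrow> real"
  assumes gauge: "\<And>a b. (\<Sum>c\<in>UNIV. Ga a c * g c b) + dg a b = (\<Sum>\<sigma>\<in>UNIV. J \<sigma> \<mu> * (\<Sum>c\<in>UNIV. g a c * Gb \<sigma> c b))"
  shows "(\<Sum>\<rho>\<in>UNIV. \<Sum>b\<in>UNIV. dJ \<rho> * g a b * E \<rho> b + J \<rho> \<nu> * dg a b * E \<rho> b
        + J \<rho> \<nu> * g a b * (\<Sum>\<sigma>\<in>UNIV. J \<sigma> \<mu> * dE \<sigma> \<rho> b))
      + (\<Sum>c\<in>UNIV. Ga a c * (\<Sum>\<rho>\<in>UNIV. \<Sum>b\<in>UNIV. J \<rho> \<nu> * g c b * E \<rho> b))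
    = (\<Sum>\<rho>\<in>UNIV. \<Sum>b\<in>UNIV. dJ \<rho> * g a b * E \<rho> b)
      + (\<Sum>\<sigma>\<in>UNIV. \<Sum>\<rho>\<in>UNIV. \<Sum>b\<in>UNIV. J \<sigma> \<mu> * J \<rho> \<nu> * g a b * (dE \<sigma> \<rho> b + (\<Sum>c\<in>UNIV. Gb \<sigma> b c * E \<rho> c)))"
proof -
  let ?s = "\<lambda>\<sigma> \<rho> b c. J \<sigma> \<mu> * J \<rho> \<nu> * g a c * (Gb \<sigma> c b * E \<rho> b)"
  let ?r = "\<lambda>\<rho> b c. J \<rho> \<nu> * (Ga a c * g c b) * E \<rho> b"
  let ?q = "\<lambda>\<sigma> \<rho> b. J \<sigma> \<mu> * J \<rho> \<nu> * g a b * dE \<sigma> \<rho> b"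
  have 1: "(\<Sum>c\<in>UNIV. Ga a c * (\<Sum>\<rho>\<in>UNIV. \<Sum>b\<in>UNIV. J \<rho> \<nu> * g c b * E \<rho> b))
      = (\<Sum>\<rho>\<in>UNIV. \<Sum>b\<in>UNIV. J \<rho> \<nu> * (\<Sum>c\<in>UNIV. Ga a c * g c b) * E \<rho> b)"
  proof -
    have "(\<Sum>c\<in>UNIV. Ga a c * (\<Sum>\<rho>\<in>UNIV. \<Sum>b\<in>UNIV. J \<rho> \<nu> * g c b * E \<rho> b))
      = (\<Sum>c\<in>UNIV. \<Sum>\<rho>\<in>UNIV. \<Sum>b\<in>UNIV. ?r \<rho> b c)"
      by (simp add: sum_distrib_left mult_ac)
    also have "\<dots> = (\<Sum>\<rho>\<in>UNIV. \<Sum>c\<in>UNIV. \<Sum>b\<in>UNIV. ?r \<rho> b c)"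
      by (rule sum.swap)
    also have "\<dots> = (\<Sum>\<rho>\<in>UNIV. \<Sum>b\<in>UNIV. \<Sum>c\<in>UNIV. ?r \<rho> b c)"
      by (intro sum.cong refl sum.swap)
    finally show ?thesis by (simp add: sum_distrib_left sum_distrib_right mult_ac)
  qed
  have 2: "(\<Sum>\<rho>\<in>UNIV. \<Sum>b\<in>UNIV. J \<rho> \<nu> * dg a b * E \<rho> b) + (\<Sum>\<rho>\<in>UNIV. \<Sum>b\<in>UNIV. J \<rho> \<nu> * (\<Sum>c\<in>UNIV. Ga a c * g c b) * E \<rho> b)
      = (\<Sum>\<sigma>\<in>UNIV. \<Sum>\<rho>\<in>UNIV. \<Sum>b\<in>UNIV. J \<sigma> \<mu> * J \<rho> \<nu> * g a b * (\<Sum>c\<in>UNIV. Gb \<sigma> b c * E \<rho> c))"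
  proof -
    have "(\<Sum>\<rho>\<in>UNIV. \<Sum>b\<in>UNIV. J \<rho> \<nu> * dg a b * E \<rho> b) + (\<Sum>\<rho>\<in>UNIV. \<Sum>b\<in>UNIV. J \<rho> \<nu> * (\<Sum>c\<in>UNIV. Ga a c * g c b) * E \<rho> b)
      = (\<Sum>\<rho>\<in>UNIV. \<Sum>b\<in>UNIV. J \<rho> \<nu> * ((\<Sum>c\<in>UNIV. Ga a c * g c b) + dg a b) * E \<rho> b)"
      by (simp add: sum.distrib algebra_simps)
    also have "\<dots> = (\<Sum>\<rho>\<in>UNIV. \<Sum>b\<in>UNIV. \<Sum>\<sigma>\<in>UNIV. \<Sum>c\<in>UNIV. ?s \<sigma> \<rho> b c)"
      unfolding gauge by (simp add: sum_distrib_left sum_distrib_right mult_ac)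
    also have "\<dots> = (\<Sum>\<rho>\<in>UNIV. \<Sum>\<sigma>\<in>UNIV. \<Sum>b\<in>UNIV. \<Sum>c\<in>UNIV. ?s \<sigma> \<rho> b c)"
      by (intro sum.cong refl sum.swap)
    also have "\<dots> = (\<Sum>\<sigma>\<in>UNIV. \<Sum>\<rho>\<in>UNIV. \<Sum>b\<in>UNIV. \<Sum>c\<in>UNIV. ?s \<sigma> \<rho> b c)"
      by (rule sum.swap)
    also have "\<dots> = (\<Sum>\<sigma>\<in>UNIV. \<Sum>\<rho>\<in>UNIV. \<Sum>c\<in>UNIV. \<Sum>b\<in>UNIV. ?s \<sigma> \<rho> b c)"
      by (intro sum.cong refl sum.swap)
    finally show ?thesis by (simp add: sum_distrib_left)
  qed
  have 3: "(\<Sum>\<rho>\<in>UNIV. \<Sum>b\<in>UNIV. J \<rho> \<nu> * g a b * (\<Sum>\<sigma>\<in>UNIV. J \<sigma> \<mu> * dE \<sigma> \<rho> b))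
      = (\<Sum>\<sigma>\<in>UNIV. \<Sum>\<rho>\<in>UNIV. \<Sum>b\<in>UNIV. ?q \<sigma> \<rho> b)"
  proof -
    have "(\<Sum>\<rho>\<in>UNIV. \<Sum>b\<in>UNIV. J \<rho> \<nu> * g a b * (\<Sum>\<sigma>\<in>UNIV. J \<sigma> \<mu> * dE \<sigma> \<rho> b))
      = (\<Sum>\<rho>\<in>UNIV. \<Sum>b\<in>UNIV. \<Sum>\<sigma>\<in>UNIV. ?q \<sigma> \<rho> b)"
      by (simp add: sum_distrib_left mult_ac)
    also have "\<dots> = (\<Sum>\<rho>\<in>UNIV. \<Sum>\<sigma>\<in>UNIV. \<Sum>b\<in>UNIV. ?q \<sigma> \<rho> b)"
      by (intro sum.cong refl sum.swap)
    also have "\<dots> = (\<Sum>\<sigma>\<in>UNIV. \<Sum>\<rho>\<in>UNIV. \<Sum>b\<in>UNIV. ?q \<sigma> \<rho> b)"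
      by (rule sum.swap)
    finally show ?thesis .
  qed
  show ?thesis
    unfolding 1 using 2 3 by (simp only: sum.distrib distrib_left)
qed

lemma has_derivative_sum_triple:
  fixes J :: "'i \<Rightarrow> 'a::real_normed_vector \<Rightarrow> real"
  assumes "\<And>\<rho>. (J \<rho> has_derivative J' \<rho>) (at x)" "\<And>b. (g b has_derivative g' b) (at x)"
    "\<And>\<rho> b. (E \<rho> b has_derivative E' \<rho> b) (at x)"
  shows "((\<lambda>x. \<Sum>\<rho>\<in>I. \<Sum>b\<in>K. J \<rho> x * g b x * E \<rho> b x) has_derivative
    (\<lambda>v. \<Sum>\<rho>\<in>I. \<Sum>b\<in>K. J' \<rho> v * g b x * E \<rho> b x + J \<rho> x * g' b v * E \<rho> b x + J \<rho> x * g b x * E' \<rho> b v)) (at x)"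
proof (intro has_derivative_sum)
  fix \<rho> b
  have "((\<lambda>x. J \<rho> x * g b x * E \<rho> b x) has_derivative
    (\<lambda>v. J \<rho> x * g b x * E' \<rho> b v + (J \<rho> x * g' b v + J' \<rho> v * g b x) * E \<rho> b x)) (at x)"
    by (intro has_derivative_mult assms)
  then show "((\<lambda>x. J \<rho> x * g b x * E \<rho> b x) has_derivative
    (\<lambda>v. J' \<rho> v * g b x * E \<rho> b x + J \<rho> x * g' b v * E \<rho> b x + J \<rho> x * g b x * E' \<rho> b v)) (at x)"
    by (simp add: algebra_simps)
qed

lemma derivative_axis_expansion:
  fixes f :: "real ^ 'm::finite \<Rightarrow> real"
  assumes "f differentiable (at y)"
  shows "frechet_derivative f (at y) w = (\<Sum>\<sigma>\<in>UNIV. w $ \<sigma> * frechet_derivative f (at y) (axis \<sigma> 1))"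
proof -
  have l: "linear (frechet_derivative f (at y))"
    using assms by (simp add: linear_frechet_derivative)
  have "w = (\<Sum>\<sigma>\<in>UNIV. w $ \<sigma> *\<^sub>R axis \<sigma> 1)"
    by (simp add: vec_eq_iff axis_def if_distrib cong: if_cong)
  then have "frechet_derivative f (at y) w = frechet_derivative f (at y) (\<Sum>\<sigma>\<in>UNIV. w $ \<sigma> *\<^sub>R axis \<sigma> 1)" by metis
  then show ?thesis by (simp add: linear_sum[OF l] linear_scale[OF l])
qed

text \<open>Differentiating the transition law of \<open>e\<close> produces derivatives of
  \<open>gtrans\<close>, which the gauge law absorbs, and second derivatives of the transition map,
  which disappear on antisymmetrisation.\<close>

lemma cov_deriv_coframe_transform:
  fixes B :: "('p::{t2_space, second_countable_topology}, 'c, 'm::finite, 'n::finite) lbundle"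
  assumes B: "lorentz_bundle B" and G: "orth_connection B G" and e: "e \<in> Omega B 1 1"
    and p: "p \<in> cdom B \<alpha>" "p \<in> cdom B \<beta>"
  shows "cov_deriv B G e \<alpha> p [Inl \<mu>, Inl \<nu>, Inr a]
    = transform (index_change B \<alpha> \<beta> p) (cov_deriv B G e \<beta> p) [Inl \<mu>, Inl \<nu>, Inr a]"
proof -
  define U where "U = chart B \<alpha> ` (cdom B \<alpha> \<inter> cdom B \<beta>)"
  define \<phi> where "\<phi> x = chart B \<beta> (coord B \<alpha> x)" for x
  define x0 where "x0 = chart B \<alpha> p"
  define y0 where "y0 = chart B \<beta> p"
  define J where "J \<rho> \<nu> x = frechet_derivative \<phi> (at x) (axis \<nu> 1) $ \<rho>" for \<rho> \<nu> x
  define g where "g a b x = gtrans B \<alpha> \<beta> (coord B \<alpha> x) $ a $ b" for a b x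
  define E where "E \<rho> b y = e \<beta> (coord B \<beta> y) [Inl \<rho>, Inr b]" for \<rho> b y
  have U: "open U" unfolding U_def by (rule bundle_chart(5)[OF B])
  have x0: "x0 \<in> U" using p by (auto simp: U_def x0_def)
  have cx0: "coord B \<alpha> x0 = p" unfolding x0_def by (rule bundle_chart(4)[OF B p(1)])
  have cy0: "coord B \<beta> y0 = p" unfolding y0_def by (rule bundle_chart(4)[OF B p(2)])
  have \<phi>0: "\<phi> x0 = y0" by (simp add: \<phi>_def cx0 y0_def)
  have Ux: "coord B \<alpha> x \<in> cdom B \<alpha>" "coord B \<alpha> x \<in> cdom B \<beta>" "chart B \<alpha> (coord B \<alpha> x) = x"
    "coord B \<beta> (\<phi> x) = coord B \<alpha> x" if "x \<in> U" for x
    using that bundle_chart(4)[OF B] by (auto simp: U_def \<phi>_def)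
  have s\<phi>: "smooth_on U \<phi>"
    using B unfolding lorentz_bundle_def U_def \<phi>_def[abs_def] by blast
  have sg: "smooth_on U (\<lambda>x. gtrans B \<alpha> \<beta> (coord B \<alpha> x))"
    using B unfolding lorentz_bundle_def U_def by blast
  have Jjac: "jac B \<alpha> \<beta> (coord B \<alpha> x) $ \<rho> $ \<nu> = J \<rho> \<nu> x" if "x \<in> U" for x \<rho> \<nu>
    using Ux(3)[OF that] by (simp add: jac_def matrix_def J_def \<phi>_def[abs_def])
  have eU: "e \<alpha> (coord B \<alpha> x) [Inl \<nu>, Inr a] = (\<Sum>\<rho>\<in>UNIV. \<Sum>b\<in>UNIV. J \<rho> \<nu> x * g a b x * E \<rho> b (\<phi> x))"
    if "x \<in> U" for x \<nu> a
    unfolding OmegaD(4)[OF e Ux(1,2)[OF that]] transform_11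
    by (simp add: Jjac[OF that] g_def E_def Ux(4)[OF that])
  define \<phi>' where "\<phi>' = frechet_derivative \<phi> (at x0)"
  define J' where "J' \<rho> \<nu> = frechet_derivative (J \<rho> \<nu>) (at x0)" for \<rho> \<nu>
  define E' where "E' \<sigma> \<rho> b = frechet_derivative (E \<rho> b) (at y0) (axis \<sigma> 1)" for \<sigma> \<rho> b
  define g' where "g' v a b = frechet_derivative (\<lambda>x. gtrans B \<alpha> \<beta> (coord B \<alpha> x)) (at x0) v $ a $ b" for v a b
  have h\<phi>: "(\<phi> has_derivative \<phi>') (at x0)"
    using smooth_on_differentiable[OF s\<phi> x0] by (simp add: \<phi>'_def frechet_derivative_works)
  have sJ: "smooth_on U (J \<rho> \<nu>)" for \<rho> \<nu>
    unfolding J_def[abs_def] by (intro smooth_on_vec_nth[OF U] smooth_on_frechet_derivative s\<phi>)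
  have hJ: "(J \<rho> \<nu> has_derivative J' \<rho> \<nu>) (at x0)" for \<rho> \<nu>
    using smooth_on_differentiable[OF sJ x0] by (simp add: J'_def frechet_derivative_works)
  have hg: "(g a b has_derivative (\<lambda>v. g' v a b)) (at x0)" for a b
  proof -
    have "((\<lambda>x. gtrans B \<alpha> \<beta> (coord B \<alpha> x)) has_derivative
        frechet_derivative (\<lambda>x. gtrans B \<alpha> \<beta> (coord B \<alpha> x)) (at x0)) (at x0)"
      using smooth_on_differentiable[OF sg x0] by (simp add: frechet_derivative_works)
    then show ?thesis
      unfolding g_def[abs_def] g'_def
      by (intro bounded_linear.has_derivative[OF bounded_linear_vec_nth])
  qed
  have dE: "E \<rho> b differentiable (at y0)" for \<rho> b
  proof (rule smooth_on_differentiable)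
    show "smooth_on (chart B \<beta> ` cdom B \<beta>) (E \<rho> b)"
      using OmegaD(3)[OF e, of \<beta>] by (simp add: smooth_family_def E_def[abs_def])
    show "y0 \<in> chart B \<beta> ` cdom B \<beta>" using p by (simp add: y0_def)
  qed
  have hE: "((\<lambda>x. E \<rho> b (\<phi> x)) has_derivative (\<lambda>v. frechet_derivative (E \<rho> b) (at y0) (\<phi>' v))) (at x0)" for \<rho> b
    by (rule has_derivative_compose[OF h\<phi>]) (use dE in \<open>simp add: \<phi>0 frechet_derivative_works\<close>)
  have E'_axis: "frechet_derivative (E \<rho> b) (at y0) (\<phi>' (axis \<mu> 1)) = (\<Sum>\<sigma>\<in>UNIV. J \<sigma> \<mu> x0 * E' \<sigma> \<rho> b)" for \<rho> b \<mu>
    by (subst derivative_axis_expansion[OF dE]) (simp add: J_def \<phi>'_def E'_def)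
  have de: "frechet_derivative (\<lambda>x. e \<alpha> (coord B \<alpha> x) [Inl \<nu>, Inr a]) (at x0) (axis \<mu> 1)
    = (\<Sum>\<rho>\<in>UNIV. \<Sum>b\<in>UNIV. J' \<rho> \<nu> (axis \<mu> 1) * g a b x0 * E \<rho> b y0 + J \<rho> \<nu> x0 * g' (axis \<mu> 1) a b * E \<rho> b y0
        + J \<rho> \<nu> x0 * g a b x0 * (\<Sum>\<sigma>\<in>UNIV. J \<sigma> \<mu> x0 * E' \<sigma> \<rho> b))" for \<mu> \<nu> a
  proof -
    have "((\<lambda>x. \<Sum>\<rho>\<in>UNIV. \<Sum>b\<in>UNIV. J \<rho> \<nu> x * g a b x * E \<rho> b (\<phi> x)) has_derivative
      (\<lambda>v. \<Sum>\<rho>\<in>UNIV. \<Sum>b\<in>UNIV. J' \<rho> \<nu> v * g a b x0 * E \<rho> b (\<phi> x0) + J \<rho> \<nu> x0 * g' v a b * E \<rho> b (\<phi> x0)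
        + J \<rho> \<nu> x0 * g a b x0 * frechet_derivative (E \<rho> b) (at y0) (\<phi>' v))) (at x0)"
      by (rule has_derivative_sum_triple[where g' = "\<lambda>b v. g' v a b", OF hJ hg hE])
    from has_derivative_transform_within_open[OF this U x0, of "\<lambda>x. e \<alpha> (coord B \<alpha> x) [Inl \<nu>, Inr a]"]
    have "((\<lambda>x. e \<alpha> (coord B \<alpha> x) [Inl \<nu>, Inr a]) has_derivative
      (\<lambda>v. \<Sum>\<rho>\<in>UNIV. \<Sum>b\<in>UNIV. J' \<rho> \<nu> v * g a b x0 * E \<rho> b (\<phi> x0) + J \<rho> \<nu> x0 * g' v a b * E \<rho> b (\<phi> x0)
        + J \<rho> \<nu> x0 * g a b x0 * frechet_derivative (E \<rho> b) (at y0) (\<phi>' v))) (at x0)"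
      by (simp add: eU)
    from frechet_derivative_at[OF this, symmetric] show ?thesis
      by (simp add: \<phi>0 E'_axis)
  qed
  \<comment> \<open>\<open>J\<close> is itself a first derivative of the transition map
    \<open>\<phi>\<close>, so this is the symmetry of the Hessian of one component of
    \<open>\<phi>\<close>.\<close>
  have J'_sym: "J' \<rho> \<nu> (axis \<mu> 1) = J' \<rho> \<mu> (axis \<nu> 1)" for \<rho> \<mu> \<nu>
  proof -
    have "(\<lambda>x. \<phi> x $ \<rho>) differentiable (at x)" "frechet_derivative (\<lambda>x. \<phi> x $ \<rho>) (at x) v = frechet_derivative \<phi> (at x) v $ \<rho>"
      if "x \<in> U" for x v
    proof -
      have h: "((\<lambda>x. \<phi> x $ \<rho>) has_derivative (\<lambda>v. frechet_derivative \<phi> (at x) v $ \<rho>)) (at x)"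
        using smooth_on_differentiable[OF s\<phi> that]
        by (intro bounded_linear.has_derivative[OF bounded_linear_vec_nth]) (simp add: frechet_derivative_works)
      then show "(\<lambda>x. \<phi> x $ \<rho>) differentiable (at x)" unfolding differentiable_def by blast
      show "frechet_derivative (\<lambda>x. \<phi> x $ \<rho>) (at x) v = frechet_derivative \<phi> (at x) v $ \<rho>"
        using fun_cong[OF frechet_derivative_at[OF h], of v] by simp
    qed
    then have "J \<rho> \<kappa> x = frechet_derivative (\<lambda>x. \<phi> x $ \<rho>) (at x) (axis \<kappa> 1)" if "x \<in> U" for x \<kappa>
      using that by (simp add: J_def)
    then have "J' \<rho> \<kappa> = frechet_derivative (\<lambda>x. frechet_derivative (\<lambda>x. \<phi> x $ \<rho>) (at x) (axis \<kappa> 1)) (at x0)" for \<kappa>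
      unfolding J'_def
      by (intro frechet_derivative_transform_within_open[OF smooth_on_differentiable[OF sJ x0] U x0])
    then show ?thesis
      using symmetric_second_derivative[OF U x0 smooth_on_vec_nth[OF U s\<phi>]] by simp
  qed
  \<comment> \<open>\<open>Da\<close> and \<open>Db\<close> are the derivatives before
    antisymmetrisation. \<open>Da\<close> is the transform of \<open>Db\<close> up to the Hessian
    term only.\<close>
  define Da where "Da \<mu> \<nu> a = frechet_derivative (\<lambda>x. e \<alpha> (coord B \<alpha> x) [Inl \<nu>, Inr a]) (at x0) (axis \<mu> 1)
      + (\<Sum>c\<in>UNIV. G \<alpha> p \<mu> $ a $ c * e \<alpha> p [Inl \<nu>, Inr c])" for \<mu> \<nu> a
  define Db where "Db \<sigma> \<rho> b = E' \<sigma> \<rho> b + (\<Sum>c\<in>UNIV. G \<beta> p \<sigma> $ b $ c * E \<rho> c y0)" for \<sigma> \<rho> b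
  have Da: "Da \<mu> \<nu> a = (\<Sum>\<rho>\<in>UNIV. \<Sum>b\<in>UNIV. J' \<rho> \<nu> (axis \<mu> 1) * g a b x0 * E \<rho> b y0)
      + (\<Sum>\<sigma>\<in>UNIV. \<Sum>\<rho>\<in>UNIV. \<Sum>b\<in>UNIV. J \<sigma> \<mu> x0 * J \<rho> \<nu> x0 * g a b x0 * Db \<sigma> \<rho> b)" for \<mu> \<nu> a
  proof -
    have law: "G \<alpha> p \<mu> ** gtrans B \<alpha> \<beta> p
          + frechet_derivative (\<lambda>x. gtrans B \<alpha> \<beta> (coord B \<alpha> x)) (at (chart B \<alpha> p)) (axis \<mu> 1)
        = (\<Sum>\<nu>\<in>UNIV. (jac B \<alpha> \<beta> p $ \<nu> $ \<mu>) *\<^sub>R (gtrans B \<alpha> \<beta> p ** G \<beta> p \<nu>))"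
      using G p unfolding orth_connection_def by blast
    have gauge: "(\<Sum>c\<in>UNIV. G \<alpha> p \<mu> $ a $ c * g c b x0) + g' (axis \<mu> 1) a b
        = (\<Sum>\<sigma>\<in>UNIV. J \<sigma> \<mu> x0 * (\<Sum>c\<in>UNIV. g a c x0 * G \<beta> p \<sigma> $ c $ b))" for a b
      using arg_cong[OF law, of "\<lambda>M. M $ a $ b"] Jjac[OF x0]
      by (simp add: matrix_matrix_mult_def g_def g'_def cx0 x0_def[symmetric])
    show ?thesis
      unfolding Da_def de Db_def
      using gauge_covariance[of "\<lambda>a c. G \<alpha> p \<mu> $ a $ c" "\<lambda>a b. g a b x0" "g' (axis \<mu> 1)" "\<lambda>\<rho> \<nu>. J \<rho> \<nu> x0" \<mu>
          "\<lambda>\<sigma> b c. G \<beta> p \<sigma> $ b $ c", OF gauge] eU[OF x0]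
      by (simp add: cx0 \<phi>0)
  qed
  let ?S = "\<lambda>X. \<Sum>\<sigma>\<in>UNIV. \<Sum>\<rho>\<in>UNIV. \<Sum>b\<in>UNIV. J \<sigma> \<mu> x0 * J \<rho> \<nu> x0 * g a b x0 * X \<sigma> \<rho> b"
  have "cov_deriv B G e \<alpha> p [Inl \<mu>, Inl \<nu>, Inr a] = Da \<mu> \<nu> a - Da \<nu> \<mu> a"
    by (simp add: cov_deriv_coframe_component[OF p(1)] Da_def x0_def)
  also have "\<dots> = ?S (\<lambda>\<sigma> \<rho> b. Db \<sigma> \<rho> b)
      - (\<Sum>\<sigma>\<in>UNIV. \<Sum>\<rho>\<in>UNIV. \<Sum>b\<in>UNIV. J \<sigma> \<nu> x0 * J \<rho> \<mu> x0 * g a b x0 * Db \<sigma> \<rho> b)"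
    unfolding Da J'_sym[of _ \<nu> \<mu>] by simp
  \<comment> \<open>Renaming the two summed form indices restores the order of the Jacobian factors
    and moves the exchange into the arguments of \<open>Db\<close>.\<close>
  also have "(\<Sum>\<sigma>\<in>UNIV. \<Sum>\<rho>\<in>UNIV. \<Sum>b\<in>UNIV. J \<sigma> \<nu> x0 * J \<rho> \<mu> x0 * g a b x0 * Db \<sigma> \<rho> b)
      = ?S (\<lambda>\<sigma> \<rho> b. Db \<rho> \<sigma> b)"
    by (subst sum.swap) (simp add: mult_ac)
  also have "?S (\<lambda>\<sigma> \<rho> b. Db \<sigma> \<rho> b) - \<dots>
      = ?S (\<lambda>\<sigma> \<rho> b. Db \<sigma> \<rho> b - Db \<rho> \<sigma> b)"
    by (simp add: sum_subtractf right_diff_distrib)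
  also have "\<dots> = ?S (\<lambda>\<sigma> \<rho> b. cov_deriv B G e \<beta> p [Inl \<sigma>, Inl \<rho>, Inr b])"
  proof -
    have "cov_deriv B G e \<beta> p [Inl \<sigma>, Inl \<rho>, Inr b] = Db \<sigma> \<rho> b - Db \<rho> \<sigma> b" for \<sigma> \<rho> b
      by (simp add: cov_deriv_coframe_component[OF p(2)] Db_def E'_def E_def[abs_def] cy0 y0_def[symmetric])
    then show ?thesis by simp
  qed
  also have "\<dots> = transform (index_change B \<alpha> \<beta> p) (cov_deriv B G e \<beta> p) [Inl \<mu>, Inl \<nu>, Inr a]"
    using Jjac[OF x0] by (simp add: transform_21 g_def cx0)
  finally show ?thesis .
qed

lemma bidegree_21_eqI:
  assumes "bidegree 2 1 A" "bidegree 2 1 C" "\<And>\<mu> \<nu> a. A [Inl \<mu>, Inl \<nu>, Inr a] = C [Inl \<mu>, Inl \<nu>, Inr a]"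
  shows "A = C"
proof (rule bidegree_eqI[OF assms(1,2)])
  fix \<mu>s :: "'a list" and as :: "'b list"
  assume "length \<mu>s = 2" "length as = 1"
  then obtain \<mu> \<nu> a where "\<mu>s = [\<mu>, \<nu>]" "as = [a]"
    by (auto simp: length_Suc_conv numeral_2_eq_2)
  then show "A (map Inl \<mu>s @ map Inr as) = C (map Inl \<mu>s @ map Inr as)" using assms(3) by simp
qed

lemma cov_deriv_coframe_Omega:
  fixes B :: "('p::{t2_space, second_countable_topology}, 'c, 'm::finite, 'n::finite) lbundle"
  assumes B: "lorentz_bundle B" and G: "orth_connection B G" and e: "e \<in> Omega B 1 1"
  shows "cov_deriv B G e \<in> Omega B 2 1"
proof (rule OmegaI)
  have bid: "bidegree 2 1 (cov_deriv B G e \<alpha> p)" for \<alpha> p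
    using bidegree_cov_deriv[OF B e] by (simp add: numeral_2_eq_2)
  show "cov_deriv B G e \<alpha> p = 0" if "p \<notin> cdom B \<alpha>" for \<alpha> p
    using that by (simp add: cov_deriv_def)
  show "bidegree 2 1 (cov_deriv B G e \<alpha> p)" for \<alpha> p by (rule bid)
  show "smooth_family (chart B \<alpha> ` cdom B \<alpha>) (\<lambda>x. cov_deriv B G e \<alpha> (coord B \<alpha> x))" for \<alpha>
    using G by (intro smooth_family_cov_deriv[OF B e]) (simp add: orth_connection_def)
  show "cov_deriv B G e \<alpha> p = transform (index_change B \<alpha> \<beta> p) (cov_deriv B G e \<beta> p)"
    if "p \<in> cdom B \<alpha>" "p \<in> cdom B \<beta>" for \<alpha> \<beta> p
    by (rule bidegree_21_eqI[OF bid bidegree_transform[OF bid isl_index_change]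
          cov_deriv_coframe_transform[OF B G e that]])
qed

text \<open>The coefficients change by the contraction of \<open>w\<close> with \<open>eta\<close>.
  Applied to \<open>e\<close> and antisymmetrised in the form indices, this contraction is the
  component formula of \<open>rho\<close>.\<close>

lemma d_conn_eq_rho:
  fixes B :: "('p::{t2_space, second_countable_topology}, 'c, 'm::finite, 'n::finite) lbundle"
  assumes B: "lorentz_bundle B" and e: "e \<in> Omega B 1 1" and w: "w \<in> Omega B 1 2"
  shows "d_conn B G w e = cov_deriv B G e + rho B e w"
proof (rule ext, rule ext)
  fix \<alpha> p
  show "d_conn B G w e \<alpha> p = (cov_deriv B G e + rho B e w) \<alpha> p"
  proof (cases "p \<in> cdom B \<alpha>")
    case False
    then show ?thesis
      using OmegaD(1)[OF rho_Omega[OF B e w] False] by (simp add: d_conn_def cov_deriv_def)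
  next
    case p: True
    have "d_conn B G w e \<alpha> p = cov_deriv B G e \<alpha> p + rho B e w \<alpha> p"
    proof (rule bidegree_21_eqI)
      have "bidegree 2 1 (cov_deriv B G' e \<alpha> p)" for G'
        using bidegree_cov_deriv[OF B e] by (simp add: numeral_2_eq_2)
      then show "bidegree 2 1 (d_conn B G w e \<alpha> p)" "bidegree 2 1 (cov_deriv B G e \<alpha> p + rho B e w \<alpha> p)"
        using Omega_bidegree[OF rho_Omega[OF B e w]] by (simp_all add: d_conn_def bidegree_linear)
      show "d_conn B G w e \<alpha> p [Inl \<mu>, Inl \<nu>, Inr a] = (cov_deriv B G e \<alpha> p + rho B e w \<alpha> p) [Inl \<mu>, Inl \<nu>, Inr a]" for \<mu> \<nu> a
      proof -
        have "(\<Sum>b\<in>UNIV. connection_of B G w \<alpha> p \<kappa> $ a $ b * X b)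
            = (\<Sum>b\<in>UNIV. G \<alpha> p \<kappa> $ a $ b * X b)
              + (\<Sum>c\<in>UNIV. \<Sum>b\<in>UNIV. w \<alpha> p [Inl \<kappa>, Inr a, Inr c] * eta B $ c $ b * X b)" for \<kappa> X
          by (subst sum.swap) (simp add: connection_of_def distrib_right sum.distrib sum_distrib_right)
        then show ?thesis
          by (simp add: d_conn_coframe_component[OF p] cov_deriv_coframe_component[OF p] rho_component)
      qed
    qed
    then show ?thesis by simp
  qed
qed

section \<open>The decomposition of connections\<close>

lemma transversal_wedge_apply:
  assumes e: "e \<in> Omega B 1 1" and en: "en \<in> Omega B 0 1" and A: "A \<in> Omega B i j"
  shows "fwedge (fwedge en (fpow e k)) A \<alpha> p = (wedge (e \<alpha> p) ^^ k) (wedge (en \<alpha> p) (A \<alpha> p))"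
  unfolding fwedge_def fpow_apply wedge_epow[OF Omega_bidegree[OF e] Omega_alternating[OF en]]
  by (rule wedge_funpow_left[OF Omega_bidegree[OF e] Omega_alternating[OF en] Omega_alternating[OF A]])

lemma W_diff: "W e k (A - C) = W e k A - W e k C"
  by (simp add: fun_eq_iff W_def fwedge_def wedge_diff_left)

lemma kerW_diff:
  assumes B: "lorentz_bundle B" and "A \<in> kerW B e k i j" "C \<in> kerW B e k i j"
  shows "A - C \<in> kerW B e k i j"
  using assms Omega_diff[OF B] by (auto simp: kerW_def W_diff)

lemma projection_onto_diff:
  assumes B: "lorentz_bundle B" and P: "projection_onto (Omega B i j) S P"
    and A: "A \<in> Omega B i j" "C \<in> Omega B i j"
  shows "P (A - C) = P A - P C"
proof -
  have "P ((A - C) + C) = P (A - C) + P C"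
    using P A Omega_diff[OF B A] unfolding projection_onto_def by blast
  then show ?thesis by simp
qed

text \<open>The square of \<open>en\<close> is zero, which removes \<open>\<beta>\<close>. The even
  factor \<open>e\<close> moves past \<open>en\<close> and joins the power, so the preimage is
  \<open>fwedge en \<gamma>\<close>.\<close>

lemma transversal_wedge_mem_imW:
  assumes B: "lorentz_bundle B" and e: "e \<in> Omega B 1 1" and en: "en \<in> Omega B 0 1"
    and \<gamma>: "\<gamma> \<in> Omega B 1 0" and \<beta>: "\<beta> \<in> Omega B 2 0"
  shows "fwedge (fwedge en (fpow e k)) (fwedge e \<gamma> + fwedge en \<beta>) \<in> imW B e (Suc k) 1 1"
proof -
  have en\<gamma>: "fwedge en \<gamma> \<in> Omega B 1 1" using Omega_fwedge[OF B en \<gamma>] by simp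
  have "fwedge e \<gamma> + fwedge en \<beta> \<in> Omega B 2 1"
    using Omega_add[OF B Omega_fwedge[OF B e \<gamma>]] Omega_fwedge[OF B en \<beta>] by (simp add: numeral_2_eq_2)
  note ap = transversal_wedge_apply[OF e en this]
  have "fwedge (fwedge en (fpow e k)) (fwedge e \<gamma> + fwedge en \<beta>) \<alpha> p = W e (Suc k) (fwedge en \<gamma>) \<alpha> p" for \<alpha> p
  proof -
    note al = Omega_alternating[OF en, of \<alpha> p] Omega_alternating[OF \<gamma>, of \<alpha> p] Omega_alternating[OF \<beta>, of \<alpha> p]
    have "homog 1 (en \<alpha> p)" using bidegree_homog[OF Omega_bidegree[OF en]] by simp
    then have "wedge (en \<alpha> p) (wedge (en \<alpha> p) (\<beta> \<alpha> p)) = 0"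
      by (simp add: wedge_assoc[symmetric] al wedge_self_1)
    then have "wedge (en \<alpha> p) ((fwedge e \<gamma> + fwedge en \<beta>) \<alpha> p) = wedge (e \<alpha> p) (wedge (en \<alpha> p) (\<gamma> \<alpha> p))"
      by (simp add: fwedge_def wedge_add_right wedge_even_left_commute[OF Omega_bidegree[OF e] al(1,2)])
    then show ?thesis
      unfolding ap W_apply[OF e en\<gamma>] by (simp add: fwedge_def funpow_swap1)
  qed
  then have "fwedge (fwedge en (fpow e k)) (fwedge e \<gamma> + fwedge en \<beta>) = W e (Suc k) (fwedge en \<gamma>)"
    by (rule ext[OF ext])
  then show ?thesis unfolding imW_def using en\<gamma> by (rule image_eqI)
qed

text \<open>A preimage section gives a preimage at each point, so the claim reduces to
  \<open>transversal_injective\<close>.\<close>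

lemma transversal_wedge_inj:
  fixes B :: "('p::{t2_space, second_countable_topology}, 'c, 'm::finite, 'n::finite) lbundle"
  assumes B: "lorentz_bundle B" and card: "CARD('n) = CARD('m) + 1" and m: "CARD('m) \<ge> 3"
    and e: "e \<in> Omega B 1 1" and en: "completes_frame B e en"
    and A: "A \<in> kerW B e (CARD('m) - 2) 2 1"
    and im: "fwedge (fwedge en (fpow e (CARD('m) - 3))) A \<in> imW B e (CARD('m) - 2) 1 1"
  shows "A = 0"
proof (rule ext, rule ext)
  fix \<alpha> p
  have en': "en \<in> Omega B 0 1" using en by (simp add: completes_frame_def)
  have A': "A \<in> Omega B 2 1" and WA: "W e (CARD('m) - 2) A = 0" using A by (auto simp: kerW_def)
  obtain C where C: "C \<in> Omega B 1 1"
    and eq: "fwedge (fwedge en (fpow e (CARD('m) - 3))) A = W e (CARD('m) - 2) C"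
    using im by (auto simp: imW_def)
  show "A \<alpha> p = 0 \<alpha> p"
  proof (cases "p \<in> cdom B \<alpha>")
    case True
    have "adapted_frame (e \<alpha> p) (en \<alpha> p) (\<lambda>\<mu>. dual_vector (e \<alpha> p) (en \<alpha> p) (Some \<mu>)) (dual_vector (e \<alpha> p) (en \<alpha> p) None)"
      by (rule adapted_frame_dual_vector[OF card Omega_bidegree[OF e] Omega_bidegree[OF en']
          det_frame_matrix_nonzero[OF card en True]])
    from adapted_frame.transversal_injective[OF this Omega_bidegree[OF A'] _ m Omega_bidegree[OF C]]
    show ?thesis
      using fun_cong[OF fun_cong[OF WA, of \<alpha>], of p] fun_cong[OF fun_cong[OF eq, of \<alpha>], of p]
      by (simp add: W_apply[OF e A'] W_apply[OF e C] transversal_wedge_apply[OF e en' A'])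
  next
    case False
    then show ?thesis using OmegaD(1)[OF A'] by simp
  qed
qed

text \<open>The two conditions on \<open>pT\<close> say that it vanishes on Z, and existence hinges
  on this. Let \<kappa> + z be the splitting of the torsion of the given connection. A solution v
  satisfies \<kappa> - \<rho> v = pT (\<kappa> - \<rho> v + z) by transversal injectivity. Hence
  \<kappa> - \<rho> v lies in \<T> and is fixed by \<open>pT\<close>, which forces pT z = 0.\<close>

theorem theorem19:
  fixes B :: "('p::{t2_space, second_countable_topology}, 'c, 'm::finite, 'n::finite) lbundle"
    and G0 :: "'c \<Rightarrow> 'p \<Rightarrow> 'm \<Rightarrow> real ^ 'n ^ 'n"
    and e en wt :: "('p, 'c, 'm, 'n) field"
    and J :: "('p, 'c, 'm, 'n) field set"
    and pT pK :: "('p, 'c, 'm, 'n) field \<Rightarrow> ('p, 'c, 'm, 'n) field"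
    and N :: nat
  assumes N: "N = CARD('n)" "N = CARD('m) + 1" "N \<ge> 4"
    and lbundle: "lorentz_bundle B"
    and reference: "orth_connection B G0"
    and coframe: "boundary_coframe B e"
    and transversal: "completes_frame B e en"
    and degenerate: "degenerate_metric B e"
    and J: "complement_in (Omega B 2 1) (rho B e ` kerW B e (N - 3) 1 2) J"
    and pT: "projection_onto (Omega B 2 1) (T_space B e J) pT"
    and pK: "projection_onto (Omega B 1 2) (K_space B e) pK"
    and pT_trace: "\<forall>\<gamma> \<in> Omega B 1 0. pT (fwedge e \<gamma>) = 0"
    and pT_transversal: "\<forall>\<beta> \<in> Omega B 2 0. pT (fwedge en \<beta>) = 0"
    and wt: "wt \<in> Omega B 1 2"
  shows "\<exists>!wv. case wv of (w, v) \<Rightarrow>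
     w \<in> Omega B 1 2 \<and> v \<in> Omega B 1 2 \<and> wt = w + v \<and>
     W e (N - 3) v = 0 \<and>
     fwedge (fwedge en (fpow e (N - 4))) (d_conn B G0 w e)
       - fwedge (fwedge en (fpow e (N - 4))) (pT (d_conn B G0 w e)) \<in> imW B e (N - 3) 1 1 \<and>
     pK v = 0"
proof (rule ex_ex1I)
  let ?\<Phi> = "\<lambda>X. fwedge (fwedge en (fpow e (N - 4))) X"
  let ?d = "\<lambda>w. d_conn B G0 w e"
  \<comment> \<open>With m = N - 1 the exponents N - 3 and N - 4 are m - 2 and m - 3, the limiting
    exponents of the pointwise lemmas; N \<ge> 4 makes the truncated subtractions exact.\<close>
  have card: "CARD('n) = CARD('m) + 1" and m: "CARD('m) \<ge> 3" and N3: "N - 3 = CARD('m) - 2"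
    and N4: "N - 4 = CARD('m) - 3" and S: "N - 3 = Suc (N - 4)"
    using N by auto
  note B = lbundle
  have e: "e \<in> Omega B 1 1" using coframe by (simp add: boundary_coframe_def)
  have en: "en \<in> Omega B 0 1" using transversal by (simp add: completes_frame_def)
  have d: "?d w = cov_deriv B G0 e + rho B e w" if "w \<in> Omega B 1 2" for w
    by (rule d_conn_eq_rho[OF B e that])
  have d_mem: "?d w \<in> Omega B 2 1" if "w \<in> Omega B 1 2" for w
    unfolding d[OF that]
    by (rule Omega_add[OF B cov_deriv_coframe_Omega[OF B reference e] rho_Omega[OF B e that]])
  have T: "T_space B e J = kerW B e (N - 3) 2 1 \<inter> J"
    and K: "K_space B e = kerW B e (N - 3) 1 2 \<inter> {A \<in> Omega B 1 2. rho B e A = 0}"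
    by (simp_all add: T_space_def K_space_def N(1))
  have pT_mem: "pT X \<in> T_space B e J" if "X \<in> Omega B 2 1" for X
    using pT that by (simp add: projection_onto_def)
  have pK_mem: "pK X \<in> K_space B e" if "X \<in> Omega B 1 2" for X
    using pK that by (simp add: projection_onto_def)
  have \<Phi>_diff: "?\<Phi> (X - Y) = ?\<Phi> X - ?\<Phi> Y" for X Y
    by (simp add: fun_eq_iff fwedge_def wedge_diff_right)
  let ?P = "\<lambda>wv. case wv of (w, v) \<Rightarrow>
     w \<in> Omega B 1 2 \<and> v \<in> Omega B 1 2 \<and> wt = w + v \<and>
     W e (N - 3) v = 0 \<and>
     ?\<Phi> (?d w) - ?\<Phi> (pT (?d w)) \<in> imW B e (N - 3) 1 1 \<and>
     pK v = 0"
  show "\<exists>wv. ?P wv"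
  proof -
    obtain \<kappa> \<gamma> \<beta> where \<kappa>: "\<kappa> \<in> kerW B e (N - 3) 2 1" and \<gamma>: "\<gamma> \<in> Omega B 1 0" and \<beta>: "\<beta> \<in> Omega B 2 0"
      and split: "?d wt = \<kappa> + (fwedge e \<gamma> + fwedge en \<beta>)"
      unfolding N3 by (rule Omega_21_decomposition[OF B card m e transversal d_mem[OF wt]])
    have \<kappa>': "\<kappa> \<in> Omega B 2 1" using \<kappa> by (simp add: kerW_def)
    obtain v0 t where v0: "v0 \<in> kerW B e (N - 3) 1 2" and t: "t \<in> J" and \<kappa>_eq: "\<kappa> = rho B e v0 + t"
      using J \<kappa>' unfolding complement_in_def by blast
    have v0': "v0 \<in> Omega B 1 2" using v0 by (simp add: kerW_def)
    \<comment> \<open>Both terms lie in the kernel of W, so the J-component \<open>t\<close> belongs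
      to \<T>.\<close>
    have "t = \<kappa> - rho B e v0" using \<kappa>_eq by simp
    then have "t \<in> kerW B e (N - 3) 2 1" using kerW_diff[OF B \<kappa> rho_kerW[OF B e v0]] by simp
    then have tT: "t \<in> T_space B e J" and t': "t \<in> Omega B 2 1" using t by (auto simp: T kerW_def)
    \<comment> \<open>Since \<open>\<rho>\<close> annihilates \<K>, this normalises
      \<open>v0\<close> without changing its image under \<open>\<rho>\<close>.\<close>
    define v where "v = v0 - pK v0"
    have k0: "pK v0 \<in> kerW B e (N - 3) 1 2" "rho B e (pK v0) = 0" "pK v0 \<in> Omega B 1 2"
      using pK_mem[OF v0'] by (auto simp: K)
    have vk: "v \<in> kerW B e (N - 3) 1 2" unfolding v_def by (rule kerW_diff[OF B v0 k0(1)])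
    then have v: "v \<in> Omega B 1 2" and Wv: "W e (N - 3) v = 0" by (auto simp: kerW_def)
    have rv: "rho B e v = rho B e v0" unfolding v_def by (simp add: rho_diff[OF B e v0' k0(3)] k0(2))
    have "pK (pK v0) = pK v0" using pK pK_mem[OF v0'] by (simp add: projection_onto_def)
    then have pKv: "pK v = 0" unfolding v_def by (simp add: projection_onto_diff[OF B pK v0' k0(3)])
    define w where "w = wt - v"
    have w: "w \<in> Omega B 1 2" unfolding w_def by (rule Omega_diff[OF B wt v])
    have z\<gamma>: "fwedge e \<gamma> \<in> Omega B 2 1" and z\<beta>: "fwedge en \<beta> \<in> Omega B 2 1"
      using Omega_fwedge[OF B e \<gamma>] Omega_fwedge[OF B en \<beta>] by (simp_all add: numeral_2_eq_2)
    have "?d w = ?d wt - rho B e v"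
      unfolding d[OF w] d[OF wt] by (simp add: w_def rho_diff[OF B e wt v])
    then have dw: "?d w = t + (fwedge e \<gamma> + fwedge en \<beta>)"
      unfolding split rv \<kappa>_eq by simp
    \<comment> \<open>The new torsion is \<open>t\<close> plus its part in Z. Since
      \<open>pT\<close> fixes the first and kills the second, subtracting the projection leaves just
      the Z-part, which \<open>?\<Phi>\<close> maps into the image of W.\<close>
    have "pT (?d w) = pT t + (pT (fwedge e \<gamma>) + pT (fwedge en \<beta>))"
      unfolding dw using pT t' z\<gamma> z\<beta> Omega_add[OF B z\<gamma> z\<beta>] by (simp add: projection_onto_def)
    moreover have "pT t = t" using pT tT by (simp add: projection_onto_def)
    ultimately have pTd: "pT (?d w) = t"
      using pT_trace \<gamma> pT_transversal \<beta> by simp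
    have "?\<Phi> (?d w) - ?\<Phi> (pT (?d w)) = ?\<Phi> (fwedge e \<gamma> + fwedge en \<beta>)"
      unfolding \<Phi>_diff[symmetric] pTd by (simp add: dw)
    then have "?\<Phi> (?d w) - ?\<Phi> (pT (?d w)) \<in> imW B e (N - 3) 1 1"
      using transversal_wedge_mem_imW[OF B e en \<gamma> \<beta>, of "N - 4"] S by simp
    then have "?P (w, v)" using w v Wv pKv by (simp add: w_def)
    then show ?thesis ..
  qed
  show "wv = wv'" if sol: "?P wv" "?P wv'" for wv wv'
  proof -
    obtain w v w' v' where wv: "wv = (w, v)" "wv' = (w', v')" by (cases wv, cases wv') auto
    have w: "w \<in> Omega B 1 2" "w' \<in> Omega B 1 2" and v: "v \<in> Omega B 1 2" "v' \<in> Omega B 1 2"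
      and s: "wt = w + v" "wt = w' + v'" and Wv: "W e (N - 3) v = 0" "W e (N - 3) v' = 0"
      and im: "?\<Phi> (?d w) - ?\<Phi> (pT (?d w)) \<in> imW B e (N - 3) 1 1"
        "?\<Phi> (?d w') - ?\<Phi> (pT (?d w')) \<in> imW B e (N - 3) 1 1"
      and pKv: "pK v = 0" "pK v' = 0"
      using sol unfolding wv by auto
    \<comment> \<open>Because both pairs have the same sum, \<open>u\<close> is at once a difference
      in the kernel of W and a difference of connections. Hence the difference of the torsions is
      \<open>rho B e u\<close>, again in the kernel.\<close>
    define u where "u = v' - v"
    have u: "u = w - w'" using s by (simp add: u_def algebra_simps)
    have uk: "u \<in> kerW B e (N - 3) 1 2"
      unfolding u_def by (rule kerW_diff[OF B]) (use v Wv in \<open>simp_all add: kerW_def\<close>)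
    then have u': "u \<in> Omega B 1 2" by (simp add: kerW_def)
    define x where "x = rho B e u"
    have x: "x = ?d w - ?d w'"
      unfolding x_def u d[OF w(1)] d[OF w(2)] by (simp add: rho_diff[OF B e w])
    have xk: "x \<in> kerW B e (N - 3) 2 1" unfolding x_def by (rule rho_kerW[OF B e uk])
    then have x': "x \<in> Omega B 2 1" by (simp add: kerW_def)
    have pTx: "pT x = pT (?d w) - pT (?d w')"
      unfolding x by (rule projection_onto_diff[OF B pT d_mem[OF w(1)] d_mem[OF w(2)]])
    obtain C C' where C: "C \<in> Omega B 1 1" "?\<Phi> (?d w) - ?\<Phi> (pT (?d w)) = W e (N - 3) C"
      and C': "C' \<in> Omega B 1 1" "?\<Phi> (?d w') - ?\<Phi> (pT (?d w')) = W e (N - 3) C'"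
      using im unfolding imW_def by blast
    have "?\<Phi> (x - pT x) = (?\<Phi> (?d w) - ?\<Phi> (pT (?d w))) - (?\<Phi> (?d w') - ?\<Phi> (pT (?d w')))"
      unfolding \<Phi>_diff pTx by (simp add: x \<Phi>_diff)
    also have "\<dots> = W e (N - 3) (C - C')" unfolding C(2) C'(2) W_diff ..
    finally have "?\<Phi> (x - pT x) \<in> imW B e (N - 3) 1 1"
      unfolding imW_def using Omega_diff[OF B C(1) C'(1)] by (rule image_eqI)
    moreover have "x - pT x \<in> kerW B e (N - 3) 2 1"
      using pT_mem[OF x'] by (intro kerW_diff[OF B xk]) (simp add: T)
    \<comment> \<open>It follows that \<open>x\<close> lies in \<T>, hence in J. Being also in
      \<open>rho B e\<close> applied to the kernel of W, it vanishes because J is a complement of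
      that image; \<open>u\<close> is then in \<K>, where \<open>pK\<close> is the identity.\<close>
    ultimately have "x - pT x = 0"
      unfolding N3 N4 by (intro transversal_wedge_inj[OF B card m e transversal])
    then have "x = pT x" by simp
    then have "x \<in> J" using pT_mem[OF x'] by (simp add: T)
    then have "x = 0" using J uk unfolding complement_in_def x_def by blast
    then have "u \<in> K_space B e" using uk u' by (simp add: K x_def)
    then have "u = pK u" using pK by (simp add: projection_onto_def)
    also have "\<dots> = pK v' - pK v" unfolding u_def by (rule projection_onto_diff[OF B pK v(2,1)])
    also have "\<dots> = 0" by (simp add: pKv)
    finally have "u = 0" .
    then show ?thesis using u unfolding wv by (simp add: u_def)
  qed
qed

end
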